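(* Let $S$ be a compact connected surface and $f:S\to S$ a Morse-Smale diffeomorphism such that $o(f)=[n]$. Then $S$ is the sphere $S^2$ and $f$ is a North-South dynamical system.
   Context: Morse-Smale: a diffeomorphism $f$ is Morse-Smale if its non-wandering set $\Omega(f)$ is finite (hence consists of periodic points), all periodic points are hyperbolic, and every intersection between a stable manifold and an unstable manifold of periodic points is transverse. North-South dynamical system: the non-wandering set consists of exactly one fixed source and one fixed sink, and every other point converges to the sink under forward iteration and to the source under backward iteration. Orders of growth: $\mathbb N=\{1,2,\dots\}$ and $\mathcal O$ is the set of non-decreasing sequences $a:\mathbb N\to[0,\infty)$. Write $a\approx b$ if there are $c_1,c_2\in(0,\infty)$ with $c_1a(n)\le b(n)\le c_2a(n)$ for all $n$; $\mathbb O=\mathcal O/_{\approx}$, and $[a(n)]$ is the class of $a$. Partial order: $[a(n)]\le[b(n)]$ if there is $C>0$ with $a(n)\le Cb(n)$ for all $n$. $\overline{\mathbb O}\supset\mathbb O$ is the Dedekind-MacNeille completion of $\mathbb O$. Generalized entropy: for a continuous map $f$ of a compact metric space $(M,d)$, let $d^f_n(x,y)=\max_{0\le k\le n-1}d(f^k(x),f^k(y))$, $B(x,n,\varepsilon)=\{y: d^f_n(x,y)<\varepsilon\}$, and let $g_{f,\varepsilon}(n)$ be the minimal cardinality of a finite set $F\subset M$ with $M=\bigcup_{x\in F}B(x,n,\varepsilon)$. Then $o(f)=\sup\{[g_{f,\varepsilon}(n)]:\varepsilon>0\}\in\overline{\mathbb O}$. *)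

theory Defs
  imports "HOL-Analysis.Analysis"
begin

section \<open>Orders of growth\<close>

text \<open>Sequences are indexed by the positive integers; the value at 0 is irrelevant and is
  forgotten by the quotient.\<close>

definition growth_seq :: "(nat \<Rightarrow> real) \<Rightarrow> bool" where
  "growth_seq a \<longleftrightarrow> mono_on {1..} a \<and> (\<forall>n\<ge>1. 0 \<le> a n)"

definition growth_equiv :: "(nat \<Rightarrow> real) \<Rightarrow> (nat \<Rightarrow> real) \<Rightarrow> bool" where
  "growth_equiv a b \<longleftrightarrow> growth_seq a \<and> growth_seq b \<and>
     (\<exists>c1>0. \<exists>c2>0. \<forall>n\<ge>1. c1 * a n \<le> b n \<and> b n \<le> c2 * a n)"

definition growth_le :: "(nat \<Rightarrow> real) \<Rightarrow> (nat \<Rightarrow> real) \<Rightarrow> bool" where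
  "growth_le a b \<longleftrightarrow> (\<exists>C>0. \<forall>n\<ge>1. a n \<le> C * b n)"

lemma growth_le_refl: "growth_le a a"
  unfolding growth_le_def by (rule exI[of _ 1]) simp

lemma growth_le_trans:
  assumes "growth_le a b" "growth_le b c"
  shows "growth_le a c"
proof -
  obtain C D where C: "C > 0" "\<forall>n\<ge>1. a n \<le> C * b n" and D: "D > 0" "\<forall>n\<ge>1. b n \<le> D * c n"
    using assms unfolding growth_le_def by blast
  have "a n \<le> (C * D) * c n" if "n \<ge> 1" for n
  proof -
    have "a n \<le> C * b n" using C that by blast
    also have "\<dots> \<le> C * (D * c n)" using C D that by (intro mult_left_mono) auto
    finally show ?thesis by (simp add: mult.assoc)
  qed
  moreover have "C * D > 0" using C D by simp
  ultimately show ?thesis unfolding growth_le_def by blast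
qed

lemma growth_equiv_iff:
  "growth_equiv a b \<longleftrightarrow> growth_seq a \<and> growth_seq b \<and> growth_le a b \<and> growth_le b a"
proof
  assume "growth_equiv a b"
  then obtain c1 c2 where g: "growth_seq a" "growth_seq b" and c: "c1 > 0" "c2 > 0"
    "\<forall>n\<ge>1. c1 * a n \<le> b n \<and> b n \<le> c2 * a n"
    unfolding growth_equiv_def by blast
  have "\<forall>n\<ge>1. a n \<le> (1 / c1) * b n"
    using c by (auto simp: field_simps)
  moreover have "1 / c1 > 0" using c by simp
  ultimately have "growth_le a b" unfolding growth_le_def by blast
  moreover have "growth_le b a" using c unfolding growth_le_def by blast
  ultimately show "growth_seq a \<and> growth_seq b \<and> growth_le a b \<and> growth_le b a"
    using g by blast
next
  assume r: "growth_seq a \<and> growth_seq b \<and> growth_le a b \<and> growth_le b a"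
  then obtain C D where C: "C > 0" "\<forall>n\<ge>1. a n \<le> C * b n" and D: "D > 0" "\<forall>n\<ge>1. b n \<le> D * a n"
    unfolding growth_le_def by blast
  have "\<forall>n\<ge>1. (1 / C) * a n \<le> b n"
    using C by (auto simp: field_simps)
  moreover have "1 / C > 0" using C by simp
  ultimately show "growth_equiv a b"
    using r D unfolding growth_equiv_def by blast
qed

quotient_type growth_order = "nat \<Rightarrow> real" / partial: growth_equiv
proof (rule part_equivpI)
  have "growth_equiv (\<lambda>_. 0) (\<lambda>_. 0)"
    by (auto simp: growth_equiv_iff growth_le_refl growth_seq_def mono_on_def)
  then show "\<exists>a. growth_equiv a a" by blast
  show "symp growth_equiv"
    by (auto simp: symp_def growth_equiv_iff)
  show "transp growth_equiv"
    by (auto simp: transp_def growth_equiv_iff intro: growth_le_trans)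
qed

instantiation growth_order :: order
begin

lift_definition less_eq_growth_order :: "growth_order \<Rightarrow> growth_order \<Rightarrow> bool" is growth_le
  by (auto simp: growth_equiv_iff intro: growth_le_trans)

definition less_growth_order :: "growth_order \<Rightarrow> growth_order \<Rightarrow> bool" where
  "less_growth_order a b \<longleftrightarrow> a \<le> b \<and> \<not> b \<le> a"

instance
proof
  fix a b c :: growth_order
  show "a < b \<longleftrightarrow> a \<le> b \<and> \<not> b \<le> a" by (rule less_growth_order_def)
  show "a \<le> a" by transfer (rule growth_le_refl)
  show "a \<le> b \<Longrightarrow> b \<le> c \<Longrightarrow> a \<le> c" by transfer (rule growth_le_trans)
  show "a \<le> b \<Longrightarrow> b \<le> a \<Longrightarrow> a = b" by transfer (auto simp: growth_equiv_iff)
qed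

end

section \<open>Dedekind--MacNeille completion\<close>

text \<open>An element of the completion is represented by the lower half of its cut.\<close>

definition upper_bounds :: "'a::order set \<Rightarrow> 'a set" where
  "upper_bounds A = {u. \<forall>a\<in>A. a \<le> u}"

definition lower_bounds :: "'a::order set \<Rightarrow> 'a set" where
  "lower_bounds A = {l. \<forall>a\<in>A. l \<le> a}"

lemma lower_upper_mono: "A \<subseteq> B \<Longrightarrow> lower_bounds (upper_bounds A) \<subseteq> lower_bounds (upper_bounds B)"
  by (auto simp: upper_bounds_def lower_bounds_def)

lemma lower_upper_increasing: "A \<subseteq> lower_bounds (upper_bounds A)"
  by (auto simp: upper_bounds_def lower_bounds_def)

lemma lower_upper_lower: "lower_bounds (upper_bounds (lower_bounds A)) = lower_bounds A"
  by (auto simp: upper_bounds_def lower_bounds_def)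

typedef (overloaded) 'a macneille =
  "{A :: 'a::order set. lower_bounds (upper_bounds A) = A}"
  morphisms lower_cut Abs_macneille
  by (rule exI[of _ "lower_bounds {}"]) (simp add: lower_upper_lower)

setup_lifting type_definition_macneille

lift_definition macneille_embed :: "'a::order \<Rightarrow> 'a macneille" is "\<lambda>x. {..x}"
  by (auto simp: upper_bounds_def lower_bounds_def)

instantiation macneille :: (order) complete_lattice
begin

lift_definition less_eq_macneille :: "'a macneille \<Rightarrow> 'a macneille \<Rightarrow> bool" is "(\<subseteq>)" .

definition less_macneille :: "'a macneille \<Rightarrow> 'a macneille \<Rightarrow> bool" where
  "less_macneille x y \<longleftrightarrow> x \<le> y \<and> \<not> y \<le> x"

lift_definition Sup_macneille :: "'a macneille set \<Rightarrow> 'a macneille"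
  is "\<lambda>X. lower_bounds (upper_bounds (\<Union>X))"
  by (rule lower_upper_lower)

definition Inf_macneille :: "'a macneille set \<Rightarrow> 'a macneille" where
  "Inf_macneille X = Sup {y. \<forall>x\<in>X. y \<le> x}"

definition sup_macneille :: "'a macneille \<Rightarrow> 'a macneille \<Rightarrow> 'a macneille" where
  "sup_macneille x y = Sup {x, y}"

definition inf_macneille :: "'a macneille \<Rightarrow> 'a macneille \<Rightarrow> 'a macneille" where
  "inf_macneille x y = Inf {x, y}"

definition top_macneille :: "'a macneille" where "top_macneille = Inf {}"

definition bot_macneille :: "'a macneille" where "bot_macneille = Sup {}"

instance
proof -
  have upper: "x \<le> Sup X" if "x \<in> X" for x :: "'a macneille" and X
  proof -
    have "lower_cut x \<subseteq> \<Union>(lower_cut ` X)" using that by blast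
    then show ?thesis
      unfolding less_eq_macneille.rep_eq Sup_macneille.rep_eq
      using lower_upper_increasing by (rule subset_trans)
  qed
  have least: "Sup X \<le> z" if "\<And>x. x \<in> X \<Longrightarrow> x \<le> z" for X and z :: "'a macneille"
  proof -
    have "\<Union>(lower_cut ` X) \<subseteq> lower_cut z"
      using that by (auto simp: less_eq_macneille.rep_eq)
    moreover have "lower_bounds (upper_bounds (lower_cut z)) = lower_cut z"
      using lower_cut by blast
    ultimately show ?thesis
      unfolding less_eq_macneille.rep_eq Sup_macneille.rep_eq using lower_upper_mono by metis
  qed
  have refl: "x \<le> x" for x :: "'a macneille" by transfer simp
  have trans: "x \<le> y \<Longrightarrow> y \<le> z \<Longrightarrow> x \<le> z" for x y z :: "'a macneille" by transfer simp
  have lower: "Inf X \<le> x" if "x \<in> X" for x :: "'a macneille" and X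
    unfolding Inf_macneille_def using that by (intro least) blast
  have greatest: "z \<le> Inf X" if "\<And>x. x \<in> X \<Longrightarrow> z \<le> x" for X and z :: "'a macneille"
    unfolding Inf_macneille_def using that by (intro upper) blast
  show "OFCLASS('a macneille, complete_lattice_class)"
  proof
    fix x y z :: "'a macneille" and A :: "'a macneille set"
    show "x < y \<longleftrightarrow> x \<le> y \<and> \<not> y \<le> x" by (rule less_macneille_def)
    show "x \<le> x" by (rule refl)
    show "x \<le> y \<Longrightarrow> y \<le> z \<Longrightarrow> x \<le> z" by (rule trans)
    show "x \<le> y \<Longrightarrow> y \<le> x \<Longrightarrow> x = y" by transfer blast
    show "inf x y \<le> x" "inf x y \<le> y" unfolding inf_macneille_def by (rule lower; simp)+
    show "x \<le> y \<Longrightarrow> x \<le> z \<Longrightarrow> x \<le> inf y z" unfolding inf_macneille_def by (rule greatest) auto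
    show "x \<le> sup x y" "y \<le> sup x y" unfolding sup_macneille_def by (rule upper; simp)+
    show "y \<le> x \<Longrightarrow> z \<le> x \<Longrightarrow> sup y z \<le> x" unfolding sup_macneille_def by (rule least) auto
    show "x \<in> A \<Longrightarrow> Inf A \<le> x" by (rule lower)
    show "(\<And>x. x \<in> A \<Longrightarrow> z \<le> x) \<Longrightarrow> z \<le> Inf A" by (rule greatest)
    show "x \<in> A \<Longrightarrow> x \<le> Sup A" by (rule upper)
    show "(\<And>x. x \<in> A \<Longrightarrow> x \<le> z) \<Longrightarrow> Sup A \<le> z" by (rule least)
    show "Inf {} = (top :: 'a macneille)" by (simp add: top_macneille_def)
    show "Sup {} = (bot :: 'a macneille)" by (simp add: bot_macneille_def)
  qed
qed

end

lemma macneille_embed_le_iff: "macneille_embed x \<le> macneille_embed y \<longleftrightarrow> x \<le> y"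
  by transfer auto

text \<open>The class \<open>[a(n)]\<close> as an element of the completion; meaningful only for \<open>growth_seq a\<close>.\<close>

definition growth_class :: "(nat \<Rightarrow> real) \<Rightarrow> growth_order macneille" where
  "growth_class a = macneille_embed (abs_growth_order a)"

section \<open>Generalized entropy\<close>

definition dyn_dist :: "('a::metric_space \<Rightarrow> 'a) \<Rightarrow> nat \<Rightarrow> 'a \<Rightarrow> 'a \<Rightarrow> real" where
  "dyn_dist f n x y = Max ((\<lambda>k. dist ((f ^^ k) x) ((f ^^ k) y)) ` {..<n})"

definition dyn_ball :: "'a::metric_space set \<Rightarrow> ('a \<Rightarrow> 'a) \<Rightarrow> 'a \<Rightarrow> nat \<Rightarrow> real \<Rightarrow> 'a set" where
  "dyn_ball M f x n \<epsilon> = {y \<in> M. dyn_dist f n x y < \<epsilon>}"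

definition span_number :: "'a::metric_space set \<Rightarrow> ('a \<Rightarrow> 'a) \<Rightarrow> real \<Rightarrow> nat \<Rightarrow> nat" where
  "span_number M f \<epsilon> n =
     (LEAST k. \<exists>F. finite F \<and> F \<subseteq> M \<and> M = (\<Union>x\<in>F. dyn_ball M f x n \<epsilon>) \<and> card F = k)"

definition gen_entropy :: "'a::metric_space set \<Rightarrow> ('a \<Rightarrow> 'a) \<Rightarrow> growth_order macneille" where
  "gen_entropy M f = (SUP \<epsilon>\<in>{0<..}. growth_class (\<lambda>n. real (span_number M f \<epsilon> n)))"

lemma mem_dyn_ball:
  assumes "n \<ge> 1"
  shows "y \<in> dyn_ball M f x n \<epsilon> \<longleftrightarrow> y \<in> M \<and> (\<forall>k<n. dist ((f ^^ k) x) ((f ^^ k) y) < \<epsilon>)"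
proof -
  have "{..<n} \<noteq> {}" using assms by (simp add: lessThan_empty_iff)
  then show ?thesis unfolding dyn_ball_def dyn_dist_def by auto
qed

lemma ex_spanning_set:
  assumes M: "compact M" and f: "continuous_on M f" "f ` M \<subseteq> M" and \<epsilon>: "\<epsilon> > 0" and n: "n \<ge> 1"
  shows "\<exists>F. finite F \<and> F \<subseteq> M \<and> M = (\<Union>x\<in>F. dyn_ball M f x n \<epsilon>)"
proof -
  have iter: "continuous_on M (f ^^ k) \<and> (f ^^ k) ` M \<subseteq> M" for k
  proof (induction k)
    case (Suc k)
    then have "continuous_on M (f \<circ> (f ^^ k))"
      using f by (intro continuous_on_compose) (auto intro: continuous_on_subset)
    then show ?case using Suc f by auto
  qed auto
  have mem: "y \<in> dyn_ball M f x n \<epsilon> \<longleftrightarrow>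
      y \<in> M \<and> (\<forall>k<n. dist ((f ^^ k) x) ((f ^^ k) y) < \<epsilon>)" for x y
    using n by (rule mem_dyn_ball)
  have ball: "dyn_ball M f x n \<epsilon> = (\<Inter>k\<in>{..<n}. M \<inter> (f ^^ k) -` ball ((f ^^ k) x) \<epsilon>)" for x
  proof (rule set_eqI)
    fix y
    have "0 < n" using n by simp
    then show "y \<in> dyn_ball M f x n \<epsilon> \<longleftrightarrow> y \<in> (\<Inter>k\<in>{..<n}. M \<inter> (f ^^ k) -` ball ((f ^^ k) x) \<epsilon>)"
      unfolding mem by auto
  qed
  have "openin (top_of_set M) (dyn_ball M f x n \<epsilon>)" for x
    unfolding ball
  proof (rule openin_Inter)
    show "finite ((\<lambda>k. M \<inter> (f ^^ k) -` ball ((f ^^ k) x) \<epsilon>) ` {..<n})" by simp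
    show "(\<lambda>k. M \<inter> (f ^^ k) -` ball ((f ^^ k) x) \<epsilon>) ` {..<n} \<noteq> {}"
      using n by (simp add: lessThan_empty_iff)
    show "openin (top_of_set M) U"
      if "U \<in> (\<lambda>k. M \<inter> (f ^^ k) -` ball ((f ^^ k) x) \<epsilon>) ` {..<n}" for U
      using that iter by (auto intro: continuous_openin_preimage_gen)
  qed
  moreover have "M \<subseteq> (\<Union>x\<in>M. dyn_ball M f x n \<epsilon>)"
    using \<epsilon> by (auto simp: mem)
  ultimately have "\<exists>D\<subseteq>(\<lambda>x. dyn_ball M f x n \<epsilon>) ` M. finite D \<and> M \<subseteq> \<Union>D"
    using M[unfolded compact_eq_openin_cover, rule_format,
        of "(\<lambda>x. dyn_ball M f x n \<epsilon>) ` M"] by simp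
  then obtain D where D: "D \<subseteq> (\<lambda>x. dyn_ball M f x n \<epsilon>) ` M" "finite D" "M \<subseteq> \<Union>D"
    by (elim exE conjE)
  from finite_subset_image[OF D(2,1)] obtain F
    where F: "F \<subseteq> M" "finite F" "D = (\<lambda>x. dyn_ball M f x n \<epsilon>) ` F"
    by (elim exE conjE)
  have "(\<Union>x\<in>F. dyn_ball M f x n \<epsilon>) \<subseteq> M" by (auto simp: dyn_ball_def)
  then have "M = (\<Union>x\<in>F. dyn_ball M f x n \<epsilon>)"
    using D(3) unfolding F(3) by (rule subset_antisym[rotated])
  then show ?thesis using F(1,2) by (intro exI[of _ F] conjI)
qed

lemma growth_seq_span_number:
  assumes M: "compact M" and f: "continuous_on M f" "f ` M \<subseteq> M" and \<epsilon>: "\<epsilon> > 0"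
  shows "growth_seq (\<lambda>n. real (span_number M f \<epsilon> n))"
proof -
  have "span_number M f \<epsilon> m \<le> span_number M f \<epsilon> n" if "1 \<le> m" "m \<le> n" for m n
  proof -
    have "\<exists>k F. finite F \<and> F \<subseteq> M \<and> M = (\<Union>x\<in>F. dyn_ball M f x n \<epsilon>) \<and> card F = k"
      using ex_spanning_set[OF assms, of n] that by simp
    from LeastI_ex[OF this] obtain F where F: "finite F" "F \<subseteq> M"
      "M = (\<Union>x\<in>F. dyn_ball M f x n \<epsilon>)" "card F = span_number M f \<epsilon> n"
      unfolding span_number_def[symmetric] by (elim exE conjE)
    have "dyn_ball M f x n \<epsilon> \<subseteq> dyn_ball M f x m \<epsilon>" for x
    proof
      fix y
      assume y: "y \<in> dyn_ball M f x n \<epsilon>"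
      have n: "1 \<le> n" using that by linarith
      have "y \<in> M" "\<forall>k<m. dist ((f ^^ k) x) ((f ^^ k) y) < \<epsilon>"
        using y that(2) unfolding mem_dyn_ball[OF n] by simp_all
      then show "y \<in> dyn_ball M f x m \<epsilon>"
        unfolding mem_dyn_ball[OF that(1)] by simp
    qed
    moreover have "dyn_ball M f x m \<epsilon> \<subseteq> M" for x by (auto simp: dyn_ball_def)
    ultimately have "(\<Union>x\<in>F. dyn_ball M f x n \<epsilon>) \<subseteq> (\<Union>x\<in>F. dyn_ball M f x m \<epsilon>)"
      and "(\<Union>x\<in>F. dyn_ball M f x m \<epsilon>) \<subseteq> M"
      by (intro UN_mono UN_least; simp)+
    then have "M = (\<Union>x\<in>F. dyn_ball M f x m \<epsilon>)"
      unfolding F(3)[symmetric] by (intro subset_antisym)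
    then have "\<exists>F'. finite F' \<and> F' \<subseteq> M \<and> M = (\<Union>x\<in>F'. dyn_ball M f x m \<epsilon>) \<and> card F' = card F"
      using F(1,2) by (intro exI[of _ F] conjI refl)
    then show ?thesis
      unfolding span_number_def[of M f \<epsilon> m] F(4)[symmetric] by (rule Least_le)
  qed
  then show ?thesis by (auto simp: growth_seq_def mono_on_def)
qed

section \<open>Surfaces\<close>

text \<open>Surfaces have no boundary. Regularity is \<open>C\<^sup>1\<close>, the weakest one for which diffeomorphisms
  and hyperbolicity make sense, so that every \<open>C\<^sup>r\<close> surface with \<open>1 \<le> r \<le> \<infinity>\<close> is covered.
  The metric may be any metric inducing the topology of the surface. Nothing below
  depends on the values of maps outside the surface.\<close>

definition C1_on :: "'a::real_normed_vector set \<Rightarrow> ('a \<Rightarrow> 'b::real_normed_vector) \<Rightarrow> bool" where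
  "C1_on X f \<longleftrightarrow>
     (\<exists>f'. (\<forall>x\<in>X. (f has_derivative blinfun_apply (f' x)) (at x)) \<and> continuous_on X f')"

type_synonym 'a chart = "'a set \<times> ('a \<Rightarrow> real^2)"

abbreviation chart_inv :: "'a chart \<Rightarrow> real^2 \<Rightarrow> 'a" where
  "chart_inv c \<equiv> inv_into (fst c) (snd c)"

definition is_chart :: "'a::metric_space set \<Rightarrow> 'a chart \<Rightarrow> bool" where
  "is_chart S c \<longleftrightarrow> openin (top_of_set S) (fst c) \<and> open (snd c ` fst c) \<and>
     homeomorphism (fst c) (snd c ` fst c) (snd c) (chart_inv c)"

text \<open>The representative of \<open>g\<close> in the charts \<open>c\<close> and \<open>d\<close>, and the open set on which it lives.\<close>

definition local_rep :: "'a chart \<Rightarrow> 'a chart \<Rightarrow> ('a \<Rightarrow> 'a) \<Rightarrow> real^2 \<Rightarrow> real^2" where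
  "local_rep c d g = snd d \<circ> g \<circ> chart_inv c"

definition local_dom :: "'a chart \<Rightarrow> 'a chart \<Rightarrow> ('a \<Rightarrow> 'a) \<Rightarrow> (real^2) set" where
  "local_dom c d g = snd c ` (fst c \<inter> g -` fst d)"

definition surface_atlas :: "'a::metric_space set \<Rightarrow> 'a chart set \<Rightarrow> bool" where
  "surface_atlas S A \<longleftrightarrow> (\<forall>c\<in>A. is_chart S c) \<and> (\<Union>c\<in>A. fst c) = S \<and>
     (\<forall>c\<in>A. \<forall>d\<in>A. C1_on (local_dom c d id) (local_rep c d id))"

definition C1_map :: "'a::metric_space set \<Rightarrow> 'a chart set \<Rightarrow> ('a \<Rightarrow> 'a) \<Rightarrow> bool" where
  "C1_map S A g \<longleftrightarrow> continuous_on S g \<and> g ` S \<subseteq> S \<and>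
     (\<forall>c\<in>A. \<forall>d\<in>A. C1_on (local_dom c d g) (local_rep c d g))"

definition diffeo :: "'a::metric_space set \<Rightarrow> 'a chart set \<Rightarrow> ('a \<Rightarrow> 'a) \<Rightarrow> bool" where
  "diffeo S A f \<longleftrightarrow> bij_betw f S S \<and> C1_map S A f \<and> C1_map S A (inv_into S f)"

section \<open>Morse--Smale diffeomorphisms\<close>

definition nonwandering :: "'a::metric_space set \<Rightarrow> ('a \<Rightarrow> 'a) \<Rightarrow> 'a set" where
  "nonwandering S f = {x \<in> S. \<forall>U. openin (top_of_set S) U \<and> x \<in> U \<longrightarrow>
     (\<exists>n\<ge>1. (f ^^ n) ` U \<inter> U \<noteq> {})}"

definition periodic_points :: "'a set \<Rightarrow> ('a \<Rightarrow> 'a) \<Rightarrow> 'a set" where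
  "periodic_points S f = {p \<in> S. \<exists>n\<ge>1. (f ^^ n) p = p}"

definition complex_eigenvalue :: "real^'n^'n \<Rightarrow> complex \<Rightarrow> bool" where
  "complex_eigenvalue M \<mu> \<longleftrightarrow>
     (\<exists>v::complex^'n. v \<noteq> 0 \<and> map_matrix complex_of_real M *v v = \<mu> *s v)"

text \<open>Eigenvalues of the differential at \<open>p\<close> of a map \<open>g\<close> fixing \<open>p\<close>. For a \<open>C\<^sup>1\<close> map they do not
  depend on the chart around \<open>p\<close>, and there are such charts whenever \<open>p\<close> lies on the surface.\<close>

definition fixpoint_eigenvalue :: "'a chart set \<Rightarrow> ('a \<Rightarrow> 'a) \<Rightarrow> 'a \<Rightarrow> complex \<Rightarrow> bool" where
  "fixpoint_eigenvalue A g p \<mu> \<longleftrightarrow> (\<exists>c\<in>A. p \<in> fst c \<and>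
     complex_eigenvalue (matrix (frechet_derivative (local_rep c c g) (at (snd c p)))) \<mu>)"

definition hyperbolic_periodic :: "'a chart set \<Rightarrow> ('a \<Rightarrow> 'a) \<Rightarrow> 'a \<Rightarrow> bool" where
  "hyperbolic_periodic A f p \<longleftrightarrow>
     (\<forall>n\<ge>1. (f ^^ n) p = p \<longrightarrow> (\<forall>\<mu>. fixpoint_eigenvalue A (f ^^ n) p \<mu> \<longrightarrow> norm \<mu> \<noteq> 1))"

definition stable_manifold :: "'a::metric_space set \<Rightarrow> ('a \<Rightarrow> 'a) \<Rightarrow> 'a \<Rightarrow> 'a set" where
  "stable_manifold S f p = {x \<in> S. (\<lambda>n. dist ((f ^^ n) x) ((f ^^ n) p)) \<longlonglongrightarrow> 0}"

definition unstable_manifold :: "'a::metric_space set \<Rightarrow> ('a \<Rightarrow> 'a) \<Rightarrow> 'a \<Rightarrow> 'a set" where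
  "unstable_manifold S f p = stable_manifold S (inv_into S f) p"

text \<open>The tangent space of an injectively immersed submanifold \<open>W\<close> at \<open>x\<close>, read in a chart around
  \<open>x\<close>: the velocities at \<open>x\<close> of the \<open>C\<^sup>1\<close> curves contained in \<open>W\<close>.\<close>

definition tangent_space_at :: "'a chart \<Rightarrow> 'a set \<Rightarrow> 'a \<Rightarrow> (real^2) set" where
  "tangent_space_at c W x = {v. \<exists>e>0. \<exists>\<gamma>. \<gamma> 0 = x \<and> \<gamma> ` {-e<..<e} \<subseteq> W \<inter> fst c \<and>
     (snd c \<circ> \<gamma>) C1_differentiable_on {-e<..<e} \<and> ((snd c \<circ> \<gamma>) has_vector_derivative v) (at (0::real))}"

definition transverse :: "'a chart set \<Rightarrow> 'a set \<Rightarrow> 'a set \<Rightarrow> bool" where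
  "transverse A W W' \<longleftrightarrow> (\<forall>x \<in> W \<inter> W'. \<forall>c\<in>A. x \<in> fst c \<longrightarrow>
     {u + v |u v. u \<in> tangent_space_at c W x \<and> v \<in> tangent_space_at c W' x} = UNIV)"

definition morse_smale :: "'a::metric_space set \<Rightarrow> 'a chart set \<Rightarrow> ('a \<Rightarrow> 'a) \<Rightarrow> bool" where
  "morse_smale S A f \<longleftrightarrow> diffeo S A f \<and> finite (nonwandering S f) \<and>
     (\<forall>p\<in>periodic_points S f. hyperbolic_periodic A f p) \<and>
     (\<forall>p\<in>periodic_points S f. \<forall>q\<in>periodic_points S f.
        transverse A (stable_manifold S f p) (unstable_manifold S f q))"

section \<open>North-South dynamics\<close>

definition fixed_source :: "'a set \<Rightarrow> 'a chart set \<Rightarrow> ('a \<Rightarrow> 'a) \<Rightarrow> 'a \<Rightarrow> bool" where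
  "fixed_source S A f p \<longleftrightarrow> p \<in> S \<and> f p = p \<and> (\<forall>\<mu>. fixpoint_eigenvalue A f p \<mu> \<longrightarrow> norm \<mu> > 1)"

definition fixed_sink :: "'a set \<Rightarrow> 'a chart set \<Rightarrow> ('a \<Rightarrow> 'a) \<Rightarrow> 'a \<Rightarrow> bool" where
  "fixed_sink S A f p \<longleftrightarrow> p \<in> S \<and> f p = p \<and> (\<forall>\<mu>. fixpoint_eigenvalue A f p \<mu> \<longrightarrow> norm \<mu> < 1)"

definition north_south :: "'a::metric_space set \<Rightarrow> 'a chart set \<Rightarrow> ('a \<Rightarrow> 'a) \<Rightarrow> bool" where
  "north_south S A f \<longleftrightarrow> (\<exists>p q. p \<noteq> q \<and> nonwandering S f = {p, q} \<and>
     fixed_source S A f p \<and> fixed_sink S A f q \<and>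
     (\<forall>x \<in> S - {p, q}. (\<lambda>n. (f ^^ n) x) \<longlonglongrightarrow> q \<and> (\<lambda>n. (inv_into S f ^^ n) x) \<longlonglongrightarrow> p))"

end

theory Submission
  imports Defs
begin

text \<open>Let \<open>\<Omega>\<close> be the finite non-wandering set and \<open>g = f\<^sup>N\<close> an iterate fixing it pointwise. If the
  orbits of points of a compact set \<open>K\<close> disjoint from \<open>\<Omega>\<close> returned to \<open>K\<close> after infinitely many
  different times \<open>m\<close>, they would accumulate on two wandering points \<open>x\<^sub>1\<close>, \<open>x\<^sub>2\<close>, each visited at most
  once by an orbit, and choosing the two times of visit freely would give more than linearly many
  distinguishable orbits of length \<open>n\<close>. Hence linear growth makes the action of \<open>f\<close> on the complement
  of \<open>\<Omega>\<close> proper. A saddle contradicts this: orbits through points close to it and lying in both the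
  expanding cones of \<open>g\<close> and of its inverse leave a fixed neighbourhood in both directions of time,
  and spend an arbitrarily long time inside. So every point of \<open>\<Omega>\<close> attracts for \<open>g\<close> or for its
  inverse; the basins are open, the complement of \<open>\<Omega>\<close> is connected, and there is exactly one sink \<open>q\<close>
  and one source \<open>p\<close>. Finally the germ of \<open>f\<close> at \<open>q\<close> extends to a homeomorphism of the plane
  contracting everything to the origin; spreading the local conjugacy by the dynamics identifies
  the basin of \<open>q\<close>, which is all of \<open>S\<close> but \<open>p\<close>, with the plane, so that \<open>S\<close> is a sphere.\<close>

section \<open>Hyperbolic real matrices of size two\<close>

text \<open>The entropy hypothesis acts at one scale at a time: for each fixed \<epsilon>, orbits of
  length n are spanned by at most C n points. Counting beats this bound because two parameters are
  free, the time i of one visit and the delay m until the other: t values of i and an unbounded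
  number of values of m do not fit into 2 C t dynamical balls. To use properness against a saddle,
  one compact set must be met twice by the same orbit, with arbitrarily long delays. It is a shell
  around a neighbourhood of the saddle, containing the first exit points in both directions of time.
  One-step cone estimates in linear coordinates are enough to find such orbits; stable manifolds and
  linearisation theorems do not enter. Passing to the iterate \<open>f ^^ N\<close> loses the
  information on \<open>f\<close> itself. It is regained at the end: p and q are limits of orbits,
  hence fixed by \<open>f\<close>, and the dichotomy between attraction and repulsion is then
  applied a second time, to \<open>f\<close>, which yields the eigenvalues. Extending the germ at q
  to a homeomorphism requires a nonlinear part with small Lipschitz constant; the continuity of the
  derivative provides it.\<close>

lemma complex_eigenvalue_2_iff:
  fixes M :: "real^2^2"
  shows "complex_eigenvalue M \<mu> \<longleftrightarrow>
    \<mu>\<^sup>2 - of_real (M$1$1 + M$2$2) * \<mu> + of_real (M$1$1 * M$2$2 - M$1$2 * M$2$1) = 0"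
    (is "_ \<longleftrightarrow> ?\<chi> = 0")
proof -
  define a b c d where "a = complex_of_real (M$1$1)" and "b = complex_of_real (M$1$2)"
    and "c = complex_of_real (M$2$1)" and "d = complex_of_real (M$2$2)"
  note defs = a_def b_def c_def d_def
  have chi: "?\<chi> = (a - \<mu>) * (d - \<mu>) - b * c"
    by (simp add: defs algebra_simps power2_eq_square)
  have ev: "complex_eigenvalue M \<mu> \<longleftrightarrow>
      (\<exists>v::complex^2. v \<noteq> 0 \<and> a * v$1 + b * v$2 = \<mu> * v$1 \<and> c * v$1 + d * v$2 = \<mu> * v$2)"
    unfolding complex_eigenvalue_def defs
    by (simp add: vec_eq_iff forall_2 matrix_vector_mult_def map_matrix_def sum_2)
  show ?thesis
  proof
    assume "complex_eigenvalue M \<mu>"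
    then obtain v :: "complex^2" where v: "v \<noteq> 0"
      "a * v$1 + b * v$2 = \<mu> * v$1" "c * v$1 + d * v$2 = \<mu> * v$2"
      unfolding ev by blast
    have "((a - \<mu>) * (d - \<mu>) - b * c) * v$1 = 0" "((a - \<mu>) * (d - \<mu>) - b * c) * v$2 = 0"
      using v(2,3) by algebra+
    moreover have "v$1 \<noteq> 0 \<or> v$2 \<noteq> 0" using v(1) by (auto simp: vec_eq_iff forall_2)
    ultimately show "?\<chi> = 0" unfolding chi by auto
  next
    assume "?\<chi> = 0"
    then have z: "(a - \<mu>) * (d - \<mu>) = b * c" unfolding chi by simp
    \<comment> \<open>A nonzero row of \<open>M - \<mu>\<close> determines the eigenvector: (a -
      \<mu>, b) annihilates (b, \<mu> - a), and (c, d - \<mu>) annihilates (\<mu> - d, c). The other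
      row follows from the vanishing determinant. In the third case M is scalar.\<close>
    consider "b \<noteq> 0 \<or> \<mu> \<noteq> a" | "c \<noteq> 0 \<or> \<mu> \<noteq> d" | "b = 0" "c = 0" "\<mu> = a" "\<mu> = d" by blast
    then show "complex_eigenvalue M \<mu>"
    proof cases
      case 1
      then show ?thesis unfolding ev using z
        by (intro exI[of _ "vector [b, \<mu> - a]"]) (auto simp: vec_eq_iff forall_2 algebra_simps)
    next
      case 2
      then show ?thesis unfolding ev using z
        by (intro exI[of _ "vector [\<mu> - d, c]"]) (auto simp: vec_eq_iff forall_2 algebra_simps)
    next
      case 3
      then show ?thesis unfolding ev
        by (intro exI[of _ "vector [1, 0]"]) (auto simp: vec_eq_iff forall_2)
    qed
  qed
qed

lemma complex_eigenvalue_2_exists: "\<exists>\<mu>. complex_eigenvalue (M :: real^2^2) \<mu>"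
proof -
  define T D where "T = complex_of_real (M$1$1 + M$2$2)"
    and "D = complex_of_real (M$1$1 * M$2$2 - M$1$2 * M$2$1)"
  define s where "s = csqrt (T\<^sup>2 - 4 * D)"
  define \<mu> where "\<mu> = (T + s) / 2"
  have s: "s\<^sup>2 = T\<^sup>2 - 4 * D" by (simp add: s_def)
  have "s = 2 * \<mu> - T" by (simp add: \<mu>_def add_divide_distrib)
  with s have "\<mu>\<^sup>2 - T * \<mu> + D = 0" by algebra
  then show ?thesis unfolding complex_eigenvalue_2_iff T_def D_def by blast
qed

text \<open>A left eigenvector is a linear coordinate which M multiplies by e. Used as a row of a
  change of coordinates P, it describes P M in terms of P without any inverse matrix.\<close>

lemma left_eigenvector_2:
  fixes M :: "real^2^2"
  assumes "e\<^sup>2 - (M$1$1 + M$2$2) * e + (M$1$1 * M$2$2 - M$1$2 * M$2$1) = 0"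
  obtains w :: "real^2" where "norm w = 1" "\<And>x. w \<bullet> (M *v x) = e * (w \<bullet> x)"
proof -
  have z: "(M$1$1 - e) * (M$2$2 - e) = M$1$2 * M$2$1"
    using assms by (simp add: algebra_simps power2_eq_square)
  have "\<exists>w::real^2. w \<noteq> 0 \<and> w$1 * M$1$1 + w$2 * M$2$1 = e * w$1 \<and> w$1 * M$1$2 + w$2 * M$2$2 = e * w$2"
  proof -
    consider "M$2$1 \<noteq> 0 \<or> e \<noteq> M$1$1" | "M$1$2 \<noteq> 0 \<or> e \<noteq> M$2$2"
      | "M$2$1 = 0" "M$1$2 = 0" "e = M$1$1" "e = M$2$2" by blast
    then show ?thesis
    proof cases
      case 1
      then show ?thesis using z
        by (intro exI[of _ "vector [M$2$1, e - M$1$1]"]) (auto simp: vec_eq_iff forall_2 algebra_simps)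
    next
      case 2
      then show ?thesis using z
        by (intro exI[of _ "vector [e - M$2$2, M$1$2]"]) (auto simp: vec_eq_iff forall_2 algebra_simps)
    next
      case 3
      then show ?thesis
        by (intro exI[of _ "vector [1, 0]"]) (auto simp: vec_eq_iff forall_2)
    qed
  qed
  then obtain w :: "real^2" where w: "w \<noteq> 0"
    "w$1 * M$1$1 + w$2 * M$2$1 = e * w$1" "w$1 * M$1$2 + w$2 * M$2$2 = e * w$2" by blast
  have "w \<bullet> (M *v x) = e * (w \<bullet> x)" for x
  proof -
    have "w \<bullet> (M *v x) = (w$1 * M$1$1 + w$2 * M$2$1) * x$1 + (w$1 * M$1$2 + w$2 * M$2$2) * x$2"
      by (simp add: inner_vec_def sum_2 matrix_vector_mult_def algebra_simps)
    then show ?thesis unfolding w by (simp add: inner_vec_def sum_2 algebra_simps)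
  qed
  then have "norm (w /\<^sub>R norm w) = 1" "(w /\<^sub>R norm w) \<bullet> (M *v x) = e * ((w /\<^sub>R norm w) \<bullet> x)" for x
    using w(1) by simp_all
  then show ?thesis using that by blast
qed

definition pair_map :: "real^2 \<Rightarrow> real^2 \<Rightarrow> real^2 \<Rightarrow> real^2" where
  "pair_map v w x = vector [v \<bullet> x, w \<bullet> x]"

lemma pair_map_nth [simp]: "pair_map v w x $ 1 = v \<bullet> x" "pair_map v w x $ 2 = w \<bullet> x"
  by (simp_all add: pair_map_def)

lemma norm_real2: "norm (x::real^2) = sqrt ((x$1)\<^sup>2 + (x$2)\<^sup>2)"
  by (simp add: norm_vec_def L2_set_def sum_2)

lemma pair_map_linear_bij:
  assumes "v$1 * w$2 - v$2 * w$1 \<noteq> 0"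
  shows "linear (pair_map v w)" "bij (pair_map v w)"
proof -
  show l: "linear (pair_map v w)"
    by (rule linearI) (simp_all add: vec_eq_iff forall_2 inner_add_right)
  have "x = 0" if "pair_map v w x = 0" for x
  proof -
    have "v$1 * x$1 + v$2 * x$2 = 0" "w$1 * x$1 + w$2 * x$2 = 0"
      using that by (simp_all add: vec_eq_iff forall_2 inner_vec_def sum_2)
    then have "(v$1 * w$2 - v$2 * w$1) * x$1 = 0" "(v$1 * w$2 - v$2 * w$1) * x$2 = 0"
      by algebra+
    then show ?thesis using assms by (simp add: vec_eq_iff forall_2)
  qed
  then have "inj (pair_map v w)" using l by (simp add: linear_injective_0)
  then show "bij (pair_map v w)"
    using l linear_inj_imp_surj by (auto simp: bij_def)
qed

text \<open>The quadratic form \<open>x \<mapsto> det (x, M x)\<close> is multiplied by \<open>det M\<close> under \<open>M\<close>, and it is definite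
  when the eigenvalues are not real.\<close>

lemma complex_case_norm:
  fixes M :: "real^2^2"
  assumes "(M$1$1 + M$2$2)\<^sup>2 < 4 * (M$1$1 * M$2$2 - M$1$2 * M$2$1)"
  obtains P :: "real^2 \<Rightarrow> real^2" where "linear P" "bij P"
    "\<And>x. norm (P (M *v x)) = sqrt (M$1$1 * M$2$2 - M$1$2 * M$2$1) * norm (P x)"
proof -
  define a b c d where defs: "a = M$1$1" "b = M$1$2" "c = M$2$1" "d = M$2$2"
  have disc: "(d - a)\<^sup>2 < 4 * (c * - b)"
    using assms unfolding defs by (simp add: power2_eq_square algebra_simps)
  then have "c * - b > 0" by (smt (verit) zero_le_power2)
  then have cb: "c \<noteq> 0" by auto
  define \<sigma> where "\<sigma> = sgn c"
  have s: "\<sigma> * c > 0" "\<sigma>\<^sup>2 = 1" "\<sigma> \<noteq> 0" using cb by (auto simp: \<sigma>_def sgn_if)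
  \<comment> \<open>Here det (x, M x) is c x1^2 + (d - a) x1 x2 - b x2^2. Multiplying by the sign
    \<sigma> of c and completing the square in x1 leaves k as the coefficient of x2^2; P consists of
    the two linear forms that are squared.\<close>
  define k where "k = - (\<sigma> * b) - (d - a)\<^sup>2 / (4 * (\<sigma> * c))"
  have "k * (4 * (\<sigma> * c)) = 4 * \<sigma>\<^sup>2 * (c * - b) - (d - a)\<^sup>2"
    using s(1) by (auto simp: k_def left_diff_distrib power2_eq_square[of \<sigma>])
  then have "k * (4 * (\<sigma> * c)) = 4 * (c * - b) - (d - a)\<^sup>2" using s(2) by simp
  then have k: "k > 0" using disc s(1)
    by (smt (verit) mult_nonpos_nonneg)
  define P where "P = pair_map (vector [sqrt (\<sigma> * c), sqrt (\<sigma> * c) * ((d - a) / (2 * c))]) (vector [0, sqrt k])"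
  have lin: "linear P" "bij P"
    unfolding P_def using s k cb by (intro pair_map_linear_bij; simp)+
  have Q: "(norm (P x))\<^sup>2 = \<sigma> * (c * (x$1)\<^sup>2 + (d - a) * x$1 * x$2 - b * (x$2)\<^sup>2)" for x
  proof -
    have "(norm (P x))\<^sup>2 = (sqrt (\<sigma> * c) * (x$1 + (d - a) / (2 * c) * x$2))\<^sup>2 + (sqrt k * x$2)\<^sup>2"
      unfolding P_def norm_real2 by (simp add: inner_vec_def sum_2 algebra_simps)
    also have "\<dots> = \<sigma> * c * (x$1 + (d - a) / (2 * c) * x$2)\<^sup>2 + k * (x$2)\<^sup>2"
      using s k by (simp add: power_mult_distrib)
    also have "\<dots> = \<sigma> * (c * (x$1)\<^sup>2 + (d - a) * x$1 * x$2 - b * (x$2)\<^sup>2)"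
    proof -
      have "1 / \<sigma> = \<sigma>" using s(2,3) by (simp add: field_simps power2_eq_square)
      moreover have "(d - a)\<^sup>2 / (4 * (\<sigma> * c)) = (1 / \<sigma>) * ((d - a)\<^sup>2 / (4 * c))" by simp
      ultimately have k': "k = - (\<sigma> * b) - \<sigma> * ((d - a)\<^sup>2 / (4 * c))" unfolding k_def by simp
      show ?thesis
        unfolding k' using cb by (simp add: field_simps power2_eq_square)
    qed
    finally show ?thesis .
  qed
  have "(norm (P (M *v x)))\<^sup>2 = (a * d - b * c) * (norm (P x))\<^sup>2" for x
  proof -
    have "(M *v x)$1 = a * x$1 + b * x$2" "(M *v x)$2 = c * x$1 + d * x$2"
      by (simp_all add: defs matrix_vector_mult_def sum_2)
    then show ?thesis unfolding Q by (simp add: algebra_simps power2_eq_square)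
  qed
  then have "sqrt ((norm (P (M *v x)))\<^sup>2) = sqrt ((a * d - b * c) * (norm (P x))\<^sup>2)" for x by simp
  then have "norm (P (M *v x)) = sqrt (a * d - b * c) * norm (P x)" for x
    by (simp add: real_sqrt_mult)
  then show ?thesis using that lin unfolding defs by blast
qed

text \<open>This covers Jordan blocks, for which no diagonal coordinates exist. An orthonormal basis
  makes M triangular, and shrinking the first coordinate makes the off-diagonal entry as small as
  desired. Later \<eta> is half the distance to 1 of the eigenvalue modulus closest to 1.\<close>

lemma real_case_triangular:
  fixes M :: "real^2^2"
  assumes "e\<^sup>2 - (M$1$1 + M$2$2) * e + (M$1$1 * M$2$2 - M$1$2 * M$2$1) = 0" and "\<eta> > 0"
  obtains P :: "real^2 \<Rightarrow> real^2" where "linear P" "bij P"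
    "\<And>x. \<bar>P (M *v x) $ 1 - (M$1$1 + M$2$2 - e) * P x $ 1\<bar> \<le> \<eta> * \<bar>P x $ 2\<bar>"
    "\<And>x. P (M *v x) $ 2 = e * P x $ 2"
proof -
  obtain w :: "real^2" where w: "norm w = 1" "\<And>x. w \<bullet> (M *v x) = e * (w \<bullet> x)"
    using left_eigenvector_2[OF assms(1)] by blast
  have w1: "(w$1)\<^sup>2 + (w$2)\<^sup>2 = 1" using w(1) unfolding norm_real2 by simp
  define v :: "real^2" where "v = vector [- w$2, w$1]"
  have v: "v$1 = - w$2" "v$2 = w$1" by (simp_all add: v_def)
  define b where "b = v \<bullet> (M *v w)"
  \<comment> \<open>In the orthonormal basis v, w the diagonal entries of M add up to the trace, and
    the one belonging to w is e; this identifies the other one.\<close>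
  have dec: "v \<bullet> (M *v x) = (M$1$1 + M$2$2 - e) * (v \<bullet> x) + b * (w \<bullet> x)" for x
  proof -
    have e1: "w$1 * M$1$1 + w$2 * M$2$1 = e * w$1"
      using w(2)[of "axis 1 1"] by (simp add: inner_vec_def sum_2 matrix_vector_mult_def axis_def)
    have e2: "w$1 * M$1$2 + w$2 * M$2$2 = e * w$2"
      using w(2)[of "axis 2 1"] by (simp add: inner_vec_def sum_2 matrix_vector_mult_def axis_def)
    have "v \<bullet> (M *v x) = (- w$2 * M$1$1 + w$1 * M$2$1) * x$1 + (- w$2 * M$1$2 + w$1 * M$2$2) * x$2"
      by (simp add: v inner_vec_def sum_2 matrix_vector_mult_def algebra_simps)
    moreover have "b = (- w$2 * M$1$1 + w$1 * M$2$1) * w$1 + (- w$2 * M$1$2 + w$1 * M$2$2) * w$2"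
      by (simp add: b_def v inner_vec_def sum_2 matrix_vector_mult_def algebra_simps)
    moreover have "v \<bullet> x = - w$2 * x$1 + w$1 * x$2" "w \<bullet> x = w$1 * x$1 + w$2 * x$2"
      by (simp_all add: v inner_vec_def sum_2)
    ultimately show ?thesis using e1 e2 w1 by algebra
  qed
  define \<delta> where "\<delta> = \<eta> / (\<bar>b\<bar> + 1)"
  have \<delta>: "\<delta> > 0" "\<delta> * \<bar>b\<bar> \<le> \<eta>" using assms(2) by (auto simp: \<delta>_def field_simps)
  define P where "P = pair_map (\<delta> *\<^sub>R v) w"
  have nz: "(\<delta> *\<^sub>R v)$1 * w$2 - (\<delta> *\<^sub>R v)$2 * w$1 \<noteq> 0"
  proof -
    have "(\<delta> *\<^sub>R v)$1 * w$2 - (\<delta> *\<^sub>R v)$2 * w$1 = - \<delta> * ((w$1)\<^sup>2 + (w$2)\<^sup>2)"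
      by (simp add: v power2_eq_square algebra_simps)
    then show ?thesis using w1 \<delta> by simp
  qed
  have 1: "\<bar>P (M *v x) $ 1 - (M$1$1 + M$2$2 - e) * P x $ 1\<bar> \<le> \<eta> * \<bar>P x $ 2\<bar>" for x
  proof -
    have "P (M *v x) $ 1 - (M$1$1 + M$2$2 - e) * P x $ 1 = \<delta> * b * (w \<bullet> x)"
      unfolding P_def by (simp add: dec algebra_simps)
    then have "\<bar>P (M *v x) $ 1 - (M$1$1 + M$2$2 - e) * P x $ 1\<bar> = \<delta> * \<bar>b\<bar> * \<bar>w \<bullet> x\<bar>"
      using \<delta> by (simp add: abs_mult)
    then show ?thesis using \<delta> by (simp add: P_def mult_right_mono)
  qed
  have 2: "P (M *v x) $ 2 = e * P x $ 2" for x by (simp add: P_def w)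
  show ?thesis using that[of P] pair_map_linear_bij[OF nz] 1 2 unfolding P_def by blast
qed

text \<open>Left eigenvectors for different eigenvalues are independent, since proportional
  functionals are scaled by the same factor. The cone estimates at a saddle use these
  coordinates.\<close>

lemma real_case_diagonal:
  fixes M :: "real^2^2"
  assumes "a\<^sup>2 - (M$1$1 + M$2$2) * a + (M$1$1 * M$2$2 - M$1$2 * M$2$1) = 0"
    and "b\<^sup>2 - (M$1$1 + M$2$2) * b + (M$1$1 * M$2$2 - M$1$2 * M$2$1) = 0" and "a \<noteq> b"
  obtains P :: "real^2 \<Rightarrow> real^2" where "linear P" "bij P"
    "\<And>x. P (M *v x) $ 1 = a * P x $ 1" "\<And>x. P (M *v x) $ 2 = b * P x $ 2"
proof -
  obtain v :: "real^2" where v: "norm v = 1" "\<And>x. v \<bullet> (M *v x) = a * (v \<bullet> x)"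
    using left_eigenvector_2[OF assms(1)] by blast
  obtain w :: "real^2" where w: "norm w = 1" "\<And>x. w \<bullet> (M *v x) = b * (w \<bullet> x)"
    using left_eigenvector_2[OF assms(2)] by blast
  have w1: "(w$1)\<^sup>2 + (w$2)\<^sup>2 = 1" using w(1) unfolding norm_real2 by simp
  have v1: "(v$1)\<^sup>2 + (v$2)\<^sup>2 = 1" using v(1) unfolding norm_real2 by simp
  have "v$1 * w$2 - v$2 * w$1 \<noteq> 0"
  proof
    assume 0: "v$1 * w$2 - v$2 * w$1 = 0"
    define t where "t = v$1 * w$1 + v$2 * w$2"
    have "v$1 = t * w$1" "v$2 = t * w$2" unfolding t_def using 0 w1 by algebra+
    then have vw: "v = t *\<^sub>R w" by (simp add: vec_eq_iff forall_2)
    then have "t \<noteq> 0" using v(1) by auto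
    have "a * (v \<bullet> w) = v \<bullet> (M *v w)" using v(2) by simp
    also have "\<dots> = t * (w \<bullet> (M *v w))" using vw by simp
    also have "\<dots> = b * (v \<bullet> w)" unfolding w using vw by simp
    finally have "v \<bullet> w = 0" using assms(3) by simp
    then have "t * (w \<bullet> w) = 0" using vw by simp
    then show False using \<open>t \<noteq> 0\<close> w(1) by (simp add: dot_square_norm)
  qed
  from pair_map_linear_bij[OF this] show ?thesis
    using that[of "pair_map v w"] v w by simp
qed

lemma norm_triangular_perturbation:
  fixes y z :: "real^2"
  assumes "\<bar>z$1 - a * y$1\<bar> \<le> \<eta> * \<bar>y$2\<bar>" "z$2 = b * y$2" "\<eta> \<ge> 0"
  shows "norm z \<le> (max \<bar>a\<bar> \<bar>b\<bar> + \<eta>) * norm y" "norm z \<ge> (min \<bar>a\<bar> \<bar>b\<bar> - \<eta>) * norm y"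
proof -
  define u :: "real^2" where "u = vector [a * y$1, b * y$2]"
  have "norm (z - u) = \<bar>z$1 - a * y$1\<bar>"
    unfolding norm_real2 u_def using assms(2) by simp
  also have "\<dots> \<le> \<eta> * norm y"
    using assms(1,3) component_le_norm_cart[of y 2] by (meson mult_left_mono order_trans)
  finally have zu: "norm (z - u) \<le> \<eta> * norm y" .
  have un: "norm u = sqrt (a\<^sup>2 * (y$1)\<^sup>2 + b\<^sup>2 * (y$2)\<^sup>2)"
    unfolding norm_real2 u_def by (simp add: power_mult_distrib)
  define p where "p = max \<bar>a\<bar> \<bar>b\<bar>"
  define q where "q = min \<bar>a\<bar> \<bar>b\<bar>"
  have p: "p \<ge> 0" "a\<^sup>2 \<le> p\<^sup>2" "b\<^sup>2 \<le> p\<^sup>2" unfolding p_def by (auto simp: abs_le_square_iff[symmetric])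
  have q: "q \<ge> 0" "a\<^sup>2 \<ge> q\<^sup>2" "b\<^sup>2 \<ge> q\<^sup>2" unfolding q_def by (auto simp: abs_le_square_iff[symmetric])
  have py: "p * norm y = sqrt (p\<^sup>2 * (y$1)\<^sup>2 + p\<^sup>2 * (y$2)\<^sup>2)"
    unfolding norm_real2 using p by (simp add: real_sqrt_mult distrib_left[symmetric])
  have qy: "q * norm y = sqrt (q\<^sup>2 * (y$1)\<^sup>2 + q\<^sup>2 * (y$2)\<^sup>2)"
    unfolding norm_real2 using q by (simp add: real_sqrt_mult distrib_left[symmetric])
  have "norm u \<le> p * norm y" unfolding un py using p
    by (intro real_sqrt_le_mono add_mono mult_right_mono) auto
  moreover have "norm u \<ge> q * norm y" unfolding un qy using q
    by (intro real_sqrt_le_mono add_mono mult_right_mono) auto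
  moreover have "norm z \<le> norm u + norm (z - u)" by (metis norm_triangle_sub add.commute)
  moreover have "norm u \<le> norm z + norm (z - u)" by (metis norm_minus_commute norm_triangle_sub)
  ultimately show "norm z \<le> (max \<bar>a\<bar> \<bar>b\<bar> + \<eta>) * norm y" "norm z \<ge> (min \<bar>a\<bar> \<bar>b\<bar> - \<eta>) * norm y"
    using zu unfolding p_def[symmetric] q_def[symmetric] by (auto simp: algebra_simps)
qed

text \<open>Eigenvalue bounds control only high powers of M; in the norm of \<open>P x\<close> the
  contraction or expansion is visible in one step. Non-real eigenvalues all have norm
  \<open>sqrt D\<close>, so a saddle has two distinct real ones. The saddle case also returns the
  eigenvalue b, by which it is refuted where all eigenvalues are known to be small.\<close>

lemma hyperbolic_matrix_cases [consumes 1, case_names sink source saddle]: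
  fixes M :: "real^2^2"
  assumes hyp: "\<forall>\<mu>. complex_eigenvalue M \<mu> \<longrightarrow> norm \<mu> \<noteq> 1"
  obtains (sink) P :: "real^2 \<Rightarrow> real^2" and \<kappa> where "linear P" "bij P" "0 \<le> \<kappa>" "\<kappa> < 1"
      "\<And>x. norm (P (M *v x)) \<le> \<kappa> * norm (P x)" "\<And>\<mu>. complex_eigenvalue M \<mu> \<Longrightarrow> norm \<mu> < 1"
    | (source) P :: "real^2 \<Rightarrow> real^2" and \<kappa> where "linear P" "bij P" "\<kappa> > 1"
      "\<And>x. norm (P (M *v x)) \<ge> \<kappa> * norm (P x)" "\<And>\<mu>. complex_eigenvalue M \<mu> \<Longrightarrow> norm \<mu> > 1"
    | (saddle) P :: "real^2 \<Rightarrow> real^2" and a b where "linear P" "bij P" "\<bar>a\<bar> < 1" "1 < \<bar>b\<bar>"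
      "\<And>x. P (M *v x) $ 1 = a * P x $ 1" "\<And>x. P (M *v x) $ 2 = b * P x $ 2"
      "complex_eigenvalue M (of_real b)"
proof -
  define T D where "T = M$1$1 + M$2$2" and "D = M$1$1 * M$2$2 - M$1$2 * M$2$1"
  have ev: "complex_eigenvalue M \<mu> \<longleftrightarrow> \<mu>\<^sup>2 - of_real T * \<mu> + of_real D = 0" for \<mu>
    unfolding complex_eigenvalue_2_iff T_def D_def ..
  show ?thesis
  proof (cases "T\<^sup>2 < 4 * D")
    case True
    then have D: "D > 0" by (smt (verit) zero_le_power2)
    define s where "s = sqrt (4 * D - T\<^sup>2)"
    have s2: "s\<^sup>2 = 4 * D - T\<^sup>2" using True by (simp add: s_def)
    have nrm: "norm \<mu> = sqrt D" if "complex_eigenvalue M \<mu>" for \<mu>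
    proof -
      have "\<mu>\<^sup>2 - of_real T * \<mu> + of_real D = 0" using that ev by blast
      then have re: "(Re \<mu>)\<^sup>2 - (Im \<mu>)\<^sup>2 - T * Re \<mu> + D = 0" and im: "(2 * Re \<mu> - T) * Im \<mu> = 0"
        by (auto simp: complex_eq_iff power2_eq_square algebra_simps)
      have "Im \<mu> \<noteq> 0"
      proof
        assume "Im \<mu> = 0"
        then have "(2 * Re \<mu> - T)\<^sup>2 = T\<^sup>2 - 4 * D" using re by (simp add: power2_eq_square algebra_simps)
        then show False using True by (smt (verit) zero_le_power2)
      qed
      then have "T = 2 * Re \<mu>" using im by simp
      then have "(Re \<mu>)\<^sup>2 + (Im \<mu>)\<^sup>2 = D" using re by (simp add: power2_eq_square)
      then show ?thesis by (simp add: cmod_def)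
    qed
    \<comment> \<open>The hypothesis speaks about eigenvalues only, so one has to be exhibited
      before \<open>sqrt D \<noteq> 1\<close> can be concluded.\<close>
    have "complex_eigenvalue M (Complex (T / 2) (s / 2))"
      unfolding ev using s2 by (simp add: complex_eq_iff power2_eq_square algebra_simps)
    then have "sqrt D \<noteq> 1" using nrm hyp by metis
    obtain P :: "real^2 \<Rightarrow> real^2" where P: "linear P" "bij P" "\<And>x. norm (P (M *v x)) = sqrt D * norm (P x)"
      using complex_case_norm[of M] True unfolding T_def D_def by blast
    show ?thesis
    proof (cases "sqrt D < 1")
      case True
      show ?thesis by (rule sink[OF P(1,2), of "sqrt D"]) (use True P D nrm in auto)
    next
      case False
      show ?thesis by (rule source[OF P(1,2), of "sqrt D"]) (use False \<open>sqrt D \<noteq> 1\<close> P D nrm in auto)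
    qed
  next
    case False
    define a b where "a = (T - sqrt (T\<^sup>2 - 4 * D)) / 2" and "b = (T + sqrt (T\<^sup>2 - 4 * D)) / 2"
    have T: "T = a + b" by (simp add: a_def b_def field_simps)
    have D: "D = a * b"
    proof -
      have "(sqrt (T\<^sup>2 - 4 * D))\<^sup>2 = T\<^sup>2 - 4 * D" using False by simp
      then show ?thesis by (simp add: a_def b_def field_simps power2_eq_square)
    qed
    have ev': "complex_eigenvalue M \<mu> \<longleftrightarrow> \<mu> = of_real a \<or> \<mu> = of_real b" for \<mu>
    proof -
      have "\<mu>\<^sup>2 - of_real T * \<mu> + of_real D = (\<mu> - of_real a) * (\<mu> - of_real b)"
        unfolding T D by (simp add: power2_eq_square algebra_simps)
      then show ?thesis unfolding ev by simp
    qed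
    have ab: "\<bar>a\<bar> \<noteq> 1" "\<bar>b\<bar> \<noteq> 1"
      using hyp ev' by (auto simp: norm_of_real)
    have ra: "a\<^sup>2 - (M$1$1 + M$2$2) * a + (M$1$1 * M$2$2 - M$1$2 * M$2$1) = 0"
      and rb: "b\<^sup>2 - (M$1$1 + M$2$2) * b + (M$1$1 * M$2$2 - M$1$2 * M$2$1) = 0"
      unfolding T_def[symmetric] D_def[symmetric] unfolding T D
      by (simp_all add: power2_eq_square algebra_simps)
    have Tb: "M$1$1 + M$2$2 - b = a" using T unfolding T_def by simp
    consider "\<bar>a\<bar> < 1" "\<bar>b\<bar> < 1" | "\<bar>a\<bar> > 1" "\<bar>b\<bar> > 1" | "\<bar>a\<bar> < 1" "\<bar>b\<bar> > 1" | "\<bar>a\<bar> > 1" "\<bar>b\<bar> < 1"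
      using ab by linarith
    then show ?thesis
    proof cases
      case 1
      define \<eta> where "\<eta> = (1 - max \<bar>a\<bar> \<bar>b\<bar>) / 2"
      have m: "max \<bar>a\<bar> \<bar>b\<bar> < 1" using 1 by simp
      then have \<eta>: "\<eta> > 0" "max \<bar>a\<bar> \<bar>b\<bar> + \<eta> < 1" by (simp_all add: \<eta>_def field_simps)
      obtain P :: "real^2 \<Rightarrow> real^2" where P: "linear P" "bij P" "\<And>x. \<bar>P (M *v x) $ 1 - a * P x $ 1\<bar> \<le> \<eta> * \<bar>P x $ 2\<bar>"
        "\<And>x. P (M *v x) $ 2 = b * P x $ 2"
        using real_case_triangular[OF rb \<eta>(1)] unfolding Tb by blast
      show ?thesis
        by (rule sink[OF P(1,2), of "max \<bar>a\<bar> \<bar>b\<bar> + \<eta>"])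
          (use norm_triangular_perturbation(1)[OF P(3,4)] \<eta> 1 ev' in \<open>auto intro: add_nonneg_nonneg simp: le_max_iff_disj\<close>)
    next
      case 2
      define \<eta> where "\<eta> = (min \<bar>a\<bar> \<bar>b\<bar> - 1) / 2"
      have m: "min \<bar>a\<bar> \<bar>b\<bar> > 1" using 2 by simp
      then have \<eta>: "\<eta> > 0" "min \<bar>a\<bar> \<bar>b\<bar> - \<eta> > 1" by (simp_all add: \<eta>_def field_simps)
      obtain P :: "real^2 \<Rightarrow> real^2" where P: "linear P" "bij P" "\<And>x. \<bar>P (M *v x) $ 1 - a * P x $ 1\<bar> \<le> \<eta> * \<bar>P x $ 2\<bar>"
        "\<And>x. P (M *v x) $ 2 = b * P x $ 2"
        using real_case_triangular[OF rb \<eta>(1)] unfolding Tb by blast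
      show ?thesis
        by (rule source[OF P(1,2), of "min \<bar>a\<bar> \<bar>b\<bar> - \<eta>"])
          (use norm_triangular_perturbation(2)[OF P(3,4)] \<eta> 2 ev' in auto)
    next
      case 3
      then have ne: "a \<noteq> b" by auto
      show ?thesis
      proof (rule real_case_diagonal[OF ra rb ne])
        fix P :: "real^2 \<Rightarrow> real^2"
        assume P: "linear P" "bij P"
          "\<And>x. P (M *v x) $ 1 = a * P x $ 1" "\<And>x. P (M *v x) $ 2 = b * P x $ 2"
        show ?thesis by (rule saddle[OF P(1,2) _ _ P(3,4)]) (use 3 ev' in auto)
      qed
    next
      case 4
      then have ne: "b \<noteq> a" by auto
      show ?thesis
      proof (rule real_case_diagonal[OF rb ra ne])
        fix P :: "real^2 \<Rightarrow> real^2"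
        assume P: "linear P" "bij P"
          "\<And>x. P (M *v x) $ 1 = b * P x $ 1" "\<And>x. P (M *v x) $ 2 = a * P x $ 2"
        show ?thesis by (rule saddle[OF P(1,2) _ _ P(3,4)]) (use 4 ev' in auto)
      qed
    qed
  qed
qed

section \<open>Homeomorphisms and their non-wandering points\<close>

text \<open>The inverse is a second parameter, so that time reversal is a symmetry:
  \<open>inverse\<close> turns each result on f into one on g, and \<open>iterate\<close> transfers
  it to powers.\<close>

locale homeo_pair =
  fixes S :: "'a::metric_space set" and f g :: "'a \<Rightarrow> 'a"
  assumes cont_f: "continuous_on S f" and cont_g: "continuous_on S g"
    and f_in: "\<And>x. x \<in> S \<Longrightarrow> f x \<in> S" and g_in: "\<And>x. x \<in> S \<Longrightarrow> g x \<in> S"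
    and g_f: "\<And>x. x \<in> S \<Longrightarrow> g (f x) = x" and f_g: "\<And>x. x \<in> S \<Longrightarrow> f (g x) = x"
begin

lemma inverse: "homeo_pair S g f"
  by unfold_locales (use cont_f cont_g f_in g_in g_f f_g in auto)

lemma fn_in: "x \<in> S \<Longrightarrow> (f ^^ n) x \<in> S"
  by (induction n) (auto intro: f_in)

lemma gn_in: "x \<in> S \<Longrightarrow> (g ^^ n) x \<in> S"
  by (induction n) (auto intro: g_in)

lemma gn_fn: "x \<in> S \<Longrightarrow> (g ^^ n) ((f ^^ n) x) = x"
proof (induction n arbitrary: x)
  case (Suc n)
  have "(g ^^ Suc n) ((f ^^ Suc n) x) = (g ^^ n) (g (f ((f ^^ n) x)))"
    by (metis funpow_Suc_right funpow.simps(2) comp_apply)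
  then show ?case using Suc fn_in g_f by simp
qed simp

lemma fn_gn: "x \<in> S \<Longrightarrow> (f ^^ n) ((g ^^ n) x) = x"
  by (rule homeo_pair.gn_fn[OF inverse])

lemma cont_fn: "continuous_on S (f ^^ n)"
proof (induction n)
  case (Suc n)
  then have "continuous_on S (f \<circ> (f ^^ n))"
    by (intro continuous_on_compose continuous_on_subset[OF cont_f]) (auto intro: fn_in)
  then show ?case by simp
qed (simp add: id_def)

lemma cont_gn: "continuous_on S (g ^^ n)"
  by (rule homeo_pair.cont_fn[OF inverse])

lemma iterate: "homeo_pair S (f ^^ n) (g ^^ n)"
  by unfold_locales (use cont_fn cont_gn fn_in gn_in gn_fn fn_gn in auto)

lemma gn_fn_le: "x \<in> S \<Longrightarrow> m \<le> n \<Longrightarrow> (g ^^ m) ((f ^^ n) x) = (f ^^ (n - m)) x"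
proof -
  assume "x \<in> S" "m \<le> n"
  then have "(f ^^ n) x = (f ^^ m) ((f ^^ (n - m)) x)"
    by (metis comp_apply funpow_add le_add_diff_inverse)
  then show ?thesis using \<open>x \<in> S\<close> by (simp add: gn_fn fn_in)
qed

lemma fn_gn_le: "x \<in> S \<Longrightarrow> n \<le> m \<Longrightarrow> (f ^^ m) ((g ^^ n) x) = (f ^^ (m - n)) x"
proof -
  assume "x \<in> S" "n \<le> m"
  then have "(f ^^ m) ((g ^^ n) x) = (f ^^ (m - n)) ((f ^^ n) ((g ^^ n) x))"
    by (metis comp_apply funpow_add le_add_diff_inverse2)
  then show ?thesis using \<open>x \<in> S\<close> by (simp add: fn_gn)
qed

lemma openin_preimage_fn:
  assumes "openin (top_of_set S) V"
  shows "openin (top_of_set S) {x \<in> S. (f ^^ n) x \<in> V}"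
proof -
  have "{x \<in> S. (f ^^ n) x \<in> V} = S \<inter> (f ^^ n) -` V" by auto
  then show ?thesis
    using continuous_openin_preimage[OF cont_fn[of n] _ assms] fn_in by auto
qed

lemma nonwandering_subset: "nonwandering S f \<subseteq> S"
  by (auto simp: nonwandering_def)

lemma wandering_nbhd:
  assumes "x \<in> S" "x \<notin> nonwandering S f"
  obtains e where "e > 0"
    "\<And>y n. y \<in> S \<Longrightarrow> dist x y < e \<Longrightarrow> dist x ((f ^^ n) y) < e \<Longrightarrow> n = 0"
proof -
  obtain U where U: "openin (top_of_set S) U" "x \<in> U" "\<And>n. n \<ge> 1 \<Longrightarrow> (f ^^ n) ` U \<inter> U = {}"
    using assms unfolding nonwandering_def by blast
  obtain e where e: "e > 0" "ball x e \<inter> S \<subseteq> U"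
    using U(1,2) unfolding openin_contains_ball by blast
  show ?thesis
  proof (rule that[OF e(1)])
    fix y n
    assume y: "y \<in> S" "dist x y < e" "dist x ((f ^^ n) y) < e"
    have "y \<in> U" "(f ^^ n) y \<in> U" using y e(2) fn_in by auto
    then show "n = 0" using U(3)[of n] by (cases "n = 0") auto
  qed
qed

text \<open>Two successive terms close to z exhibit a return to a neighbourhood of z after a
  positive time.\<close>

lemma limit_point_nonwandering:
  assumes x: "x \<in> S" and r: "strict_mono r" and z: "z \<in> S" and lim: "(\<lambda>k. (f ^^ r k) x) \<longlonglongrightarrow> z"
  shows "z \<in> nonwandering S f"
proof (rule ccontr)
  assume "z \<notin> nonwandering S f"
  then obtain e where e: "e > 0"
    "\<And>y n. y \<in> S \<Longrightarrow> dist z y < e \<Longrightarrow> dist z ((f ^^ n) y) < e \<Longrightarrow> n = 0"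
    using wandering_nbhd z by blast
  obtain K where K: "\<And>k. k \<ge> K \<Longrightarrow> dist ((f ^^ r k) x) z < e"
    using lim e(1) unfolding lim_sequentially by blast
  have lt: "r K < r (Suc K)" using r by (simp add: strict_mono_def)
  have "(f ^^ (r (Suc K) - r K)) ((f ^^ r K) x) = (f ^^ r (Suc K)) x"
    using lt by (metis comp_apply funpow_add le_add_diff_inverse2 less_imp_le)
  then have "r (Suc K) - r K = 0"
    using e(2)[of "(f ^^ r K) x" "r (Suc K) - r K"] K[of K] K[of "Suc K"] fn_in[OF x]
    by (simp add: dist_commute)
  then show False using lt by simp
qed

lemma nonwandering_inverse_subset: "nonwandering S f \<subseteq> nonwandering S g"
proof
  fix x assume x: "x \<in> nonwandering S f"
  show "x \<in> nonwandering S g" unfolding nonwandering_def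
  proof (intro CollectI conjI allI impI)
    show "x \<in> S" using x nonwandering_subset by blast
    fix U assume U: "openin (top_of_set S) U \<and> x \<in> U"
    then obtain n y where n: "n \<ge> 1" "y \<in> U" "(f ^^ n) y \<in> U"
      using x unfolding nonwandering_def by blast
    then have "y \<in> S" using U openin_imp_subset by blast
    then have "y \<in> (g ^^ n) ` U \<inter> U" using n gn_fn[of y n] by (metis IntI imageI)
    then show "\<exists>n\<ge>1. (g ^^ n) ` U \<inter> U \<noteq> {}" using n(1) by blast
  qed
qed

lemma nonwandering_inverse: "nonwandering S g = nonwandering S f"
  using nonwandering_inverse_subset homeo_pair.nonwandering_inverse_subset[OF inverse] by blast

lemma f_nonwandering: "x \<in> nonwandering S f \<Longrightarrow> f x \<in> nonwandering S f"
proof -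
  assume x: "x \<in> nonwandering S f"
  then have xS: "x \<in> S" using nonwandering_subset by blast
  show ?thesis unfolding nonwandering_def
  proof (intro CollectI conjI allI impI)
    show "f x \<in> S" using xS f_in by blast
    fix U assume U: "openin (top_of_set S) U \<and> f x \<in> U"
    then have "openin (top_of_set S) {y \<in> S. f y \<in> U}"
      using openin_preimage_fn[of U 1] by simp
    moreover have "x \<in> {y \<in> S. f y \<in> U}" using U xS by blast
    ultimately obtain n y where n: "n \<ge> 1" "y \<in> S" "f y \<in> U" "f ((f ^^ n) y) \<in> U"
      using x unfolding nonwandering_def by blast
    then have "(f ^^ n) (f y) \<in> (f ^^ n) ` U \<inter> U" by (simp add: funpow_swap1)
    then show "\<exists>n\<ge>1. (f ^^ n) ` U \<inter> U \<noteq> {}" using n(1) by blast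
  qed
qed

lemma fn_nonwandering: "x \<in> nonwandering S f \<Longrightarrow> (f ^^ n) x \<in> nonwandering S f"
  by (induction n) (auto intro: f_nonwandering)

text \<open>The orbit of a non-wandering point stays in a finite set, so two of its positions
  coincide; undoing the earlier number of steps gives a period. The product of the chosen periods is
  a common multiple.\<close>

lemma finite_nonwandering_period:
  assumes fin: "finite (nonwandering S f)"
  obtains N where "N \<ge> 1" "\<And>x. x \<in> nonwandering S f \<Longrightarrow> (f ^^ N) x = x"
proof -
  let ?\<Omega> = "nonwandering S f"
  have "\<exists>n\<ge>1. (f ^^ n) x = x" if x: "x \<in> ?\<Omega>" for x
  proof -
    have xS: "x \<in> S" using x nonwandering_subset by blast
    have "range (\<lambda>n. (f ^^ n) x) \<subseteq> ?\<Omega>" using fn_nonwandering[OF x] by blast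
    then have "\<not> inj (\<lambda>n. (f ^^ n) x)"
      using fin finite_subset finite_imageD infinite_UNIV_nat by (metis (no_types, lifting))
    then obtain a b where ab: "a \<noteq> b" "(f ^^ a) x = (f ^^ b) x" unfolding inj_def by blast
    have *: "\<exists>n\<ge>1. (f ^^ n) x = x" if "a < b" "(f ^^ a) x = (f ^^ b) x" for a b
    proof -
      have "(f ^^ (b - a)) x = x" using gn_fn_le[OF xS, of a b] gn_fn[OF xS, of a] that by simp
      then show ?thesis using that by (intro exI[of _ "b - a"]) auto
    qed
    show ?thesis using ab *[of a b] *[of b a] by (cases "a < b") auto
  qed
  then obtain per where per: "\<And>x. x \<in> ?\<Omega> \<Longrightarrow> per x \<ge> 1 \<and> (f ^^ per x) x = x" by metis
  define N where "N = (\<Prod>x\<in>?\<Omega>. per x)"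
  show ?thesis
  proof (rule that)
    show "N \<ge> 1" unfolding N_def using per by (intro prod_ge_1) auto
    fix x assume x: "x \<in> ?\<Omega>"
    then have "per x dvd N" unfolding N_def using fin by (intro dvd_prodI) auto
    then obtain k where "N = per x * k" by (elim dvdE)
    moreover have "((f ^^ per x) ^^ k) x = x" using per[OF x] by (induction k) auto
    ultimately show "(f ^^ N) x = x" by (simp add: funpow_mult)
  qed
qed

text \<open>An orbit that is eventually close to the finite set \<open>R\<close> of fixed points cannot jump from
  one of them to another.\<close>

lemma orbit_converges:
  assumes S: "compact S" and R: "finite R" "R \<subseteq> S" "\<And>p. p \<in> R \<Longrightarrow> f p = p"
    and lim: "\<And>z r. strict_mono r \<Longrightarrow> z \<in> S \<Longrightarrow> (\<lambda>k. (f ^^ r k) x) \<longlonglongrightarrow> z \<Longrightarrow> z \<in> R" and x: "x \<in> S"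
  obtains p where "p \<in> R" "(\<lambda>n. (f ^^ n) x) \<longlonglongrightarrow> p"
proof -
  have sub: "\<exists>s l. strict_mono s \<and> l \<in> R \<and> (\<lambda>k. (f ^^ r (s k)) x) \<longlonglongrightarrow> l" if "strict_mono r" for r :: "nat \<Rightarrow> nat"
  proof -
    have "\<forall>k. (f ^^ r k) x \<in> S" using fn_in x by blast
    then obtain l s where s: "l \<in> S" "strict_mono s" "((\<lambda>k. (f ^^ r k) x) \<circ> s) \<longlonglongrightarrow> l"
      using S[unfolded compact_def, rule_format, of "\<lambda>k. (f ^^ r k) x"] by blast
    then have "l \<in> R" using lim[of "r \<circ> s" l] that strict_mono_o[of r s] by (simp add: o_def)
    then show ?thesis using s by (auto simp: o_def)
  qed
  obtain s p where p: "p \<in> R" "strict_mono s" "(\<lambda>k. (f ^^ s k) x) \<longlonglongrightarrow> p"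
    using sub[of id] by (auto simp: strict_mono_def)
  have pS: "p \<in> S" using p R by blast
  obtain d where d: "d > 0" "\<And>q. q \<in> R \<Longrightarrow> q \<noteq> p \<Longrightarrow> d \<le> dist p q"
    using finite_set_avoid[OF R(1), of p] by blast
  have "\<exists>e>0. \<forall>y\<in>S. dist y p < e \<longrightarrow> dist (f y) p < d / 2"
  proof -
    have "\<forall>e>0. \<exists>e'>0. \<forall>y\<in>S. dist y p < e' \<longrightarrow> dist (f y) (f p) < e"
      using cont_f pS unfolding continuous_on_iff by blast
    then show ?thesis using d(1) R(3)[OF p(1)] by (metis half_gt_zero)
  qed
  then obtain e0 where e0: "e0 > 0" "\<And>y. y \<in> S \<Longrightarrow> dist y p < e0 \<Longrightarrow> dist (f y) p < d / 2" by blast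
  have "(\<lambda>n. (f ^^ n) x) \<longlonglongrightarrow> p"
    unfolding lim_sequentially
  proof (rule allI, rule impI)
    fix e' :: real assume "e' > 0"
    define e where "e = Min {e', e0, d / 2}"
    have e: "e > 0" "e \<le> e'" "e \<le> e0" "e \<le> d / 2" using \<open>e' > 0\<close> e0 d by (auto simp: e_def)
    \<comment> \<open>Otherwise the orbit leaves the ball of radius e infinitely often. Its
      positions just after leaving accumulate at some l in R. By the choice of \<open>e0\<close>
      they stay within d / 2 of p, where d separates p from the rest of R, so l = p; but they also
      stay at distance at least e.\<close>
    have "\<exists>n0. \<forall>n\<ge>n0. dist ((f ^^ n) x) p < e \<longrightarrow> dist ((f ^^ Suc n) x) p < e"
    proof (rule ccontr)
      assume "\<not> ?thesis"
      then have "\<forall>n0. \<exists>n\<ge>n0. dist ((f ^^ n) x) p < e \<and> \<not> dist ((f ^^ Suc n) x) p < e" by blast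
      then have "infinite {n. dist ((f ^^ n) x) p < e \<and> \<not> dist ((f ^^ Suc n) x) p < e}"
        unfolding infinite_nat_iff_unbounded_le by blast
      from infinite_enumerate[OF this] obtain r :: "nat \<Rightarrow> nat" where r: "strict_mono r"
        "\<And>n. dist ((f ^^ r n) x) p < e \<and> \<not> dist ((f ^^ Suc (r n)) x) p < e" by blast
      obtain s l where s: "strict_mono s" "l \<in> R" "(\<lambda>k. (f ^^ Suc (r (s k))) x) \<longlonglongrightarrow> l"
        using sub[of "Suc \<circ> r"] r(1) by (auto simp: strict_mono_def)
      have far: "dist ((f ^^ Suc (r (s k))) x) p < d / 2" for k
        using e0(2)[of "(f ^^ r (s k)) x"] r(2)[of "s k"] e fn_in[OF x] by simp
      have limd: "(\<lambda>k. dist ((f ^^ Suc (r (s k))) x) p) \<longlonglongrightarrow> dist l p"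
        using s(3) by (intro tendsto_dist tendsto_const)
      have "dist l p \<le> d / 2"
        by (rule LIMSEQ_le_const2[OF limd]) (use far in \<open>auto intro: less_imp_le\<close>)
      then have "l = p" using d(1) d(2)[OF s(2)] by (cases "l = p") (auto simp: dist_commute)
      moreover have "e \<le> dist l p"
        by (rule LIMSEQ_le_const[OF limd]) (use r(2) in \<open>auto simp: not_less\<close>)
      ultimately show False using e by simp
    qed
    then obtain n0 where n0: "\<And>n. n \<ge> n0 \<Longrightarrow> dist ((f ^^ n) x) p < e \<Longrightarrow> dist ((f ^^ Suc n) x) p < e"
      by blast
    obtain k0 where k0: "\<And>k. k \<ge> k0 \<Longrightarrow> dist ((f ^^ s k) x) p < e"
      using p(3) e(1) unfolding lim_sequentially by blast
    define k where "k = max n0 k0"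
    have sk: "s k \<ge> n0" "dist ((f ^^ s k) x) p < e"
      using seq_suble[OF p(2), of k] k0[of k] by (auto simp: k_def)
    have "dist ((f ^^ n) x) p < e" if "n \<ge> s k" for n
      using that
    proof (induction n rule: dec_induct)
      case (step n)
      then show ?case using n0[of n] sk(1) by (simp del: funpow.simps)
    qed (rule sk(2))
    then show "\<exists>no. \<forall>n\<ge>no. dist ((f ^^ n) x) p < e'"
      using e(2) by (meson less_le_trans)
  qed
  then show ?thesis using that p(1) by blast
qed

end

section \<open>Linear growth, attractors and connectedness\<close>

lemma growth_class_le_iff:
  assumes "growth_seq a" "growth_seq b"
  shows "growth_class a \<le> growth_class b \<longleftrightarrow> growth_le a b"
  unfolding growth_class_def macneille_embed_le_iff
  using assms by (intro less_eq_growth_order.abs_eq) (simp_all add: growth_equiv_iff growth_le_refl)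

context homeo_pair
begin

text \<open>The supremum dominates the class of the spanning numbers at each \<epsilon>. The
  constant C depends on \<epsilon> but not on n, which is why it is quantified before n.\<close>

lemma spanning_set_linear:
  assumes S: "compact S" and ent: "gen_entropy S f = growth_class (\<lambda>n. real n)" and \<epsilon>: "\<epsilon> > 0"
  shows "\<exists>C. \<forall>n\<ge>1.
    \<exists>F. finite F \<and> F \<subseteq> S \<and> S = (\<Union>x\<in>F. dyn_ball S f x n \<epsilon>) \<and> real (card F) \<le> C * real n"
proof -
  have fS: "f ` S \<subseteq> S" using f_in by blast
  have "growth_class (\<lambda>n. real (span_number S f \<epsilon> n)) \<le> gen_entropy S f"
    unfolding gen_entropy_def using \<epsilon> by (intro SUP_upper) simp
  moreover have "growth_seq (\<lambda>n. real n)" by (auto simp: growth_seq_def mono_on_def)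
  ultimately have "growth_le (\<lambda>n. real (span_number S f \<epsilon> n)) (\<lambda>n. real n)"
    unfolding ent using growth_seq_span_number[OF S cont_f fS \<epsilon>] by (simp add: growth_class_le_iff)
  then obtain C where C: "\<And>n. n \<ge> 1 \<Longrightarrow> real (span_number S f \<epsilon> n) \<le> C * real n"
    unfolding growth_le_def by blast
  show ?thesis
  proof (intro exI[of _ C] allI impI)
    fix n :: nat assume n: "n \<ge> 1"
    have "\<exists>k F. finite F \<and> F \<subseteq> S \<and> S = (\<Union>x\<in>F. dyn_ball S f x n \<epsilon>) \<and> card F = k"
      using ex_spanning_set[OF S cont_f fS \<epsilon> n] by simp
    from LeastI_ex[OF this] obtain F where "finite F" "F \<subseteq> S"
      "S = (\<Union>x\<in>F. dyn_ball S f x n \<epsilon>)" "card F = span_number S f \<epsilon> n"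
      unfolding span_number_def[symmetric] by (elim exE conjE)
    then show "\<exists>F. finite F \<and> F \<subseteq> S \<and> S = (\<Union>x\<in>F. dyn_ball S f x n \<epsilon>) \<and> real (card F) \<le> C * real n"
      using C[OF n] by metis
  qed
qed

text \<open>Visits at times m and n with m at most n are a return of the point
  \<open>(f ^^ m) y\<close> after n - m steps, and wandering forces n - m = 0.\<close>

lemma wandering_visit_once:
  assumes "x \<in> S" "x \<notin> nonwandering S f"
  obtains e where "e > 0"
    "\<And>y m n. y \<in> S \<Longrightarrow> dist x ((f ^^ m) y) < e \<Longrightarrow> dist x ((f ^^ n) y) < e \<Longrightarrow> m = n"
proof -
  obtain e where e: "e > 0"
    "\<And>y n. y \<in> S \<Longrightarrow> dist x y < e \<Longrightarrow> dist x ((f ^^ n) y) < e \<Longrightarrow> n = 0"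
    using wandering_nbhd assms by blast
  have le: "m = n" if "y \<in> S" "dist x ((f ^^ m) y) < e" "dist x ((f ^^ n) y) < e" "m \<le> n" for y m n
  proof -
    have "(f ^^ (n - m)) ((f ^^ m) y) = (f ^^ n) y"
      using \<open>m \<le> n\<close> by (metis comp_apply funpow_add le_add_diff_inverse2)
    then show ?thesis using e(2)[of "(f ^^ m) y" "n - m"] that fn_in by auto
  qed
  show ?thesis
  proof (rule that[OF e(1)])
    fix y m n assume "y \<in> S" "dist x ((f ^^ m) y) < e" "dist x ((f ^^ n) y) < e"
    then show "m = n" using le[of y m n] le[of y n m] by (cases "m \<le> n") auto
  qed
qed

text \<open>If the orbits of points \<open>y\<^sub>m\<close> near a wandering point \<open>x\<^sub>1\<close> pass near a wandering point \<open>x\<^sub>2\<close>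
  at time \<open>m\<close>, for all \<open>m\<close> in an infinite set \<open>M\<close>, then the points \<open>f\<^sup>-\<^sup>i y\<^sub>m\<close> with \<open>i, m < t\<close> are
  told apart up to time \<open>2 t\<close> by the instants \<open>i\<close> and \<open>i + m\<close> at which they visit \<open>x\<^sub>1\<close> and \<open>x\<^sub>2\<close>.
  Their number is \<open>t\<close> times an unbounded factor.\<close>

lemma linear_entropy_imp_proper_on_wandering:
  assumes S: "compact S" and ent: "gen_entropy S f = growth_class (\<lambda>n. real n)"
    and K: "compact K" "K \<subseteq> S" "K \<inter> nonwandering S f = {}"
  shows "\<exists>m0. \<forall>m\<ge>m0. (f ^^ m) ` K \<inter> K = {}"
proof (rule ccontr)
  assume "\<not> ?thesis"
  then have "\<forall>m0. \<exists>m\<ge>m0. m \<in> {m. (f ^^ m) ` K \<inter> K \<noteq> {}}" by blast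
  then have "infinite {m. (f ^^ m) ` K \<inter> K \<noteq> {}}"
    unfolding infinite_nat_iff_unbounded_le by blast
  from infinite_enumerate[OF this] obtain r :: "nat \<Rightarrow> nat" where r: "strict_mono r"
    "\<And>k. (f ^^ r k) ` K \<inter> K \<noteq> {}" by blast
  have "\<forall>k. \<exists>y. y \<in> K \<and> (f ^^ r k) y \<in> K" using r(2) by blast
  then obtain y where y: "\<And>k. y k \<in> K" "\<And>k. (f ^^ r k) (y k) \<in> K" by metis
  have "compact (K \<times> K)" using K by (simp add: compact_Times)
  then obtain l s where ls: "l \<in> K \<times> K" "strict_mono s"
    "((\<lambda>k. (y k, (f ^^ r k) (y k))) \<circ> s) \<longlonglongrightarrow> l"
    using \<open>compact (K \<times> K)\<close>[unfolded compact_def, rule_format, of "\<lambda>k. (y k, (f ^^ r k) (y k))"] y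
    by blast
  define x1 x2 where "x1 = fst l" and "x2 = snd l"
  have lim: "(\<lambda>k. y (s k)) \<longlonglongrightarrow> x1" "(\<lambda>k. (f ^^ r (s k)) (y (s k))) \<longlonglongrightarrow> x2"
    using tendsto_fst[OF ls(3)] tendsto_snd[OF ls(3)] by (simp_all add: x1_def x2_def o_def)
  have "x1 \<in> K" "x2 \<in> K" using ls(1) by (auto simp: x1_def x2_def)
  then have x: "x1 \<in> S" "x1 \<notin> nonwandering S f" "x2 \<in> S" "x2 \<notin> nonwandering S f"
    using K by auto
  obtain e1 where e1: "e1 > 0"
    "\<And>y m n. y \<in> S \<Longrightarrow> dist x1 ((f ^^ m) y) < e1 \<Longrightarrow> dist x1 ((f ^^ n) y) < e1 \<Longrightarrow> m = n"
    using wandering_visit_once[OF x(1,2)] by blast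
  obtain e2 where e2: "e2 > 0"
    "\<And>y m n. y \<in> S \<Longrightarrow> dist x2 ((f ^^ m) y) < e2 \<Longrightarrow> dist x2 ((f ^^ n) y) < e2 \<Longrightarrow> m = n"
    using wandering_visit_once[OF x(3,4)] by blast
  \<comment> \<open>Half, because two errors add up: the constructed orbit passes within \<epsilon>
    of x1 and x2, and the centre of the dynamical ball follows it within \<epsilon>.\<close>
  define \<epsilon> where "\<epsilon> = min e1 e2 / 2"
  have \<epsilon>: "\<epsilon> > 0" "2 * \<epsilon> \<le> e1" "2 * \<epsilon> \<le> e2" using e1(1) e2(1) by (auto simp: \<epsilon>_def)
  obtain k1 where k1: "\<And>k. k \<ge> k1 \<Longrightarrow> dist (y (s k)) x1 < \<epsilon>"
    using lim(1) \<epsilon>(1) unfolding lim_sequentially by blast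
  obtain k2 where k2: "\<And>k. k \<ge> k2 \<Longrightarrow> dist ((f ^^ r (s k)) (y (s k))) x2 < \<epsilon>"
    using lim(2) \<epsilon>(1) unfolding lim_sequentially by blast
  define M where "M = (\<lambda>k. r (s k)) ` {max k1 k2..}"
  have "inj (\<lambda>k. r (s k))"
    using strict_mono_imp_inj_on[OF strict_mono_o[OF r(1) ls(2)]] by (simp add: o_def)
  then have "infinite M" unfolding M_def
    using finite_imageD[OF _ inj_on_subset[OF _ subset_UNIV]] infinite_Ici by blast
  have "\<forall>m\<in>M. \<exists>y. y \<in> S \<and> dist y x1 < \<epsilon> \<and> dist ((f ^^ m) y) x2 < \<epsilon>"
  proof
    fix m assume "m \<in> M"
    then obtain k where "m = r (s k)" "k \<ge> k1" "k \<ge> k2" by (auto simp: M_def)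
    then show "\<exists>y. y \<in> S \<and> dist y x1 < \<epsilon> \<and> dist ((f ^^ m) y) x2 < \<epsilon>"
      using k1[of k] k2[of k] y(1)[of "s k"] K(2) by (intro exI[of _ "y (s k)"]) auto
  qed
  then obtain Y where Y: "\<And>m. m \<in> M \<Longrightarrow> Y m \<in> S" "\<And>m. m \<in> M \<Longrightarrow> dist (Y m) x1 < \<epsilon>"
    "\<And>m. m \<in> M \<Longrightarrow> dist ((f ^^ m) (Y m)) x2 < \<epsilon>" by metis
  obtain C where C: "\<And>n. n \<ge> 1 \<Longrightarrow>
    \<exists>F. finite F \<and> F \<subseteq> S \<and> S = (\<Union>x\<in>F. dyn_ball S f x n \<epsilon>) \<and> real (card F) \<le> C * real n"
    using spanning_set_linear[OF S ent \<epsilon>(1)] by blast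
  have bound: "real (card (M \<inter> {..<t})) \<le> 2 * C" if t: "t \<ge> 1" for t
  proof -
    obtain F where F: "finite F" "F \<subseteq> S" "S = (\<Union>x\<in>F. dyn_ball S f x (2 * t) \<epsilon>)"
      "real (card F) \<le> C * real (2 * t)"
      using C[of "2 * t"] t by (auto simp del: of_nat_mult)
    \<comment> \<open>For i, m < t both visits, at times i and i + m, happen before 2 t and are
      therefore seen by dynamical balls of length 2 t. The centre \<open>h a\<close> assigned to a
      pair visits each of x1 and x2 at most once, so it determines the pair.\<close>
    define I where "I = {..<t} \<times> (M \<inter> {..<t})"
    have "\<exists>x\<in>F. dist x1 ((f ^^ fst a) x) < e1 \<and> dist x2 ((f ^^ (fst a + snd a)) x) < e2"
      if a: "a \<in> I" for a
    proof -
      obtain i m where im: "a = (i, m)" "i < t" "m < t" "m \<in> M" using a by (auto simp: I_def)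
      define z where "z = (g ^^ i) (Y m)"
      have z: "z \<in> S" using Y(1)[OF im(4)] gn_in by (simp add: z_def)
      then obtain x where x: "x \<in> F" "z \<in> dyn_ball S f x (2 * t) \<epsilon>" using F(3) by blast
      have near: "dist ((f ^^ k) x) ((f ^^ k) z) < \<epsilon>" if "k < 2 * t" for k
        using x(2) that t by (simp add: mem_dyn_ball)
      have fi: "(f ^^ i) z = Y m" using Y(1)[OF im(4)] by (simp add: z_def fn_gn)
      then have fim: "(f ^^ (i + m)) z = (f ^^ m) (Y m)"
        using funpow_add[of m i f] by (simp add: add.commute)
      have "dist x1 ((f ^^ i) x) < 2 * \<epsilon>"
        using dist_triangle_lt[of x1 "Y m" "(f ^^ i) x" "2 * \<epsilon>"] near[of i] Y(2)[OF im(4)] im(2)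
        by (simp add: fi dist_commute)
      moreover have "dist x2 ((f ^^ (i + m)) x) < 2 * \<epsilon>"
        using dist_triangle_lt[of x2 "(f ^^ m) (Y m)" "(f ^^ (i + m)) x" "2 * \<epsilon>"]
          near[of "i + m"] Y(3)[OF im(4)] im(2,3)
        by (simp add: fim dist_commute)
      ultimately have "dist x1 ((f ^^ i) x) < e1" "dist x2 ((f ^^ (i + m)) x) < e2"
        using \<epsilon>(2,3) by linarith+
      then show ?thesis using x(1) im(1) by auto
    qed
    then obtain h where h: "\<And>a. a \<in> I \<Longrightarrow> h a \<in> F"
      "\<And>a. a \<in> I \<Longrightarrow> dist x1 ((f ^^ fst a) (h a)) < e1"
      "\<And>a. a \<in> I \<Longrightarrow> dist x2 ((f ^^ (fst a + snd a)) (h a)) < e2" by metis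
    have "inj_on h I"
    proof (rule inj_onI)
      fix a b assume ab: "a \<in> I" "b \<in> I" "h a = h b"
      have hS: "h a \<in> S" using h(1)[OF ab(1)] F(2) by blast
      have "fst a = fst b"
        using e1(2)[OF hS] h(2)[OF ab(1)] h(2)[OF ab(2)] ab(3) by simp
      moreover have "fst a + snd a = fst b + snd b"
        using e2(2)[OF hS] h(3)[OF ab(1)] h(3)[OF ab(2)] ab(3) by simp
      ultimately show "a = b" by (simp add: prod_eq_iff)
    qed
    then have "card I \<le> card F" using h(1) F(1) by (intro card_inj_on_le[of h]) auto
    then have "real t * real (card (M \<inter> {..<t})) \<le> real (card F)"
      unfolding I_def card_cartesian_product card_lessThan of_nat_mult[symmetric] by (rule of_nat_mono)
    also have "\<dots> \<le> real t * (2 * C)" using F(4) by (simp add: algebra_simps)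
    finally show ?thesis using t by (simp add: mult_le_cancel_left_pos)
  qed
  \<comment> \<open>Any t beyond this finite part of M violates \<open>bound\<close>, whose
    right-hand side does not depend on t.\<close>
  obtain B where B: "finite B" "card B = nat \<lceil>2 * C\<rceil> + 1" "B \<subseteq> M"
    using infinite_arbitrarily_large[OF \<open>infinite M\<close>] by blast
  have "B \<noteq> {}" using B(2) by auto
  define t where "t = Suc (Max B)"
  have "B \<subseteq> M \<inter> {..<t}" using B by (auto simp: t_def less_Suc_eq_le)
  then have "card B \<le> card (M \<inter> {..<t})" by (intro card_mono) auto
  then have "real (nat \<lceil>2 * C\<rceil> + 1) \<le> 2 * C" using bound[of t] B(2) by (simp add: t_def)
  then show False by linarith
qed

end

text \<open>Asymptotic stability, stated without coordinates. Convergence makes basins open; the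
  arbitrarily small forward invariant neighbourhoods are what forbids an orbit from converging to
  the same point under the inverse.\<close>

definition attracts :: "'a::metric_space set \<Rightarrow> ('a \<Rightarrow> 'a) \<Rightarrow> 'a \<Rightarrow> bool" where
  "attracts S f p \<longleftrightarrow> p \<in> S \<and> (\<forall>U. openin (top_of_set S) U \<and> p \<in> U \<longrightarrow>
     (\<exists>V. openin (top_of_set S) V \<and> p \<in> V \<and> V \<subseteq> U \<and> f ` V \<subseteq> V \<and> (\<forall>x\<in>V. (\<lambda>n. (f ^^ n) x) \<longlonglongrightarrow> p)))"

lemma attracts_nbhd:
  assumes "attracts S f p"
  shows "\<exists>V. openin (top_of_set S) V \<and> p \<in> V \<and> (\<forall>x\<in>V. (\<lambda>n. (f ^^ n) x) \<longlonglongrightarrow> p)"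
proof -
  have "openin (top_of_set S) S \<and> p \<in> S" using assms by (simp add: attracts_def)
  then show ?thesis using assms unfolding attracts_def by blast
qed

lemma openin_diff_finite:
  fixes F :: "'a::t1_space set"
  assumes "finite F"
  shows "openin (top_of_set S) (S - F)"
  unfolding openin_open using assms
  by (intro exI[of _ "- F"]) (auto intro: open_Compl finite_imp_closed)

lemma openin_restrict:
  "openin (top_of_set S) V \<Longrightarrow> W \<subseteq> S \<Longrightarrow> openin (top_of_set W) (W \<inter> V)"
  unfolding openin_open by auto

lemma connected_openin_cover:
  assumes "connected W" "openin (top_of_set W) A" "openin (top_of_set W) B" "W \<subseteq> A \<union> B" "A \<inter> B = {}"
  shows "A = {} \<or> B = {}"
  using assms unfolding connected_openin by blast

section \<open>Basins of attraction, and uniqueness of the sink and of the source\<close>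

context homeo_pair
begin

lemma funpow_tendsto_iff:
  "(\<lambda>k. (f ^^ k) ((f ^^ n) x)) \<longlonglongrightarrow> p \<longleftrightarrow> (\<lambda>k. (f ^^ k) x) \<longlonglongrightarrow> p"
proof -
  have "(\<lambda>k. (f ^^ k) ((f ^^ n) x)) = (\<lambda>k. (f ^^ (k + n)) x)" by (simp add: funpow_add)
  then show ?thesis
    using LIMSEQ_ignore_initial_segment[of "\<lambda>k. (f ^^ k) x" p n] LIMSEQ_offset[of "\<lambda>k. (f ^^ k) x" n p]
    by auto
qed

text \<open>Take a neighbourhood V of p that is invariant under g and avoids x. Once the forward
  orbit of x has entered V, following it back with g remains in V and ends at x.\<close>

lemma attracts_inverse_no_stable_manifold:
  assumes p: "attracts S g p" and x: "x \<in> S" "(\<lambda>n. (f ^^ n) x) \<longlonglongrightarrow> p"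
  shows "x = p"
proof (rule ccontr)
  assume "x \<noteq> p"
  have "openin (top_of_set S) (S - {x})" by (simp add: openin_diff_finite)
  then obtain V where V: "openin (top_of_set S) V" "p \<in> V" "V \<subseteq> S - {x}" "g ` V \<subseteq> V"
    using p \<open>x \<noteq> p\<close> unfolding attracts_def by blast
  obtain e where e: "e > 0" "ball p e \<inter> S \<subseteq> V"
    using V(1,2) unfolding openin_contains_ball by blast
  obtain n where "dist ((f ^^ n) x) p < e" using x(2) e(1) unfolding lim_sequentially by blast
  then have "(f ^^ n) x \<in> V" using e(2) fn_in[OF x(1)] by (auto simp: dist_commute)
  then have "(g ^^ k) ((f ^^ n) x) \<in> V" for k
    by (induction k) (use V(4) in \<open>simp_all add: image_subset_iff\<close>)
  from this[of n] have "x \<in> V" by (simp only: gn_fn[OF x(1)])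
  then show False using V(3) by blast
qed

text \<open>The basin is the union of the preimages, under all iterates, of one neighbourhood that
  is attracted.\<close>

lemma openin_basin:
  assumes "attracts S f p"
  shows "openin (top_of_set S) {x \<in> S. (\<lambda>n. (f ^^ n) x) \<longlonglongrightarrow> p}"
proof -
  obtain V where V: "openin (top_of_set S) V" "p \<in> V" "\<And>x. x \<in> V \<Longrightarrow> (\<lambda>n. (f ^^ n) x) \<longlonglongrightarrow> p"
    using attracts_nbhd[OF assms] by blast
  obtain e where e: "e > 0" "ball p e \<inter> S \<subseteq> V"
    using V(1,2) unfolding openin_contains_ball by blast
  have "{x \<in> S. (\<lambda>n. (f ^^ n) x) \<longlonglongrightarrow> p} = (\<Union>n. {x \<in> S. (f ^^ n) x \<in> V})"
  proof (intro set_eqI iffI)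
    fix x assume x: "x \<in> {x \<in> S. (\<lambda>n. (f ^^ n) x) \<longlonglongrightarrow> p}"
    then obtain n where "dist ((f ^^ n) x) p < e" using e(1) unfolding lim_sequentially by blast
    then show "x \<in> (\<Union>n. {x \<in> S. (f ^^ n) x \<in> V})"
      using e(2) x fn_in by (auto simp: dist_commute)
  next
    fix x assume "x \<in> (\<Union>n. {x \<in> S. (f ^^ n) x \<in> V})"
    then show "x \<in> {x \<in> S. (\<lambda>n. (f ^^ n) x) \<longlonglongrightarrow> p}"
      using V(3) funpow_tendsto_iff by blast
  qed
  then show ?thesis using openin_preimage_fn[OF V(1)] by auto
qed

text \<open>The basins of the points of R are disjoint open sets covering the connected set W, so
  one of them is everything.\<close>

lemma unique_attractor:
  assumes S: "connected W" "W \<subseteq> S" and R: "\<And>p. p \<in> R \<Longrightarrow> attracts S f p"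
    and conv: "\<And>x. x \<in> W \<Longrightarrow> \<exists>p\<in>R. (\<lambda>n. (f ^^ n) x) \<longlonglongrightarrow> p" and W: "W \<noteq> {}"
  shows "\<exists>q\<in>R. \<forall>x\<in>W. (\<lambda>n. (f ^^ n) x) \<longlonglongrightarrow> q"
proof -
  define B where "B p = {x \<in> W. (\<lambda>n. (f ^^ n) x) \<longlonglongrightarrow> p}" for p
  have B: "openin (top_of_set W) (B p)" if "p \<in> R" for p
  proof -
    have "B p = W \<inter> {x \<in> S. (\<lambda>n. (f ^^ n) x) \<longlonglongrightarrow> p}" unfolding B_def using S by auto
    then show ?thesis using openin_restrict[OF openin_basin[OF R[OF that]] S(2)] by simp
  qed
  obtain x q where xq: "x \<in> W" "q \<in> R" "(\<lambda>n. (f ^^ n) x) \<longlonglongrightarrow> q" using W conv by blast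
  have cover: "W \<subseteq> B q \<union> (\<Union>p\<in>R - {q}. B p)" using conv by (auto simp: B_def)
  have "B q \<inter> (\<Union>p\<in>R - {q}. B p) = {}" using LIMSEQ_unique unfolding B_def by blast
  moreover have "openin (top_of_set W) (\<Union>p\<in>R - {q}. B p)" using B by blast
  moreover have "B q \<noteq> {}" using xq by (auto simp: B_def)
  ultimately have "(\<Union>p\<in>R - {q}. B p) = {}"
    using connected_openin_cover[OF S(1) B[OF xq(2)] _ cover] by blast
  then have "x \<in> B q" if "x \<in> W" for x using cover that by blast
  then show ?thesis using xq(2) by (auto simp: B_def)
qed

text \<open>A point off R cannot converge forwards to an attractor of g, so its limit is an
  attractor of f, the same for all points by connectedness. Any further attractor of f would have
  points of S - R nearby, whose limit is already known. The same holds backwards; the two limits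
  differ because no point can have one limit that attracts in both directions.\<close>

lemma source_sink_dynamics:
  assumes R: "finite R" "R \<subseteq> S" "\<And>p. p \<in> R \<Longrightarrow> attracts S f p \<or> attracts S g p"
    and fwd: "\<And>x. x \<in> S \<Longrightarrow> \<exists>p\<in>R. (\<lambda>n. (f ^^ n) x) \<longlonglongrightarrow> p"
    and bwd: "\<And>x. x \<in> S \<Longrightarrow> \<exists>p\<in>R. (\<lambda>n. (g ^^ n) x) \<longlonglongrightarrow> p"
    and W: "connected (S - R)" "S - R \<noteq> {}"
    and dense: "\<And>p U. p \<in> R \<Longrightarrow> openin (top_of_set S) U \<Longrightarrow> p \<in> U \<Longrightarrow> U \<inter> (S - R) \<noteq> {}"
  shows "\<exists>p q. p \<noteq> q \<and> R = {p, q} \<and>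
    (\<forall>x\<in>S - R. (\<lambda>n. (f ^^ n) x) \<longlonglongrightarrow> q \<and> (\<lambda>n. (g ^^ n) x) \<longlonglongrightarrow> p)"
proof -
  define Rf where "Rf = {p \<in> R. attracts S f p}"
  define Rg where "Rg = {p \<in> R. attracts S g p}"
  have cf: "\<exists>p\<in>Rf. (\<lambda>n. (f ^^ n) x) \<longlonglongrightarrow> p" if x: "x \<in> S - R" for x
  proof -
    obtain p where p: "p \<in> R" "(\<lambda>n. (f ^^ n) x) \<longlonglongrightarrow> p" using fwd x by blast
    then have "\<not> attracts S g p" using attracts_inverse_no_stable_manifold x by blast
    then show ?thesis using p R(3) by (auto simp: Rf_def)
  qed
  have "\<exists>q\<in>Rf. \<forall>x\<in>S - R. (\<lambda>n. (f ^^ n) x) \<longlonglongrightarrow> q"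
    by (rule unique_attractor[of "S - R" Rf, OF W(1) _ _ cf W(2)]) (auto simp: Rf_def)
  then obtain q where q: "q \<in> Rf" "\<And>x. x \<in> S - R \<Longrightarrow> (\<lambda>n. (f ^^ n) x) \<longlonglongrightarrow> q" by blast
  have cg: "\<exists>p\<in>Rg. (\<lambda>n. (g ^^ n) x) \<longlonglongrightarrow> p" if x: "x \<in> S - R" for x
  proof -
    obtain p where p: "p \<in> R" "(\<lambda>n. (g ^^ n) x) \<longlonglongrightarrow> p" using bwd x by blast
    then have "\<not> attracts S f p"
      using homeo_pair.attracts_inverse_no_stable_manifold[OF inverse] x by blast
    then show ?thesis using p R(3) by (auto simp: Rg_def)
  qed
  have "\<exists>p\<in>Rg. \<forall>x\<in>S - R. (\<lambda>n. (g ^^ n) x) \<longlonglongrightarrow> p"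
    by (rule homeo_pair.unique_attractor[OF inverse, of "S - R" Rg, OF W(1) _ _ cg W(2)]) (auto simp: Rg_def)
  then obtain p where p: "p \<in> Rg" "\<And>x. x \<in> S - R \<Longrightarrow> (\<lambda>n. (g ^^ n) x) \<longlonglongrightarrow> p" by blast
  have near: "\<exists>x\<in>S - R. x \<in> V" if "p \<in> R" "openin (top_of_set S) V" "p \<in> V" for p V
    using dense[OF that] by blast
  have Rf1: "p' = q" if "p' \<in> Rf" for p'
  proof -
    obtain V where V: "openin (top_of_set S) V" "p' \<in> V" "\<And>x. x \<in> V \<Longrightarrow> (\<lambda>n. (f ^^ n) x) \<longlonglongrightarrow> p'"
      using \<open>p' \<in> Rf\<close> attracts_nbhd[of S f p'] unfolding Rf_def by blast
    then obtain x where "x \<in> S - R" "x \<in> V" using near[of p' V] \<open>p' \<in> Rf\<close> unfolding Rf_def by blast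
    then show ?thesis using LIMSEQ_unique[OF V(3) q(2)] by blast
  qed
  have Rg1: "p' = p" if "p' \<in> Rg" for p'
  proof -
    obtain V where V: "openin (top_of_set S) V" "p' \<in> V" "\<And>x. x \<in> V \<Longrightarrow> (\<lambda>n. (g ^^ n) x) \<longlonglongrightarrow> p'"
      using \<open>p' \<in> Rg\<close> attracts_nbhd[of S g p'] unfolding Rg_def by blast
    then obtain x where "x \<in> S - R" "x \<in> V" using near[of p' V] \<open>p' \<in> Rg\<close> unfolding Rg_def by blast
    then show ?thesis using LIMSEQ_unique[OF V(3) p(2)] by blast
  qed
  have "R \<subseteq> Rf \<union> Rg" using R(3) unfolding Rf_def Rg_def by blast
  then have "R \<subseteq> {p, q}" using Rf1 Rg1 by blast
  moreover have "{p, q} \<subseteq> R" using p(1) q(1) unfolding Rf_def Rg_def by blast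
  ultimately have "R = {p, q}" by (rule subset_antisym)
  moreover have "p \<noteq> q"
  proof
    assume "p = q"
    then obtain x where "x \<in> S - R" using W(2) by blast
    moreover from this have "x = q"
      using attracts_inverse_no_stable_manifold[of q x] q(2) p(1) \<open>p = q\<close> unfolding Rg_def by blast
    ultimately show False using q(1) unfolding Rf_def by blast
  qed
  ultimately show ?thesis using p(2) q(2) by blast
qed

end

text \<open>If S - {p} were separated, the connected set D - {p} would lie on one side; adding D to
  that side would separate S.\<close>

lemma connected_delete_point:
  fixes S :: "'a::t1_space set"
  assumes S: "connected S" and D: "openin (top_of_set S) D" "p \<in> D" "connected (D - {p})" "D - {p} \<noteq> {}"
  shows "connected (S - {p})"
proof (rule ccontr)
  assume "\<not> connected (S - {p})"
  then obtain E1 E2 where E: "openin (top_of_set (S - {p})) E1" "openin (top_of_set (S - {p})) E2"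
    "S - {p} \<subseteq> E1 \<union> E2" "E1 \<inter> E2 = {}" "E1 \<noteq> {}" "E2 \<noteq> {}"
    unfolding connected_openin by blast
  have o: "openin (top_of_set S) (S - {p})" by (simp add: openin_diff_finite)
  have E': "openin (top_of_set S) E1" "openin (top_of_set S) E2" using E(1,2) o openin_trans by blast+
  have *: False if "openin (top_of_set S) E1" "openin (top_of_set S) E2" "S - {p} \<subseteq> E1 \<union> E2"
    "E1 \<inter> E2 = {}" "E2 \<noteq> {}" "D - {p} \<subseteq> E1" "p \<notin> E2" for E1 E2
  proof -
    have "openin (top_of_set S) (E1 \<union> D)" using that D(1) by blast
    moreover have "S \<subseteq> (E1 \<union> D) \<union> E2" using that(3) D(2) by blast
    moreover have "(E1 \<union> D) \<inter> E2 = {}" using that by blast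
    moreover have "E1 \<union> D \<noteq> {}" using D(2) by blast
    ultimately show False using connected_openin_cover[OF S _ that(2)] that(5) by blast
  qed
  have p: "p \<notin> E1" "p \<notin> E2" using openin_imp_subset[OF E(1)] openin_imp_subset[OF E(2)] by auto
  have DS: "D - {p} \<subseteq> S - {p}" using openin_imp_subset[OF D(1)] by blast
  have "openin (top_of_set (D - {p})) ((D - {p}) \<inter> E1)" "openin (top_of_set (D - {p})) ((D - {p}) \<inter> E2)"
    using openin_restrict[OF E(1) DS] openin_restrict[OF E(2) DS] by simp_all
  moreover have "D - {p} \<subseteq> (D - {p}) \<inter> E1 \<union> (D - {p}) \<inter> E2" using E(3) DS by blast
  moreover have "((D - {p}) \<inter> E1) \<inter> ((D - {p}) \<inter> E2) = {}" using E(4) by blast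
  ultimately have "(D - {p}) \<inter> E1 = {} \<or> (D - {p}) \<inter> E2 = {}"
    using connected_openin_cover[OF D(3)] by blast
  then have "D - {p} \<subseteq> E2 \<or> D - {p} \<subseteq> E1" using E(3) DS by blast
  then show False
    using *[of E1 E2] *[of E2 E1] E E' p by (auto simp: Un_commute Int_commute)
qed

text \<open>The neighbourhoods D may be chosen inside any U, so at each deletion D can be taken
  disjoint from the points deleted before.\<close>

lemma connected_delete_finite:
  fixes S :: "'a::t1_space set"
  assumes S: "connected S" and F: "finite F"
    and loc: "\<And>p U. p \<in> S \<Longrightarrow> openin (top_of_set S) U \<Longrightarrow> p \<in> U \<Longrightarrow>
      \<exists>D. openin (top_of_set S) D \<and> p \<in> D \<and> D \<subseteq> U \<and> connected (D - {p}) \<and> D - {p} \<noteq> {}"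
  shows "connected (S - F)"
  using F
proof (induction F rule: finite_induct)
  case (insert p F)
  show ?case
  proof (cases "p \<in> S")
    case True
    have o: "openin (top_of_set S) (S - F)" using insert(1) by (rule openin_diff_finite)
    then obtain D where D: "openin (top_of_set S) D" "p \<in> D" "D \<subseteq> S - F" "connected (D - {p})" "D - {p} \<noteq> {}"
      using loc[OF True o] insert(2) True by blast
    have "openin (top_of_set (S - F)) D" using D(1,3) by (metis Diff_subset openin_subset_trans)
    then have "connected (S - F - {p})" using connected_delete_point[OF insert(3)] D by blast
    moreover have "S - insert p F = S - F - {p}" by blast
    ultimately show ?thesis by simp
  next
    case False
    then have "S - insert p F = S - F" by blast
    then show ?thesis using insert(3) by simp
  qed
qed (simp add: S)

section \<open>Dynamics near a fixed point of a surface homeomorphism\<close>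

text \<open>A chart moved by an affine map, with p at the origin, so that norms of coordinates
  measure the distance to p in whichever linear coordinates suit the derivative.\<close>

locale local_coord =
  fixes S :: "'a::metric_space set" and p :: 'a and U :: "'a set"
    and \<psi> :: "'a \<Rightarrow> real^2" and \<phi> :: "real^2 \<Rightarrow> 'a"
  assumes U: "openin (top_of_set S) U" "p \<in> U"
    and hom: "homeomorphism U (\<psi> ` U) \<psi> \<phi>" and open_image: "open (\<psi> ` U)"
    and center: "\<psi> p = 0"
begin

lemma U_subset: "U \<subseteq> S"
  using U(1) by (rule openin_imp_subset)

lemma \<phi>_\<psi>: "x \<in> U \<Longrightarrow> \<phi> (\<psi> x) = x"
  using hom by (auto simp: homeomorphism_def)

lemma \<psi>_\<phi>: "v \<in> \<psi> ` U \<Longrightarrow> \<psi> (\<phi> v) = v"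
  using hom by (auto simp: homeomorphism_def)

lemma \<phi>_in: "v \<in> \<psi> ` U \<Longrightarrow> \<phi> v \<in> U"
  using hom by (auto simp: homeomorphism_def)

lemma cont_\<psi>: "continuous_on U \<psi>" and cont_\<phi>: "continuous_on (\<psi> ` U) \<phi>"
  using hom by (auto simp: homeomorphism_def)

lemma \<phi>_0: "\<phi> 0 = p"
  using \<phi>_\<psi>[OF U(2)] center by simp

lemma \<phi>_image_eq: "B \<subseteq> \<psi> ` U \<Longrightarrow> \<phi> ` B = {x \<in> U. \<psi> x \<in> B}"
  using \<phi>_\<psi> \<psi>_\<phi> \<phi>_in by (auto simp: image_iff) (metis imageI)

lemma small_ball:
  assumes "openin (top_of_set S) V" "p \<in> V"
  obtains r where "r > 0" "cball 0 r \<subseteq> \<psi> ` U" "\<phi> ` cball 0 r \<subseteq> V"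
proof -
  have "openin (top_of_set U) (U \<inter> V)"
    using assms(1) U_subset by (rule openin_restrict)
  then have "openin (top_of_set (\<psi> ` U)) (\<psi> ` (U \<inter> V))"
    using homeomorphism_imp_open_map[OF hom] by blast
  then have "open (\<psi> ` (U \<inter> V))" using open_image by (simp add: openin_open_eq)
  moreover have "0 \<in> \<psi> ` (U \<inter> V)" using center U(2) assms(2) by force
  ultimately obtain r where r: "r > 0" "cball 0 r \<subseteq> \<psi> ` (U \<inter> V)"
    using open_contains_cball by blast
  moreover have "\<phi> v \<in> V" if "v \<in> \<psi> ` (U \<inter> V)" for v using that \<phi>_\<psi> by auto
  ultimately show ?thesis using that[of r] by blast
qed

lemma openin_\<phi>_image:
  assumes "open B" "B \<subseteq> \<psi> ` U"
  shows "openin (top_of_set S) (\<phi> ` B)"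
proof -
  have "openin (top_of_set U) (U \<inter> \<psi> -` B)" using continuous_openin_preimage_gen[OF cont_\<psi> assms(1)] .
  moreover have "U \<inter> \<psi> -` B = \<phi> ` B" using \<phi>_image_eq[OF assms(2)] by auto
  ultimately show ?thesis using U(1) openin_trans by metis
qed

lemma compact_\<phi>_image:
  assumes "compact B" "B \<subseteq> \<psi> ` U"
  shows "compact (\<phi> ` B)"
  using assms cont_\<phi> compact_continuous_image continuous_on_subset by metis

lemma p_in_\<phi>_ball: "r > 0 \<Longrightarrow> p \<in> \<phi> ` ball 0 r"
  using \<phi>_0 by (metis centre_in_ball imageI)

text \<open>This is where the dimension enters: a punctured disc is connected. That it is infinite
  makes the complement of a finite set dense.\<close>

lemma punctured_nbhd:
  assumes "openin (top_of_set S) V" "p \<in> V"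
  obtains D where "openin (top_of_set S) D" "p \<in> D" "D \<subseteq> V" "connected (D - {p})" "infinite (D - {p})"
proof -
  obtain r where r: "r > 0" "cball 0 r \<subseteq> \<psi> ` U" "\<phi> ` cball 0 r \<subseteq> V" using small_ball[OF assms] .
  have b: "ball 0 r \<subseteq> \<psi> ` U" using r(2) ball_subset_cball by blast
  have inj: "inj_on \<phi> (ball 0 r)" using \<psi>_\<phi> b by (metis inj_onI subsetD)
  have eq: "\<phi> ` ball 0 r - {p} = \<phi> ` (ball 0 r - {0})"
    using inj_on_image_set_diff[OF inj, of "ball 0 r" "{0}"] r(1) \<phi>_0 by simp
  have "connected (\<phi> ` (ball 0 r - {0}))"
  proof (rule connected_continuous_image)
    show "continuous_on (ball 0 r - {0}) \<phi>" using cont_\<phi> b continuous_on_subset by blast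
    show "connected (ball 0 r - {0::real^2})" by (intro connected_punctured_ball) simp
  qed
  moreover have "infinite (\<phi> ` (ball 0 r - {0}))"
  proof -
    have "uncountable (ball (0::real^2) r)" using r(1) by (rule uncountable_ball)
    then have "infinite (ball (0::real^2) r)" by (metis uncountable_infinite)
    then have "infinite (ball (0::real^2) r - {0})" by simp
    then show ?thesis using inj by (metis finite_imageD inj_on_subset Diff_subset)
  qed
  ultimately show ?thesis
    using that[of "\<phi> ` ball 0 r"] openin_\<phi>_image[of "ball 0 r"] b p_in_\<phi>_ball[OF r(1)] r(3) eq
      image_mono[OF ball_subset_cball[of "0::real^2" r], of \<phi>] by auto
qed

text \<open>Since the norm contracts in a single step, every small coordinate ball is forward
  invariant, and its points tend to p geometrically.\<close>

lemma contraction_attracts: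
  assumes O: "openin (top_of_set S) O'" "p \<in> O'" "O' \<subseteq> U" and \<kappa>: "0 \<le> \<kappa>" "\<kappa> < 1"
    and contr: "\<And>x. x \<in> O' \<Longrightarrow> h x \<in> U \<and> norm (\<psi> (h x)) \<le> \<kappa> * norm (\<psi> x)"
  shows "attracts S h p"
  unfolding attracts_def
proof (intro conjI allI impI)
  show "p \<in> S" using U U_subset by blast
  fix V assume V: "openin (top_of_set S) V \<and> p \<in> V"
  then have "openin (top_of_set S) (V \<inter> O')" "p \<in> V \<inter> O'" using O by auto
  then obtain r where r: "r > 0" "cball 0 r \<subseteq> \<psi> ` U" "\<phi> ` cball 0 r \<subseteq> V \<inter> O'" using small_ball by blast
  have b: "ball 0 r \<subseteq> \<psi> ` U" using r(2) ball_subset_cball by blast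
  define D where "D = \<phi> ` ball 0 r"
  have D: "D = {x \<in> U. norm (\<psi> x) < r}" unfolding D_def \<phi>_image_eq[OF b] by simp
  have DO: "D \<subseteq> V \<inter> O'" using r(3) image_mono[OF ball_subset_cball[of "0::real^2" r], of \<phi>] by (auto simp: D_def)
  have inv: "h x \<in> D" "norm (\<psi> (h x)) \<le> \<kappa> * norm (\<psi> x)" if "x \<in> D" for x
  proof -
    show *: "norm (\<psi> (h x)) \<le> \<kappa> * norm (\<psi> x)" using contr that DO by blast
    also have "\<dots> \<le> norm (\<psi> x)" using \<kappa> by (simp add: mult_left_le_one_le)
    finally show "h x \<in> D" using contr[of x] that DO unfolding D by auto
  qed
  have lim: "(\<lambda>n. (h ^^ n) x) \<longlonglongrightarrow> p" if x: "x \<in> D" for x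
  proof -
    have it: "(h ^^ n) x \<in> D \<and> norm (\<psi> ((h ^^ n) x)) \<le> \<kappa> ^ n * norm (\<psi> x)" for n
    proof (induction n)
      case (Suc n)
      then have "norm (\<psi> (h ((h ^^ n) x))) \<le> \<kappa> * (\<kappa> ^ n * norm (\<psi> x))"
        using inv(2)[of "(h ^^ n) x"] \<kappa> by (meson mult_left_mono order_trans)
      then show ?case using inv(1) Suc by (simp add: mult.assoc)
    qed (simp add: x)
    have "(\<lambda>n. \<kappa> ^ n * norm (\<psi> x)) \<longlonglongrightarrow> 0 * norm (\<psi> x)"
      using \<kappa> by (intro tendsto_mult LIMSEQ_realpow_zero tendsto_const)
    then have "(\<lambda>n. \<kappa> ^ n * norm (\<psi> x)) \<longlonglongrightarrow> 0" by simp
    then have "(\<lambda>n. \<psi> ((h ^^ n) x)) \<longlonglongrightarrow> 0"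
      by (rule Lim_null_comparison[rotated]) (rule always_eventually, use it in blast)
    moreover have "\<psi> ((h ^^ n) x) \<in> \<psi> ` U" for n using it[of n] by (auto simp: D)
    ultimately have "(\<lambda>n. \<phi> (\<psi> ((h ^^ n) x))) \<longlonglongrightarrow> \<phi> 0"
      using U(2) by (intro continuous_on_tendsto_compose[OF cont_\<phi>] always_eventually)
        (auto simp: image_iff center intro: bexI[of _ p])
    moreover have "\<phi> (\<psi> ((h ^^ n) x)) = (h ^^ n) x" for n using it[of n] by (auto simp: D \<phi>_\<psi>)
    ultimately show ?thesis by (simp add: \<phi>_0)
  qed
  show "\<exists>D. openin (top_of_set S) D \<and> p \<in> D \<and> D \<subseteq> V \<and> h ` D \<subseteq> D \<and> (\<forall>x\<in>D. (\<lambda>n. (h ^^ n) x) \<longlonglongrightarrow> p)"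
    using openin_\<phi>_image[of "ball 0 r"] b p_in_\<phi>_ball[OF r(1)] DO inv(1) lim
    by (intro exI[of _ D]) (auto simp: D_def)
qed

end

locale local_dynamics = homeo_pair S f g + local_coord S p U \<psi> \<phi>
  for S :: "'a::metric_space set" and f g p U \<psi> \<phi> +
  assumes fixed: "f p = p"
begin

text \<open>Expansion at \<open>g x\<close> by the factor \<kappa> is contraction of g at x by 1 /
  \<kappa>, on the points that g sends into the region where the estimate holds.\<close>

lemma expansion_attracts_inverse:
  assumes O: "openin (top_of_set S) O'" "p \<in> O'" "O' \<subseteq> U" and \<kappa>: "\<kappa> > 1"
    and exp: "\<And>x. x \<in> O' \<Longrightarrow> norm (\<psi> (f x)) \<ge> \<kappa> * norm (\<psi> x)"
  shows "attracts S g p"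
proof (rule contraction_attracts)
  let ?O = "{x \<in> S. (g ^^ 1) x \<in> O'} \<inter> U"
  have pS: "p \<in> S" using U U_subset by blast
  have gp: "g p = p" using g_f[OF pS] fixed by simp
  show "openin (top_of_set S) ?O"
    using homeo_pair.openin_preimage_fn[OF inverse O(1), of 1] U(1) by (rule openin_Int)
  show "p \<in> ?O" using pS gp O(2) U(2) by simp
  show "?O \<subseteq> U" by blast
  show "0 \<le> 1 / \<kappa>" "1 / \<kappa> < 1" using \<kappa> by auto
  fix x assume x: "x \<in> ?O"
  then have "norm (\<psi> x) \<ge> \<kappa> * norm (\<psi> (g x))" using exp[of "g x"] f_g[of x] by auto
  then show "g x \<in> U \<and> norm (\<psi> (g x)) \<le> 1 / \<kappa> * norm (\<psi> x)"
    using x O(3) \<kappa> by (auto simp: field_simps)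
qed

text \<open>A point on the diagonal lies in the cone of expansion of \<open>f\<close> and in the one of \<open>f\<^sup>-\<^sup>1\<close>, so that
  its orbit leaves a neighbourhood of a saddle in both directions of time.\<close>

lemma saddle_orbits_leave:
  assumes ab: "\<bar>a\<bar> < 1" "1 < \<bar>b\<bar>"
    and lin: "\<And>e. e > 0 \<Longrightarrow> \<exists>O'. openin (top_of_set S) O' \<and> p \<in> O' \<and> O' \<subseteq> U \<and> (\<forall>x\<in>O'.
      \<bar>\<psi> (f x) $ 1 - a * \<psi> x $ 1\<bar> \<le> e * norm (\<psi> x) \<and> \<bar>\<psi> (f x) $ 2 - b * \<psi> x $ 2\<bar> \<le> e * norm (\<psi> x))"
    and Q: "openin (top_of_set S) Q" "p \<in> Q"
  obtains V V0 where "compact V" "openin (top_of_set S) V0" "p \<in> V0" "V0 \<subseteq> V" "V \<subseteq> Q"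
    "\<And>O'. openin (top_of_set S) O' \<Longrightarrow> p \<in> O' \<Longrightarrow>
      \<exists>y\<in>O'. y \<in> S \<and> (\<exists>n. (f ^^ n) y \<notin> V) \<and> (\<exists>n. (g ^^ n) y \<notin> V)"
proof -
  \<comment> \<open>The error \<open>e * (s x + u x)\<close> is at most 2 e times the larger
    coordinate, so the rates \<bar>a\<bar> and \<bar>b\<bar> change to \<alpha> and \<beta>. The
    factor 4 keeps each at least half as far from 1 as before.\<close>
  define e where "e = min (1 - \<bar>a\<bar>) (\<bar>b\<bar> - 1) / 4"
  have e: "e > 0" "4 * e \<le> 1 - \<bar>a\<bar>" "4 * e \<le> \<bar>b\<bar> - 1" using ab by (auto simp: e_def)
  define \<alpha> \<beta> where "\<alpha> = \<bar>a\<bar> + 2 * e" and "\<beta> = \<bar>b\<bar> - 2 * e"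
  have \<alpha>\<beta>: "0 < \<alpha>" "\<alpha> < 1" "1 < \<beta>" using ab e unfolding \<alpha>_def \<beta>_def by linarith+
  obtain O1 where O1: "openin (top_of_set S) O1" "p \<in> O1" "O1 \<subseteq> U"
    "\<And>x. x \<in> O1 \<Longrightarrow> \<bar>\<psi> (f x) $ 1 - a * \<psi> x $ 1\<bar> \<le> e * norm (\<psi> x)"
    "\<And>x. x \<in> O1 \<Longrightarrow> \<bar>\<psi> (f x) $ 2 - b * \<psi> x $ 2\<bar> \<le> e * norm (\<psi> x)"
    using lin[OF e(1)] by blast
  have "openin (top_of_set S) (O1 \<inter> Q)" "p \<in> O1 \<inter> Q" using O1(1,2) Q by auto
  then obtain r where r: "r > 0" "cball 0 r \<subseteq> \<psi> ` U" "\<phi> ` cball 0 r \<subseteq> O1 \<inter> Q" using small_ball by blast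
  define V V0 where "V = \<phi> ` cball 0 r" and "V0 = \<phi> ` ball 0 r"
  define s u where "s x = \<bar>\<psi> x $ 1\<bar>" and "u x = \<bar>\<psi> x $ 2\<bar>" for x
  have V: "V = {x \<in> U. norm (\<psi> x) \<le> r}" unfolding V_def \<phi>_image_eq[OF r(2)] by simp
  have su: "s x \<le> r" "u x \<le> r" if "x \<in> V" for x
    using that component_le_norm_cart[of "\<psi> x"] unfolding V s_def u_def by (auto intro: order_trans)
  have n1: "norm (\<psi> x) \<le> s x + u x" for x
    using norm_le_l1_cart[of "\<psi> x"] by (simp add: s_def u_def sum_2)
  have step: "s (f x) \<le> \<bar>a\<bar> * s x + e * (s x + u x)" "u (f x) \<ge> \<bar>b\<bar> * u x - e * (s x + u x)"
    if "x \<in> V" for x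
  proof -
    have x: "x \<in> O1" using that r(3) by (auto simp: V_def)
    have le: "e * norm (\<psi> x) \<le> e * (s x + u x)" using n1 e by simp
    have "s (f x) \<le> \<bar>a * \<psi> x $ 1\<bar> + \<bar>\<psi> (f x) $ 1 - a * \<psi> x $ 1\<bar>" unfolding s_def by linarith
    then show "s (f x) \<le> \<bar>a\<bar> * s x + e * (s x + u x)"
      using O1(4)[OF x] le by (simp add: abs_mult s_def)
    have "u (f x) \<ge> \<bar>b * \<psi> x $ 2\<bar> - \<bar>\<psi> (f x) $ 2 - b * \<psi> x $ 2\<bar>" unfolding u_def by linarith
    then show "u (f x) \<ge> \<bar>b\<bar> * u x - e * (s x + u x)"
      using O1(5)[OF x] le by (simp add: abs_mult u_def)
  qed
  have pos: "s x \<ge> 0" "u x \<ge> 0" for x by (auto simp: s_def u_def)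
  have forward: "s (f x) \<le> \<alpha> * u x" "u (f x) \<ge> \<beta> * u x" if x: "x \<in> V" "s x \<le> u x" for x
  proof -
    have "\<bar>a\<bar> * s x \<le> \<bar>a\<bar> * u x" "e * s x \<le> e * u x" using x(2) e by (auto intro: mult_left_mono)
    then show "s (f x) \<le> \<alpha> * u x" "u (f x) \<ge> \<beta> * u x"
      using step[OF x(1)] by (auto simp: \<alpha>_def \<beta>_def algebra_simps)
  qed
  \<comment> \<open>The cone \<open>u x \<le> s x\<close> is preserved when time runs backwards:
    from a point outside it, \<open>forward\<close> would give \<open>s (f x) < u (f x)\<close>.
    Inside it s decreases by the factor \<alpha> in forward time, hence grows under g.\<close>
  have backward: "u x \<le> s x" "s (f x) \<le> \<alpha> * s x" if x: "x \<in> V" "u (f x) \<le> s (f x)" for x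
  proof -
    show us: "u x \<le> s x"
    proof (rule ccontr)
      assume n: "\<not> u x \<le> s x"
      then have "u x > 0" using pos[of x] by linarith
      then have "\<alpha> * u x < \<beta> * u x" using \<alpha>\<beta> by (intro mult_strict_right_mono) auto
      then show False using forward[OF x(1)] n x(2) by linarith
    qed
    then have "e * u x \<le> e * s x" using e by (auto intro: mult_left_mono)
    then show "s (f x) \<le> \<alpha> * s x"
      using step(1)[OF x(1)] by (auto simp: \<alpha>_def algebra_simps)
  qed
  have leave: "\<exists>y\<in>O'. y \<in> S \<and> (\<exists>n. (f ^^ n) y \<notin> V) \<and> (\<exists>n. (g ^^ n) y \<notin> V)"
    if O': "openin (top_of_set S) O'" "p \<in> O'" for O'
  proof -
    obtain r' where r': "r' > 0" "cball 0 r' \<subseteq> \<psi> ` U" "\<phi> ` cball 0 r' \<subseteq> O'"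
      using small_ball[OF O'] .
    define t where "t = r' / 2"
    have t: "t > 0" using r'(1) by (simp add: t_def)
    \<comment> \<open>On the diagonal s and u agree, so the point belongs to both cones. With t half
      of r', the sum of the coordinates, which bounds the norm, is r'.\<close>
    define v :: "real^2" where "v = vector [t, t]"
    have "norm v \<le> r'" using norm_le_l1_cart[of v] t by (simp add: v_def sum_2 t_def)
    then have v: "v \<in> cball 0 r'" by simp
    define y where "y = \<phi> v"
    have vU: "v \<in> \<psi> ` U" using v r'(2) by blast
    have "y \<in> O'" "y \<in> S" using v r'(3) \<phi>_in[OF vU] U_subset by (auto simp: y_def)
    moreover have "\<psi> y = v" by (simp add: y_def \<psi>_\<phi>[OF vU])
    then have "s y = t" "u y = t" using t by (simp_all add: s_def u_def v_def)
    ultimately have y: "y \<in> O'" "y \<in> S" "s y = t" "u y = t" .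
    have "\<exists>n. (f ^^ n) y \<notin> V"
    proof (rule ccontr)
      assume "\<not> ?thesis"
      then have inV: "(f ^^ n) y \<in> V" for n by blast
      have grow: "s ((f ^^ n) y) \<le> u ((f ^^ n) y) \<and> u ((f ^^ n) y) \<ge> \<beta> ^ n * t" for n
      proof (induction n)
        case (Suc n)
        let ?x = "(f ^^ n) y"
        have "s (f ?x) \<le> \<alpha> * u ?x" "u (f ?x) \<ge> \<beta> * u ?x" using forward[OF inV] Suc by auto
        moreover have "\<alpha> * u ?x \<le> \<beta> * u ?x" using \<alpha>\<beta> pos by (intro mult_right_mono) auto
        moreover have "\<beta> * (\<beta> ^ n * t) \<le> \<beta> * u ?x" using Suc \<alpha>\<beta> by (intro mult_left_mono) auto
        ultimately show ?case by (simp add: mult.assoc)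
      qed (simp add: y)
      obtain n where "r / t < \<beta> ^ n" using real_arch_pow[OF \<alpha>\<beta>(3)] by blast
      then have "r < \<beta> ^ n * t" using t by (simp add: field_simps)
      then show False using grow[of n] su(2)[OF inV[of n]] by linarith
    qed
    moreover have "\<exists>n. (g ^^ n) y \<notin> V"
    proof (rule ccontr)
      assume "\<not> ?thesis"
      then have inV: "(g ^^ n) y \<in> V" for n by blast
      have grow: "u ((g ^^ n) y) \<le> s ((g ^^ n) y) \<and> t \<le> \<alpha> ^ n * s ((g ^^ n) y)" for n
      proof (induction n)
        case (Suc n)
        let ?x = "(g ^^ Suc n) y"
        have fx: "f ?x = (g ^^ n) y" using f_g gn_in[OF y(2)] by simp
        then have "u ?x \<le> s ?x" "s (f ?x) \<le> \<alpha> * s ?x" using backward[OF inV[of "Suc n"]] Suc by auto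
        moreover have "\<alpha> ^ n * s (f ?x) \<le> \<alpha> ^ n * (\<alpha> * s ?x)"
          using calculation(2) \<alpha>\<beta> by (intro mult_left_mono) auto
        ultimately show ?case using Suc fx by (simp add: algebra_simps del: funpow.simps)
      qed (simp add: y)
      obtain n where n: "r / t < (1 / \<alpha>) ^ n" using real_arch_pow[of "1 / \<alpha>"] \<alpha>\<beta> by auto
      then have "\<alpha> ^ n * r < t" using t \<alpha>\<beta> by (simp add: field_simps power_divide)
      moreover have "\<alpha> ^ n * s ((g ^^ n) y) \<le> \<alpha> ^ n * r"
        using su(1)[OF inV[of n]] \<alpha>\<beta> by (intro mult_left_mono) auto
      ultimately show False using grow[of n] by linarith
    qed
    ultimately show ?thesis using y by blast
  qed
  have b: "ball 0 r \<subseteq> \<psi> ` U" using r(2) ball_subset_cball by blast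
  show ?thesis
  proof (rule that[of V V0])
    show "compact V" unfolding V_def by (intro compact_\<phi>_image r) simp
    show "openin (top_of_set S) V0" unfolding V0_def by (intro openin_\<phi>_image b) simp
    show "p \<in> V0" unfolding V0_def using r(1) by (rule p_in_\<phi>_ball)
    show "V0 \<subseteq> V" unfolding V_def V0_def by (intro image_mono ball_subset_cball)
    show "V \<subseteq> Q" using r(3) by (auto simp: V_def)
  qed (rule leave)
qed

text \<open>A point close enough to p stays in V up to time m, and then leaves V in both directions
  of time. Its two first exit points lie in one compact set without fixed points from R, and the
  delay between them exceeds m.\<close>

lemma not_saddle:
  assumes ab: "\<bar>a\<bar> < 1" "1 < \<bar>b\<bar>"
    and lin: "\<And>e. e > 0 \<Longrightarrow> \<exists>O'. openin (top_of_set S) O' \<and> p \<in> O' \<and> O' \<subseteq> U \<and> (\<forall>x\<in>O'.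
      \<bar>\<psi> (f x) $ 1 - a * \<psi> x $ 1\<bar> \<le> e * norm (\<psi> x) \<and> \<bar>\<psi> (f x) $ 2 - b * \<psi> x $ 2\<bar> \<le> e * norm (\<psi> x))"
    and R: "finite R" "\<And>x. x \<in> R \<Longrightarrow> x \<in> S \<and> f x = x"
    and proper: "\<And>K. compact K \<Longrightarrow> K \<subseteq> S \<Longrightarrow> K \<inter> R = {} \<Longrightarrow> \<exists>m0. \<forall>m\<ge>m0. (f ^^ m) ` K \<inter> K = {}"
  shows False
proof -
  have pS: "p \<in> S" using U U_subset by blast
  have Q: "openin (top_of_set S) (S - (R - {p}))" using R(1) by (intro openin_diff_finite) simp
  obtain V V0 where V: "compact V" "openin (top_of_set S) V0" "p \<in> V0" "V0 \<subseteq> V" "V \<subseteq> S - (R - {p})"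
    and leave: "\<And>O'. openin (top_of_set S) O' \<Longrightarrow> p \<in> O' \<Longrightarrow>
      \<exists>y\<in>O'. y \<in> S \<and> (\<exists>n. (f ^^ n) y \<notin> V) \<and> (\<exists>n. (g ^^ n) y \<notin> V)"
    using saddle_orbits_leave[OF ab lin Q] pS by blast
  have VS: "V \<subseteq> S" using V(5) by blast
  \<comment> \<open>The shell of possible first exit points under f and g. A point of R in it is
    fixed, so the point of V from which it comes is itself; V meets R at most in p, and p is removed
    with V0.\<close>
  define K where "K = (f ` V \<union> g ` V) - V0"
  have "compact (f ` V)" "compact (g ` V)"
    using V(1) VS cont_f cont_g by (auto intro: compact_continuous_image continuous_on_subset)
  then have c: "compact (f ` V \<union> g ` V)" by (rule compact_Un)
  obtain T where T: "open T" "V0 = S \<inter> T" using V(2) unfolding openin_open by blast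
  have sub: "f ` V \<union> g ` V \<subseteq> S" using VS f_in g_in by blast
  then have "K = (f ` V \<union> g ` V) - T" unfolding K_def T(2) by blast
  then have "compact K" using c T(1) by (simp add: compact_diff)
  moreover have "K \<subseteq> S" using sub by (auto simp: K_def)
  moreover have "K \<inter> R = {}"
  proof -
    have gR: "g x = x" if "x \<in> R" for x using R(2)[OF that] g_f[of x] by auto
    have False if "x \<in> K" "x \<in> R" for x
    proof -
      have "x \<in> S" "f x = x" "g x = x" using R(2) gR that by auto
      then have "x \<in> V" using that(1) VS f_g g_f by (auto simp: K_def)
      then have "x = p" using V(5) that(2) by blast
      then show False using that(1) V(3) by (simp add: K_def)
    qed
    then show ?thesis by blast
  qed
  ultimately obtain m where m: "\<And>k. k \<ge> m \<Longrightarrow> (f ^^ k) ` K \<inter> K = {}" using proper[of K] by blast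
  have fp: "(f ^^ j) p = p" for j using fixed by (induction j) auto
  \<comment> \<open>Constraining the forward iterates suffices: they make the forward exit time i
    exceed m, and the delay i + j is at least i.\<close>
  define O' where "O' = (\<Inter>j\<in>{..m}. {x \<in> S. (f ^^ j) x \<in> V0})"
  have "openin (top_of_set S) O'" unfolding O'_def
    by (intro openin_INT2) (auto intro: openin_preimage_fn[OF V(2)])
  moreover have "p \<in> O'" unfolding O'_def using pS fp V(3) by simp
  ultimately obtain y where y: "y \<in> O'" "y \<in> S" "\<exists>n. (f ^^ n) y \<notin> V" "\<exists>n. (g ^^ n) y \<notin> V"
    using leave by blast
  have yV: "(f ^^ j) y \<in> V" if "j \<le> m" for j using y(1) that V(4) by (auto simp: O'_def)
  then have y0: "y \<in> V" using yV[of 0] by simp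
  have first: "\<exists>n. (h ^^ n) y \<in> h ` V - V" if "\<exists>n. (h ^^ n) y \<notin> V" for h :: "'a \<Rightarrow> 'a"
  proof -
    define n where "n = (LEAST n. (h ^^ n) y \<notin> V)"
    have n: "(h ^^ n) y \<notin> V" "\<And>k. k < n \<Longrightarrow> (h ^^ k) y \<in> V"
      unfolding n_def using LeastI_ex[OF that] not_less_Least by blast+
    then obtain k where "n = Suc k" using y0 by (cases n) auto
    then show ?thesis using n by (intro exI[of _ n]) auto
  qed
  obtain i where i: "(f ^^ i) y \<in> f ` V - V" using first y(3) by blast
  obtain j where j: "(g ^^ j) y \<in> g ` V - V" using first y(4) by blast
  have "(f ^^ i) y \<in> K" "(g ^^ j) y \<in> K" using i j V(4) by (auto simp: K_def)
  moreover have "(f ^^ (i + j)) ((g ^^ j) y) = (f ^^ i) y" using fn_gn_le[OF y(2), of j "i + j"] by simp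
  moreover have "i > m" using i yV[of i] by (metis DiffD2 not_le)
  ultimately show False using m[of "i + j"] by (metis IntI empty_iff imageI le_add1 less_imp_le order_trans)
qed

end

section \<open>Recognising the sphere\<close>

text \<open>Uniqueness of the one-point compactification. Continuity at a holds because the
  complement of a neighbourhood of b is compact and is carried by k to a compact, hence closed, set
  that misses a.\<close>

lemma punctured_compact_homeomorphic:
  fixes S :: "'a::metric_space set" and T :: "'b::metric_space set"
  assumes S: "compact S" "a \<in> S" and T: "compact T" "b \<in> T" and hom: "(S - {a}) homeomorphic (T - {b})"
  shows "S homeomorphic T"
proof -
  obtain h k where hk: "homeomorphism (S - {a}) (T - {b}) h k"
    using hom unfolding homeomorphic_def by blast
  define H where "H x = (if x = a then b else h x)" for x
  have h_in: "h x \<in> T - {b}" "k (h x) = x" if "x \<in> S - {a}" for x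
    using hk that by (auto simp: homeomorphism_def)
  have k_in: "k y \<in> S - {a}" "h (k y) = y" if "y \<in> T - {b}" for y
    using hk that by (auto simp: homeomorphism_def)
  have H_in: "H \<in> S \<rightarrow> T" using h_in T by (auto simp: H_def)
  have "openin (top_of_set S) (S \<inter> H -` W)" if W: "openin (top_of_set T) W" for W
  proof (cases "b \<in> W")
    case True
    have "compact (T - W)"
      using T(1) W unfolding openin_open by (auto simp: Diff_Int compact_diff)
    moreover have "T - W \<subseteq> T - {b}" using True by blast
    ultimately have "compact (k ` (T - W))"
      using hk by (metis compact_continuous_image continuous_on_subset homeomorphism_cont2)
    then have "open (- k ` (T - W))" by (simp add: compact_imp_closed open_Compl)
    moreover have "S \<inter> H -` W = S \<inter> - k ` (T - W)"
    proof (intro set_eqI iffI)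
      fix x assume x: "x \<in> S \<inter> H -` W"
      have "x \<noteq> k y" if "y \<in> T - W" for y
      proof
        assume "x = k y"
        then have "x \<noteq> a" "h x = y" using k_in[of y] that True by auto
        then show False using x that by (simp add: H_def)
      qed
      then show "x \<in> S \<inter> - k ` (T - W)" using x by blast
    next
      fix x assume x: "x \<in> S \<inter> - k ` (T - W)"
      have "h x \<in> W" if "x \<noteq> a"
        using h_in[of x] x that by (metis ComplD DiffI Diff_iff IntD1 IntD2 imageI singletonD)
      then show "x \<in> S \<inter> H -` W" using x True by (auto simp: H_def)
    qed
    ultimately show ?thesis unfolding openin_open by blast
  next
    case False
    have o: "openin (top_of_set S) (S - {a})" by (simp add: openin_diff_finite)
    have "W \<subseteq> T - {b}" using openin_imp_subset[OF W] False by blast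
    then have "openin (top_of_set (T - {b})) W"
      by (rule openin_subset_trans[OF W]) blast
    moreover have "continuous_on (S - {a}) h" "h \<in> (S - {a}) \<rightarrow> (T - {b})"
      using homeomorphism_cont1[OF hk] h_in(1) by blast+
    ultimately have "openin (top_of_set (S - {a})) ((S - {a}) \<inter> h -` W)"
      using continuous_openin_preimage by blast
    moreover have "S \<inter> H -` W = (S - {a}) \<inter> h -` W" using False by (auto simp: H_def split: if_splits)
    ultimately show ?thesis using o openin_trans by metis
  qed
  then have "continuous_on S H" using continuous_on_open_gen[OF H_in] by blast
  moreover have "H ` S = T"
  proof
    show "H ` S \<subseteq> T" using H_in by blast
    show "T \<subseteq> H ` S"
    proof
      fix y assume y: "y \<in> T"
      show "y \<in> H ` S"
      proof (cases "y = b")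
        case True
        then show ?thesis using S(2) by (intro image_eqI[of _ _ a]) (auto simp: H_def)
      next
        case False
        then show ?thesis using k_in[of y] y by (intro image_eqI[of _ _ "k y"]) (auto simp: H_def)
      qed
    qed
  qed
  moreover have "inj_on H S"
  proof (rule inj_onI)
    fix x y assume xy: "x \<in> S" "y \<in> S" "H x = H y"
    have Hb: "H z = b \<longleftrightarrow> z = a" if "z \<in> S" for z
      using h_in(1)[of z] that unfolding H_def by (cases "z = a") auto
    show "x = y"
    proof (cases "x = a \<or> y = a")
      case True
      then show ?thesis using xy Hb by metis
    next
      case False
      then have "h x = h y" using xy(3) by (simp add: H_def)
      then have "k (h x) = k (h y)" by simp
      then show ?thesis using False xy(1,2) by (simp add: h_in(2))
    qed
  qed
  ultimately show ?thesis
    using homeomorphism_compact[OF S(1)] unfolding homeomorphic_def by blast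
qed

lemma punctured_plane_imp_sphere:
  fixes S :: "'a::metric_space set"
  assumes "compact S" "a \<in> S" "(S - {a}) homeomorphic (UNIV :: (real^2) set)"
  shows "S homeomorphic sphere (0::real^3) 1"
proof -
  define b :: "real^3" where "b = axis 1 1"
  have b: "b \<in> sphere 0 1" by (simp add: b_def)
  have "(sphere (0::real^3) 1 - {b}) homeomorphic (UNIV :: (real^2) set)"
    by (rule homeomorphic_punctured_sphere_affine[OF _ b]) simp_all
  then have "(S - {a}) homeomorphic (sphere (0::real^3) 1 - {b})"
    using assms(3) homeomorphic_sym homeomorphic_trans by blast
  then show ?thesis using punctured_compact_homeomorphic[OF assms(1,2) _ b] by simp
qed

text \<open>The mean value inequality for f - D, on a ball where the derivative is close to D.
  Comparing two arbitrary points, and not only with \<open>x0\<close>, makes the nonlinear part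
  Lipschitz with small constant, as inverting a perturbation of D requires.\<close>

lemma C1_on_strict_derivative:
  assumes f: "C1_on X f" and X: "open X" "x0 \<in> X"
  obtains D where "(f has_derivative D) (at x0)"
    "\<And>e. e > 0 \<Longrightarrow> \<exists>d>0. ball x0 d \<subseteq> X \<and>
      (\<forall>x\<in>ball x0 d. \<forall>y\<in>ball x0 d. norm ((f x - D x) - (f y - D y)) \<le> e * norm (x - y))"
proof -
  obtain f' where f': "\<And>x. x \<in> X \<Longrightarrow> (f has_derivative blinfun_apply (f' x)) (at x)" "continuous_on X f'"
    using f unfolding C1_on_def by blast
  show ?thesis
  proof (rule that[OF f'(1)[OF X(2)]])
    fix e :: real assume e: "e > 0"
    obtain d1 where d1: "d1 > 0" "\<And>x. x \<in> X \<Longrightarrow> dist x x0 < d1 \<Longrightarrow> dist (f' x) (f' x0) < e"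
      using f'(2) X(2) e unfolding continuous_on_iff by blast
    obtain d2 where d2: "d2 > 0" "ball x0 d2 \<subseteq> X" using X open_contains_ball by blast
    define d where "d = min d1 d2"
    have sub: "ball x0 d \<subseteq> X" using d2(2) by (auto simp: d_def)
    have "norm ((f x - blinfun_apply (f' x0) x) - (f y - blinfun_apply (f' x0) y)) \<le> e * norm (x - y)"
      if "x \<in> ball x0 d" "y \<in> ball x0 d" for x y
    proof (rule differentiable_bound[of "ball x0 d" _ "\<lambda>z. blinfun_apply (f' z - f' x0)"])
      fix z assume z: "z \<in> ball x0 d"
      have "((\<lambda>x. f x - blinfun_apply (f' x0) x) has_derivative
        (\<lambda>h. blinfun_apply (f' z) h - blinfun_apply (f' x0) h)) (at z within ball x0 d)"
        using z sub by (intro has_derivative_diff has_derivative_at_withinI[OF f'(1)]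
          bounded_linear_imp_has_derivative blinfun.bounded_linear_right) auto
      moreover have "blinfun_apply (f' z - f' x0) = (\<lambda>h. blinfun_apply (f' z) h - blinfun_apply (f' x0) h)"
        by (simp add: fun_eq_iff blinfun.diff_left)
      ultimately show "((\<lambda>x. f x - blinfun_apply (f' x0) x) has_derivative blinfun_apply (f' z - f' x0))
        (at z within ball x0 d)" by simp
      have "z \<in> X" "dist z x0 < d1" using z sub by (auto simp: d_def dist_commute)
      then have "norm (f' z - f' x0) \<le> e" using d1(2)[of z] by (simp add: dist_norm)
      then show "onorm (blinfun_apply (f' z - f' x0)) \<le> e" by (simp add: norm_blinfun.rep_eq)
    qed (use that in auto)
    then show "\<exists>d>0. ball x0 d \<subseteq> X \<and> (\<forall>x\<in>ball x0 d. \<forall>y\<in>ball x0 d.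
      norm ((f x - blinfun_apply (f' x0) x) - (f y - blinfun_apply (f' x0) y)) \<le> e * norm (x - y))"
      using sub d1(1) d2(1) by (intro exI[of _ d]) (auto simp: d_def)
  qed
qed

text \<open>An invertible linear map plus a map of small Lipschitz constant is a homeomorphism,
  since finding preimages is a fixed point problem for a contraction. Thus it is enough to extend
  the nonlinear part F - L with its Lipschitz constant.\<close>

lemma sink_germ_extension:
  fixes F L :: "real^2 \<Rightarrow> real^2"
  assumes L: "linear L" "bij L" "\<And>y. norm (L y) \<le> \<kappa> * norm y" and \<kappa>: "0 \<le> \<kappa>" "\<kappa> < 1"
    and F0: "F 0 = 0"
    and strict: "\<And>e. e > 0 \<Longrightarrow> \<exists>d>0. \<forall>x\<in>ball 0 d. \<forall>y\<in>ball 0 d.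
      norm ((F x - L x) - (F y - L y)) \<le> e * norm (x - y)"
  obtains Ft Gt r c where "homeo_pair UNIV Ft Gt" "r > 0" "\<And>y. y \<in> cball 0 r \<Longrightarrow> Ft y = F y"
    "0 \<le> c" "c < 1" "\<And>y. norm (Ft y) \<le> c * norm y"
proof -
  define B where "B = inv L"
  have B: "linear B" "\<And>y. B (L y) = y" "\<And>y. L (B y) = y"
    using L(1,2) unfolding B_def by (simp_all add: bij_is_inj bij_is_surj surj_f_inv_f inj_linear_imp_inv_linear)
  obtain C where C: "C > 0" "\<And>y. norm (B y) \<le> C * norm y"
    using linear_bounded_pos[OF B(1)] by blast
  \<comment> \<open>The first bound keeps the extension contracting, at rate \<kappa> + e; the
    second gives the fixed point problem below the contraction factor C * e, at most 1/2.\<close>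
  define e where "e = min ((1 - \<kappa>) / 2) (1 / (2 * C))"
  have e: "e > 0" "\<kappa> + e < 1" "C * e < 1"
  proof -
    show "e > 0" using \<kappa> C by (simp add: e_def)
    have "e \<le> (1 - \<kappa>) / 2" unfolding e_def by (rule min.cobounded1)
    then show "\<kappa> + e < 1" using \<kappa> by simp
    have "e \<le> 1 / (2 * C)" unfolding e_def by (rule min.cobounded2)
    then have "C * e \<le> C * (1 / (2 * C))" using C(1) by (intro mult_left_mono) auto
    then show "C * e < 1" using C(1) by simp
  qed
  obtain d where d: "d > 0" "\<And>x y. x \<in> ball 0 d \<Longrightarrow> y \<in> ball 0 d \<Longrightarrow>
      norm ((F x - L x) - (F y - L y)) \<le> e * norm (x - y)"
    using strict[OF e(1)] by blast
  define r where "r = d / 2"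
  have r: "r > 0" "cball 0 r \<subseteq> ball (0::real^2) d" using d(1) by (auto simp: r_def)
  \<comment> \<open>The nearest-point projection onto the ball is 1-Lipschitz and fixes the ball.
    Composing F - L with it extends F - L to the plane without enlarging its Lipschitz
    constant.\<close>
  define p where "p = closest_point (cball (0::real^2) r)"
  have p: "p y \<in> cball 0 r" "dist (p x) (p y) \<le> dist x y" for x y
    unfolding p_def using r(1)
    by (intro closest_point_in_set closest_point_lipschitz convex_cball closed_cball; simp)+
  have p_id: "p y = y" if "y \<in> cball 0 r" for y unfolding p_def using that by (rule closest_point_self)
  define \<rho> where "\<rho> y = F (p y) - L (p y)" for y
  have lip: "norm (\<rho> x - \<rho> y) \<le> e * norm (x - y)" for x y
  proof -
    have "norm (\<rho> x - \<rho> y) \<le> e * norm (p x - p y)"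
      unfolding \<rho>_def by (intro d(2) subsetD[OF r(2) p(1)])
    also have "\<dots> \<le> e * norm (x - y)" using p(2)[of x y] e(1) by (simp add: dist_norm)
    finally show ?thesis .
  qed
  have "\<rho> 0 = 0" using p_id[of 0] r(1) F0 linear_0[OF L(1)] by (simp add: \<rho>_def)
  then have \<rho>n: "norm (\<rho> y) \<le> e * norm y" for y using lip[of y 0] by simp
  define Ft where "Ft y = L y + \<rho> y" for y
  have ex1: "\<exists>!y. Ft y = z" for z
  proof -
    have "\<exists>!y. B (z - \<rho> y) = y"
    proof (rule banach_fix_type)
      show "0 \<le> C * e" "C * e < 1" using C e by auto
      show "\<forall>x y. dist (B (z - \<rho> x)) (B (z - \<rho> y)) \<le> C * e * dist x y"
      proof (intro allI)
        fix x y
        have "B (z - \<rho> x) - B (z - \<rho> y) = B (\<rho> y - \<rho> x)" by (simp add: linear_diff[OF B(1), symmetric])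
        then have "dist (B (z - \<rho> x)) (B (z - \<rho> y)) \<le> C * norm (\<rho> y - \<rho> x)" using C(2) by (simp add: dist_norm)
        also have "\<dots> \<le> C * (e * norm (y - x))" using lip C(1) by (intro mult_left_mono) auto
        finally show "dist (B (z - \<rho> x)) (B (z - \<rho> y)) \<le> C * e * dist x y"
          by (simp add: dist_norm norm_minus_commute mult.assoc)
      qed
    qed
    moreover have "Ft y = z \<longleftrightarrow> B (z - \<rho> y) = y" for y
    proof
      assume "Ft y = z"
      then have "z - \<rho> y = L y" by (auto simp: Ft_def)
      then show "B (z - \<rho> y) = y" using B(2)[of y] by simp
    next
      assume "B (z - \<rho> y) = y"
      then have "L y = z - \<rho> y" using B(3)[of "z - \<rho> y"] by simp
      then show "Ft y = z" by (simp add: Ft_def)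
    qed
    ultimately show ?thesis by simp
  qed
  then have bij: "bij Ft" by (metis bij_iff)
  define Gt where "Gt = inv Ft"
  have inv: "Gt (Ft y) = y" "Ft (Gt y) = y" for y
    using bij by (simp_all add: Gt_def bij_is_inj bij_is_surj surj_f_inv_f)
  have contF: "continuous_on UNIV Ft"
  proof -
    have "continuous_on UNIV \<rho>"
      by (rule lipschitz_on_continuous_on[of e]) (use lip e(1) in \<open>auto intro!: lipschitz_onI simp: dist_norm\<close>)
    then show ?thesis unfolding Ft_def
      using linear_continuous_on[of L UNIV] L(1) by (auto intro!: continuous_on_add simp: linear_conv_bounded_linear)
  qed
  have "continuous_on UNIV Gt"
  \<comment> \<open>The bound
    \<open>norm (x - y) \<le> C * (norm (u - v) + e * norm (x - y))\<close> for preimages x, y of u,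
    v, solved for \<open>norm (x - y)\<close>, gives this constant.\<close>
  proof (rule lipschitz_on_continuous_on[of "C / (1 - C * e)"], rule lipschitz_onI)
    show "0 \<le> C / (1 - C * e)" using C e by simp
    fix u v
    define x y where "x = Gt u" and "y = Gt v"
    have "x - y = B (L x - L y)"
      using B(2)[of "x - y"] by (simp add: linear_diff[OF L(1)])
    also have "L x - L y = (u - v) - (\<rho> x - \<rho> y)" using inv(2)[of u] inv(2)[of v]
      by (simp add: Ft_def x_def y_def algebra_simps)
    finally have "norm (x - y) \<le> C * norm ((u - v) - (\<rho> x - \<rho> y))" using C(2) by metis
    also have "\<dots> \<le> C * (norm (u - v) + e * norm (x - y))"
      using C(1) lip[of x y] norm_triangle_ineq4[of "u - v" "\<rho> x - \<rho> y"] by (intro mult_left_mono) auto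
    finally have "norm (x - y) * (1 - C * e) \<le> C * norm (u - v)" by (simp add: algebra_simps)
    then show "dist (Gt u) (Gt v) \<le> C / (1 - C * e) * dist u v"
      using e(3) by (simp add: dist_norm x_def y_def field_simps)
  qed
  then have "homeo_pair UNIV Ft Gt" using contF inv by unfold_locales auto
  moreover have "Ft y = F y" if "y \<in> cball 0 r" for y using p_id[OF that] by (simp add: Ft_def \<rho>_def)
  moreover have "norm (Ft y) \<le> (\<kappa> + e) * norm y" for y
    using norm_triangle_ineq[of "L y" "\<rho> y"] L(3)[of y] \<rho>n[of y] by (simp add: Ft_def algebra_simps)
  ultimately show ?thesis using that[of Ft Gt r "\<kappa> + e"] r(1) \<kappa>(1) e by simp
qed

text \<open>Conjugate germs of globally attracting invariant sets: a point is moved into \<open>V\<close> by an iterate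
  of \<open>f\<close>, transported by \<open>\<psi>\<close> and moved back by as many iterates of the inverse \<open>G\<close> of \<open>F\<close>.\<close>

lemma germ_conjugacy_extends:
  assumes X: "homeo_pair X f g" and Y: "homeo_pair Y F G"
    and V: "openin (top_of_set X) V" "f ` V \<subseteq> V" "\<And>x. x \<in> X \<Longrightarrow> \<exists>n. (f ^^ n) x \<in> V"
    and \<psi>: "continuous_on V \<psi>" "\<psi> ` V \<subseteq> Y" "\<And>x. x \<in> V \<Longrightarrow> \<psi> (f x) = F (\<psi> x)"
  obtains H where "continuous_on X H" "H ` X \<subseteq> Y"
    "\<And>x n. x \<in> X \<Longrightarrow> (f ^^ n) x \<in> V \<Longrightarrow> H x = (G ^^ n) (\<psi> ((f ^^ n) x))"
proof -
  interpret X: homeo_pair X f g by (rule X)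
  interpret Y: homeo_pair Y F G by (rule Y)
  define h where "h n x = (G ^^ n) (\<psi> ((f ^^ n) x))" for n x
  have hSuc: "h (Suc n) x = h n x" if "(f ^^ n) x \<in> V" for n x
  proof -
    have "\<psi> ((f ^^ Suc n) x) = F (\<psi> ((f ^^ n) x))" using \<psi>(3) that by simp
    moreover have "\<psi> ((f ^^ n) x) \<in> Y" using \<psi>(2) that by blast
    ultimately show ?thesis
      unfolding h_def funpow_Suc_right[of n G] by (simp add: Y.g_f)
  qed
  have inV: "(f ^^ m) x \<in> V \<and> h m x = h n x" if "(f ^^ n) x \<in> V" "n \<le> m" for m n x
    using that(2)
  proof (induction m rule: dec_induct)
    case (step m)
    then show ?case using V(2) hSuc[of m x] by auto
  qed (simp add: that(1))
  have const: "h m x = h n x" if "(f ^^ m) x \<in> V" "(f ^^ n) x \<in> V" for m n x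
    using inV[OF that(1), of n] inV[OF that(2), of m] by (cases "m \<le> n") auto
  obtain N where N: "\<And>x. x \<in> X \<Longrightarrow> (f ^^ N x) x \<in> V" using V(3) by metis
  define H where "H x = h (N x) x" for x
  have H: "H x = h n x" if "x \<in> X" "(f ^^ n) x \<in> V" for x n
    unfolding H_def using const[OF N[OF that(1)] that(2)] .
  \<comment> \<open>The formulas \<open>h n\<close> live on open sets \<open>T n\<close> that cover
    X, and the conjugacy makes them agree on overlaps, so they paste to a continuous map.\<close>
  define T where "T n = {x \<in> X. (f ^^ n) x \<in> V}" for n
  have "continuous_map (top_of_set X) euclidean H"
  proof (rule pasting_lemma[of UNIV _ T _ h])
    fix n
    show "openin (top_of_set X) (T n)" unfolding T_def by (rule X.openin_preimage_fn[OF V(1)])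
    have "continuous_on (T n) ((G ^^ n) \<circ> (\<psi> \<circ> (f ^^ n)))"
    proof (intro continuous_on_compose)
      show "continuous_on (T n) (f ^^ n)" by (rule continuous_on_subset[OF X.cont_fn]) (auto simp: T_def)
      show "continuous_on ((f ^^ n) ` T n) \<psi>" by (rule continuous_on_subset[OF \<psi>(1)]) (auto simp: T_def)
      show "continuous_on ((\<psi> \<circ> (f ^^ n)) ` T n) (G ^^ n)"
        by (rule continuous_on_subset[OF Y.cont_gn]) (use \<psi>(2) in \<open>auto simp: T_def\<close>)
    qed
    moreover have "X \<inter> T n = T n" by (auto simp: T_def)
    ultimately show "continuous_map (subtopology (top_of_set X) (T n)) euclidean (h n)"
      by (simp add: subtopology_subtopology h_def o_def)
  next
    show "h i x = h j x" if "x \<in> topspace (top_of_set X) \<inter> T i \<inter> T j" for i j x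
      using that const by (auto simp: T_def)
    show "\<exists>j. j \<in> UNIV \<and> x \<in> T j \<and> H x = h j x" if "x \<in> topspace (top_of_set X)" for x
      using that N by (auto simp: T_def H_def)
  qed
  then have "continuous_on X H" by simp
  moreover have "H ` X \<subseteq> Y"
    using N \<psi>(2) by (auto simp: H_def h_def intro!: Y.gn_in)
  ultimately show ?thesis using that H by (simp add: h_def)
qed

text \<open>Both \<psi> and \<phi> are extended. The extensions are mutually inverse because the
  same number n of steps that brings x into V brings its image into W, and there \<phi> undoes
  \<psi>.\<close>

lemma germ_conjugacy_homeomorphic:
  assumes X: "homeo_pair X f g" and Y: "homeo_pair Y F G"
    and V: "openin (top_of_set X) V" "f ` V \<subseteq> V" "\<And>x. x \<in> X \<Longrightarrow> \<exists>n. (f ^^ n) x \<in> V"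
    and W: "openin (top_of_set Y) W" "F ` W \<subseteq> W" "\<And>y. y \<in> Y \<Longrightarrow> \<exists>n. (F ^^ n) y \<in> W"
    and hom: "homeomorphism V W \<psi> \<phi>" and conj: "\<And>x. x \<in> V \<Longrightarrow> \<psi> (f x) = F (\<psi> x)"
  shows "X homeomorphic Y"
proof -
  interpret X: homeo_pair X f g by (rule X)
  interpret Y: homeo_pair Y F G by (rule Y)
  have VX: "V \<subseteq> X" and WY: "W \<subseteq> Y" using V(1) W(1) openin_imp_subset by blast+
  have h: "continuous_on V \<psi>" "\<psi> ` V = W" "continuous_on W \<phi>" "\<phi> ` W = V"
    "\<And>x. x \<in> V \<Longrightarrow> \<phi> (\<psi> x) = x" "\<And>y. y \<in> W \<Longrightarrow> \<psi> (\<phi> y) = y"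
    using hom by (auto simp: homeomorphism_def)
  have conj': "\<phi> (F y) = f (\<phi> y)" if "y \<in> W" for y
  proof -
    have "\<phi> y \<in> V" using that h(4) by blast
    then have "\<psi> (f (\<phi> y)) = F y" "f (\<phi> y) \<in> V" using conj h(6)[OF that] V(2) by auto
    then show ?thesis using h(5) by metis
  qed
  have "\<psi> ` V \<subseteq> Y" "\<phi> ` W \<subseteq> X" using h(2,4) VX WY by auto
  obtain H where H: "continuous_on X H" "H ` X \<subseteq> Y"
    "\<And>x n. x \<in> X \<Longrightarrow> (f ^^ n) x \<in> V \<Longrightarrow> H x = (G ^^ n) (\<psi> ((f ^^ n) x))"
    using germ_conjugacy_extends[OF X Y V h(1) \<open>\<psi> ` V \<subseteq> Y\<close> conj] by metis
  obtain K where K: "continuous_on Y K" "K ` Y \<subseteq> X"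
    "\<And>y n. y \<in> Y \<Longrightarrow> (F ^^ n) y \<in> W \<Longrightarrow> K y = (g ^^ n) (\<phi> ((F ^^ n) y))"
    using germ_conjugacy_extends[OF Y X W h(3) \<open>\<phi> ` W \<subseteq> X\<close> conj'] by metis
  have KH: "K (H x) = x" if x: "x \<in> X" for x
  proof -
    obtain n where n: "(f ^^ n) x \<in> V" using V(3) x by blast
    then have w: "\<psi> ((f ^^ n) x) \<in> W" using h(2) by blast
    have Hx: "H x = (G ^^ n) (\<psi> ((f ^^ n) x))" by (rule H(3)[OF x n])
    have FH: "(F ^^ n) (H x) = \<psi> ((f ^^ n) x)" unfolding Hx using w WY by (intro Y.fn_gn) blast
    have "K (H x) = (g ^^ n) (\<phi> ((F ^^ n) (H x)))" using H(2) x w FH by (intro K(3)) auto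
    then show ?thesis unfolding FH h(5)[OF n] by (simp add: X.gn_fn x)
  qed
  have HK: "H (K y) = y" if y: "y \<in> Y" for y
  proof -
    obtain n where n: "(F ^^ n) y \<in> W" using W(3) y by blast
    then have v: "\<phi> ((F ^^ n) y) \<in> V" using h(4) by blast
    have Ky: "K y = (g ^^ n) (\<phi> ((F ^^ n) y))" by (rule K(3)[OF y n])
    have fK: "(f ^^ n) (K y) = \<phi> ((F ^^ n) y)" unfolding Ky using v VX by (intro X.fn_gn) blast
    have "H (K y) = (G ^^ n) (\<psi> ((f ^^ n) (K y)))" using K(2) y v fK by (intro H(3)) auto
    then show ?thesis unfolding fK h(6)[OF n] by (simp add: Y.gn_fn y)
  qed
  have "homeomorphism X Y H K"
    using H(1,2) K(1,2) KH HK by (auto simp: homeomorphism_def image_iff) (metis image_subset_iff)+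
  then show ?thesis unfolding homeomorphic_def by blast
qed

section \<open>Linearisation in charts\<close>

lemma linear_bij_bounds:
  fixes P :: "real^2 \<Rightarrow> real^2"
  assumes "linear P" "bij P"
  obtains C where "C > 0" "\<And>v. norm (P v) \<le> C * norm v" "\<And>v. norm v \<le> C * norm (P v)"
proof -
  have inv: "linear (inv P)" "\<And>v. inv P (P v) = v"
    using assms by (simp_all add: bij_is_inj inj_linear_imp_inv_linear)
  obtain B where B: "B > 0" "\<And>v. norm (P v) \<le> B * norm v" using linear_bounded_pos[OF assms(1)] by blast
  obtain B' where B': "B' > 0" "\<And>v. norm (inv P v) \<le> B' * norm v" using linear_bounded_pos[OF inv(1)] by blast
  show ?thesis
  proof (rule that[of "max B B'"])
    show "max B B' > 0" using B by simp
    show "norm (P v) \<le> max B B' * norm v" for v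
      using B(2)[of v] by (rule order_trans) (simp add: mult_right_mono)
    show "norm v \<le> max B B' * norm (P v)" for v
      using B'(2)[of "P v"] unfolding inv(2) by (rule order_trans) (simp add: mult_right_mono)
  qed
qed

locale surface =
  fixes S :: "'a::metric_space set" and A :: "'a chart set"
  assumes atlas: "surface_atlas S A"
begin

lemma chart_homeo: "c \<in> A \<Longrightarrow> homeomorphism (fst c) (snd c ` fst c) (snd c) (chart_inv c)"
  and chart_openin: "c \<in> A \<Longrightarrow> openin (top_of_set S) (fst c)"
  and chart_open: "c \<in> A \<Longrightarrow> open (snd c ` fst c)"
  using atlas unfolding surface_atlas_def is_chart_def by blast+

lemma chart_at: "x \<in> S \<Longrightarrow> \<exists>c\<in>A. x \<in> fst c"
  using atlas unfolding surface_atlas_def by blast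

lemma chart_subset: "c \<in> A \<Longrightarrow> fst c \<subseteq> S"
  using chart_openin openin_imp_subset by blast

lemma chart_inv_chart: "c \<in> A \<Longrightarrow> x \<in> fst c \<Longrightarrow> chart_inv c (snd c x) = x"
  using chart_homeo unfolding homeomorphism_def by blast

lemma local_coord_chart:
  assumes c: "c \<in> A" "p \<in> fst c" and P: "linear P" "bij P"
  shows "local_coord S p (fst c) (\<lambda>x. P (snd c x - snd c p)) (\<lambda>v. chart_inv c (snd c p + inv P v))"
proof
  show "openin (top_of_set S) (fst c)" "p \<in> fst c" using c chart_openin by auto
  have invP: "linear (inv P)" "\<And>v. inv P (P v) = v" "\<And>v. P (inv P v) = v"
    using P by (simp_all add: bij_is_inj bij_is_surj surj_f_inv_f inj_linear_imp_inv_linear)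
  have cont: "continuous_on X P" "continuous_on X (inv P)" for X
    using P(1) invP(1) by (simp_all add: linear_continuous_on linear_conv_bounded_linear)
  have im: "(\<lambda>x. P (snd c x - snd c p)) ` fst c = P ` (\<lambda>z. z - snd c p) ` snd c ` fst c"
    by (simp add: image_image)
  show "open ((\<lambda>x. P (snd c x - snd c p)) ` fst c)"
    unfolding im using P chart_open[OF c(1)]
    by (simp add: open_bijective_linear_image_eq open_translation_subtract)
  note h = chart_homeo[OF c(1), unfolded homeomorphism_def]
  show "homeomorphism (fst c) ((\<lambda>x. P (snd c x - snd c p)) ` fst c) (\<lambda>x. P (snd c x - snd c p))
    (\<lambda>v. chart_inv c (snd c p + inv P v))"
  proof (rule homeomorphismI)
    show "continuous_on (fst c) (\<lambda>x. P (snd c x - snd c p))"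
      using h by (intro continuous_on_compose2[OF cont(1)] continuous_intros) auto
    have "continuous_on (snd c ` fst c) (chart_inv c)" using h by blast
    then show "continuous_on ((\<lambda>x. P (snd c x - snd c p)) ` fst c) (\<lambda>v. chart_inv c (snd c p + inv P v))"
      by (rule continuous_on_compose2) (auto intro!: continuous_intros cont simp: invP)
  qed (use c in \<open>auto simp: invP chart_inv_chart\<close>)
  show "P (snd c p - snd c p) = 0" using P(1) by (simp add: linear_0)
qed

lemma openin_chart_preimage:
  assumes "c \<in> A" "d \<in> A" "continuous_on S g" "g ` S \<subseteq> S"
  shows "openin (top_of_set S) (fst c \<inter> g -` fst d)"
proof -
  have "openin (top_of_set S) (S \<inter> g -` fst d)"
    using assms chart_openin[OF assms(2)] by (intro continuous_openin_preimage[of _ _ S]) auto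
  then have "openin (top_of_set S) (fst c \<inter> (S \<inter> g -` fst d))"
    using chart_openin[OF assms(1)] by (rule openin_Int[rotated])
  moreover have "fst c \<inter> (S \<inter> g -` fst d) = fst c \<inter> g -` fst d" using chart_subset[OF assms(1)] by blast
  ultimately show ?thesis by simp
qed

lemma open_local_dom:
  assumes "c \<in> A" "d \<in> A" "continuous_on S g" "g ` S \<subseteq> S"
  shows "open (local_dom c d g)"
proof -
  have "openin (top_of_set (fst c)) (fst c \<inter> g -` fst d)"
    by (rule openin_subset_trans[OF openin_chart_preimage[OF assms] _ chart_subset[OF assms(1)]]) simp
  then have "openin (top_of_set (snd c ` fst c)) (local_dom c d g)"
    unfolding local_dom_def using homeomorphism_imp_open_map[OF chart_homeo[OF assms(1)]] by blast
  then show ?thesis using chart_open[OF assms(1)] by (simp add: openin_open_eq)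
qed

section \<open>Derivatives of iterates in charts\<close>

lemma local_rep_differentiable:
  assumes "C1_map S A g" "c \<in> A" "d \<in> A" "x \<in> fst c" "g x \<in> fst d"
  shows "local_rep c d g differentiable (at (snd c x))"
proof -
  have "snd c x \<in> local_dom c d g" using assms(4,5) by (auto simp: local_dom_def)
  moreover have "C1_on (local_dom c d g) (local_rep c d g)" using assms by (simp add: C1_map_def)
  ultimately show ?thesis unfolding C1_on_def differentiable_def by blast
qed

lemma C1_map_id: "C1_map S A id"
  using atlas by (auto simp: C1_map_def surface_atlas_def continuous_on_id)

lemma local_rep_chart: "c \<in> A \<Longrightarrow> w \<in> fst c \<Longrightarrow> local_rep c d g (snd c w) = snd d (g w)"
  by (simp add: local_rep_def chart_inv_chart)

lemma local_rep_compose_has_derivative: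
  assumes g: "continuous_on S g" "g ` S \<subseteq> S" and c: "c \<in> A" "d \<in> A" "e \<in> A"
    and x: "x \<in> fst c" "g x \<in> fst e"
    and D: "(local_rep c e g has_derivative D) (at (snd c x))"
    and E: "(local_rep e d h has_derivative E) (at (snd e (g x)))"
  shows "(local_rep c d (h \<circ> g) has_derivative E \<circ> D) (at (snd c x))"
proof (rule has_derivative_transform_within_open)
  show "((local_rep e d h) \<circ> (local_rep c e g) has_derivative E \<circ> D) (at (snd c x))"
    using D E by (intro diff_chain_at) (simp_all add: local_rep_chart c x)
  show "open (local_dom c e g)" using open_local_dom c g by blast
  show "snd c x \<in> local_dom c e g" using x by (auto simp: local_dom_def)
  show "(local_rep e d h \<circ> local_rep c e g) z = local_rep c d (h \<circ> g) z" if "z \<in> local_dom c e g" for z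
    using that by (auto simp: local_dom_def local_rep_chart c)
qed

lemma funpow_continuous_map:
  assumes "continuous_on S f" "f ` S \<subseteq> S"
  shows "continuous_on S (f ^^ k)" "(f ^^ k) ` S \<subseteq> S"
proof (induction k)
  case (Suc k)
  { case 1 show ?case
      using continuous_on_compose[OF Suc(1) continuous_on_subset[OF assms(1) Suc(2)]] by simp
  next
    case 2 show ?case using Suc(2) assms(2) by auto }
qed auto

text \<open>The orbit of x may leave the chart c before it comes back, so the chain rule goes
  through a chart e around the intermediate point; hence the induction is over all target charts
  d.\<close>

lemma funpow_local_rep_differentiable:
  assumes f: "C1_map S A f" and c: "c \<in> A" "x \<in> fst c"
  shows "d \<in> A \<Longrightarrow> (f ^^ k) x \<in> fst d \<Longrightarrow> local_rep c d (f ^^ k) differentiable (at (snd c x))"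
proof (induction k arbitrary: d)
  case 0
  then show ?case using local_rep_differentiable[OF C1_map_id c(1) _ c(2)] unfolding funpow.simps(1) by blast
next
  case (Suc k)
  have f': "continuous_on S f" "f ` S \<subseteq> S" using f by (auto simp: C1_map_def)
  note fk = funpow_continuous_map[OF f', of k]
  have "x \<in> S" using c chart_subset by blast
  then have "(f ^^ k) x \<in> S" using fk(2) by blast
  then obtain e where e: "e \<in> A" "(f ^^ k) x \<in> fst e" using chart_at by blast
  obtain D where "(local_rep c e (f ^^ k) has_derivative D) (at (snd c x))"
    using Suc.IH[OF e] unfolding differentiable_def by blast
  moreover obtain E where "(local_rep e d f has_derivative E) (at (snd e ((f ^^ k) x)))"
    using local_rep_differentiable[OF f e(1) Suc.prems(1) e(2)] Suc.prems(2)
    unfolding differentiable_def by auto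
  ultimately have "(local_rep c d (f \<circ> (f ^^ k)) has_derivative E \<circ> D) (at (snd c x))"
    using local_rep_compose_has_derivative[OF fk c(1) Suc.prems(1) e(1) c(2) e(2)] by blast
  then show ?case unfolding differentiable_def by auto
qed

lemma local_rep_linearization:
  assumes g: "continuous_on S g" "g ` S \<subseteq> S" and c: "c \<in> A" "p \<in> fst c" and p: "g p = p"
    and D: "(local_rep c c g has_derivative D) (at (snd c p))"
    and P: "linear (P :: real^2 \<Rightarrow> real^2)" "bij P" and e: "e > 0"
  shows "\<exists>O'. openin (top_of_set S) O' \<and> p \<in> O' \<and> O' \<subseteq> fst c \<and> (\<forall>x\<in>O'. g x \<in> fst c \<and>
    norm (P (snd c (g x) - snd c p) - P (D (snd c x - snd c p))) \<le> e * norm (P (snd c x - snd c p)))"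
proof -
  obtain C where C: "C > 0" "\<And>v. norm (P v) \<le> C * norm v" "\<And>v. norm v \<le> C * norm (P v)"
    using linear_bij_bounds[OF P] by blast
  \<comment> \<open>One factor C is lost when P is applied to the error, the other when the
    displacement is bounded by its image under P.\<close>
  have "e / (C * C) > 0" using e C by simp
  then obtain d where d: "d > 0" "\<And>y. norm (y - snd c p) < d \<Longrightarrow>
    norm (local_rep c c g y - local_rep c c g (snd c p) - D (y - snd c p)) \<le> e / (C * C) * norm (y - snd c p)"
    using D unfolding has_derivative_at_alt by blast
  define O' where "O' = (fst c \<inter> g -` fst c) \<inter> (fst c \<inter> snd c -` ball (snd c p) d)"
  have "openin (top_of_set (fst c)) (fst c \<inter> snd c -` ball (snd c p) d)"
    using chart_homeo[OF c(1)] by (intro continuous_openin_preimage_gen) (auto simp: homeomorphism_def)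
  then have "openin (top_of_set S) (fst c \<inter> snd c -` ball (snd c p) d)"
    using chart_openin[OF c(1)] openin_trans by blast
  then have "openin (top_of_set S) O'"
    unfolding O'_def using openin_chart_preimage[OF c(1) c(1) g] by (rule openin_Int[rotated])
  moreover have "p \<in> O'" "O' \<subseteq> fst c" using c p d(1) by (auto simp: O'_def)
  moreover have "g x \<in> fst c \<and>
    norm (P (snd c (g x) - snd c p) - P (D (snd c x - snd c p))) \<le> e * norm (P (snd c x - snd c p))"
    if x: "x \<in> O'" for x
  proof -
    have x': "x \<in> fst c" "g x \<in> fst c" "norm (snd c x - snd c p) < d"
      using x by (auto simp: O'_def dist_norm norm_minus_commute)
    let ?z = "snd c x - snd c p"
    have "norm (P (snd c (g x) - snd c p) - P (D ?z)) = norm (P (snd c (g x) - snd c p - D ?z))"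
      by (simp add: linear_diff[OF P(1)])
    also have "\<dots> \<le> C * norm (snd c (g x) - snd c p - D ?z)" by (rule C(2))
    also have "\<dots> \<le> C * (e / (C * C) * norm ?z)"
      using mult_left_mono[OF d(2)[OF x'(3)], of C] C(1) by (simp only: local_rep_chart c x'(1) p less_imp_le)
    also have "\<dots> \<le> C * (e / (C * C) * (C * norm (P ?z)))"
      using C e by (intro mult_left_mono) auto
    also have "\<dots> = e * norm (P ?z)" using C(1) by (simp add: field_simps)
    finally show ?thesis using x' by blast
  qed
  ultimately show ?thesis by blast
qed

text \<open>Properness excludes the saddle, and in the other cases the linear estimate survives the
  nonlinear error when e is half the distance of \<kappa> from 1. The eigenvalue bounds are kept
  beside the topological statements because sinks and sources are defined by the derivative.\<close>

lemma hyperbolic_fixed_point_cases: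
  assumes f: "C1_map S A f" and hp: "homeo_pair S (f ^^ k) h"
    and c: "c \<in> A" "p \<in> fst c" and p: "(f ^^ k) p = p"
    and hyp: "\<And>\<mu>. complex_eigenvalue (matrix (frechet_derivative (local_rep c c (f ^^ k)) (at (snd c p)))) \<mu>
      \<Longrightarrow> norm \<mu> \<noteq> 1"
    and R: "finite R" "\<And>x. x \<in> R \<Longrightarrow> x \<in> S \<and> (f ^^ k) x = x"
    and proper: "\<And>K. compact K \<Longrightarrow> K \<subseteq> S \<Longrightarrow> K \<inter> R = {} \<Longrightarrow> \<exists>m0. \<forall>m\<ge>m0. ((f ^^ k) ^^ m) ` K \<inter> K = {}"
  shows "attracts S (f ^^ k) p \<and>
      (\<forall>\<mu>. complex_eigenvalue (matrix (frechet_derivative (local_rep c c (f ^^ k)) (at (snd c p)))) \<mu> \<longrightarrow> norm \<mu> < 1) \<or>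
    attracts S h p \<and>
      (\<forall>\<mu>. complex_eigenvalue (matrix (frechet_derivative (local_rep c c (f ^^ k)) (at (snd c p)))) \<mu> \<longrightarrow> norm \<mu> > 1)"
proof -
  let ?g = "f ^^ k"
  define D where "D = frechet_derivative (local_rep c c ?g) (at (snd c p))"
  define M where "M = matrix D"
  have diff: "(local_rep c c ?g has_derivative D) (at (snd c p))"
    using funpow_local_rep_differentiable[OF f c c(1)] p c(2) frechet_derivative_works
    unfolding D_def by metis
  have D: "D v = M *v v" for v
    using has_derivative_linear[OF diff] unfolding M_def by (simp add: matrix_works)
  have g: "continuous_on S ?g" "?g ` S \<subseteq> S"
    using hp by (auto simp: homeo_pair_def)
  note lin = local_rep_linearization[OF g c p diff]
  note coord = local_coord_chart[OF c]
  have hyp': "\<forall>\<mu>. complex_eigenvalue M \<mu> \<longrightarrow> norm \<mu> \<noteq> 1" using hyp unfolding M_def D_def by blast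
  have dyn: "local_dynamics S ?g h p (fst c) (\<lambda>x. P (snd c x - snd c p)) (\<lambda>v. chart_inv c (snd c p + inv P v))"
    if "linear P" "bij P" for P
    using hp coord[OF that] p by (simp add: local_dynamics_def local_dynamics_axioms_def)
  show ?thesis
    using hyp'
  proof (cases rule: hyperbolic_matrix_cases)
    case (sink P \<kappa>)
    define e where "e = (1 - \<kappa>) / 2"
    have e: "e > 0" "\<kappa> + e < 1" "0 \<le> \<kappa> + e" using sink(3,4) by (auto simp: e_def field_simps)
    obtain O' where O': "openin (top_of_set S) O'" "p \<in> O'" "O' \<subseteq> fst c"
      "\<And>x. x \<in> O' \<Longrightarrow> ?g x \<in> fst c"
      "\<And>x. x \<in> O' \<Longrightarrow> norm (P (snd c (?g x) - snd c p) - P (D (snd c x - snd c p))) \<le> e * norm (P (snd c x - snd c p))"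
      using lin[OF sink(1,2) e(1)] by blast
    have "norm (P (snd c (?g x) - snd c p)) \<le> (\<kappa> + e) * norm (P (snd c x - snd c p))" if "x \<in> O'" for x
      using O'(5)[OF that] sink(5)[of "snd c x - snd c p"]
        norm_triangle_sub[of "P (snd c (?g x) - snd c p)" "P (D (snd c x - snd c p))"]
      by (simp add: D algebra_simps)
    then have "attracts S ?g p"
      using local_coord.contraction_attracts[OF coord[OF sink(1,2)] O'(1-3) e(3,2), of ?g] O'(4) by blast
    then show ?thesis using sink(6) unfolding M_def D_def by blast
  next
    case (source P \<kappa>)
    define e where "e = (\<kappa> - 1) / 2"
    have e: "e > 0" "\<kappa> - e > 1" using source(3) by (auto simp: e_def field_simps)
    obtain O' where O': "openin (top_of_set S) O'" "p \<in> O'" "O' \<subseteq> fst c"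
      "\<And>x. x \<in> O' \<Longrightarrow> norm (P (snd c (?g x) - snd c p) - P (D (snd c x - snd c p))) \<le> e * norm (P (snd c x - snd c p))"
      using lin[OF source(1,2) e(1)] by blast
    have "norm (P (snd c (?g x) - snd c p)) \<ge> (\<kappa> - e) * norm (P (snd c x - snd c p))" if "x \<in> O'" for x
      using O'(4)[OF that] source(4)[of "snd c x - snd c p"]
        norm_triangle_sub[of "P (D (snd c x - snd c p))" "P (snd c (?g x) - snd c p)"]
      by (simp add: D algebra_simps norm_minus_commute)
    then have "attracts S h p"
      using local_dynamics.expansion_attracts_inverse[OF dyn[OF source(1,2)] O'(1-3) e(2)] by blast
    then show ?thesis using source(5) unfolding M_def D_def by blast
  next
    case (saddle P a b)
    have "\<exists>O'. openin (top_of_set S) O' \<and> p \<in> O' \<and> O' \<subseteq> fst c \<and> (\<forall>x\<in>O'.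
      \<bar>P (snd c (?g x) - snd c p) $ 1 - a * P (snd c x - snd c p) $ 1\<bar> \<le> e * norm (P (snd c x - snd c p)) \<and>
      \<bar>P (snd c (?g x) - snd c p) $ 2 - b * P (snd c x - snd c p) $ 2\<bar> \<le> e * norm (P (snd c x - snd c p)))"
      if e: "e > 0" for e
    proof -
      obtain O' where O': "openin (top_of_set S) O'" "p \<in> O'" "O' \<subseteq> fst c"
        "\<And>x. x \<in> O' \<Longrightarrow> norm (P (snd c (?g x) - snd c p) - P (D (snd c x - snd c p))) \<le> e * norm (P (snd c x - snd c p))"
        using lin[OF saddle(1,2) e] by blast
      have "\<bar>P (snd c (?g x) - snd c p) $ i - P (D (snd c x - snd c p)) $ i\<bar> \<le> e * norm (P (snd c x - snd c p))"
        if "x \<in> O'" for x i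
        using component_le_norm_cart[of "P (snd c (?g x) - snd c p) - P (D (snd c x - snd c p))" i] O'(4)[OF that]
        by simp
      from this[where i = 1] this[where i = 2] show ?thesis
        using O'(1-3) unfolding D saddle(5,6) by blast
    qed
    then show ?thesis
      using local_dynamics.not_saddle[OF dyn[OF saddle(1,2)] saddle(3,4) _ R proper] by blast
  qed
qed

lemma basin_complement_point_imp_sphere:
  assumes S: "compact S" and hp: "homeo_pair S f h" and f: "C1_map S A f" "C1_map S A h"
    and p: "p \<in> S" "f p = p" and q: "q \<in> S" "f q = q" "p \<noteq> q"
    and conv: "\<And>x. x \<in> S - {p} \<Longrightarrow> (\<lambda>n. (f ^^ n) x) \<longlonglongrightarrow> q"
    and sink: "\<And>c \<mu>. c \<in> A \<Longrightarrow> q \<in> fst c \<Longrightarrow>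
      complex_eigenvalue (matrix (frechet_derivative (local_rep c c f) (at (snd c q)))) \<mu> \<Longrightarrow> norm \<mu> < 1"
  shows "S homeomorphic sphere (0::real^3) 1"
proof -
  interpret homeo_pair S f h by (rule hp)
  obtain c where c: "c \<in> A" "q \<in> fst c" using chart_at q(1) by blast
  have fS: "f ` S \<subseteq> S" and hS: "h ` S \<subseteq> S" using f_in g_in by auto
  have hq: "h q = q" using g_f[OF q(1)] q(2) by simp
  have X: "open (local_dom c c f)" "snd c q \<in> local_dom c c f"
    using open_local_dom[OF c(1) c(1) cont_f fS] c q(2) by (auto simp: local_dom_def)
  have "C1_on (local_dom c c f) (local_rep c c f)" using f(1) c by (simp add: C1_map_def)
  from C1_on_strict_derivative[OF this X] obtain D where
    D: "(local_rep c c f has_derivative D) (at (snd c q))"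
    and strict: "\<And>e. e > 0 \<Longrightarrow> \<exists>d>0. ball (snd c q) d \<subseteq> local_dom c c f \<and>
      (\<forall>x\<in>ball (snd c q) d. \<forall>y\<in>ball (snd c q) d.
        norm ((local_rep c c f x - D x) - (local_rep c c f y - D y)) \<le> e * norm (x - y))" by blast
  have lD: "linear D" using D by (rule has_derivative_linear)
  have DM: "D v = matrix D *v v" for v using lD by (simp add: matrix_works)
  \<comment> \<open>The chain rule for \<open>h \<circ> f\<close>, which is the identity near q,
    gives D a left inverse.\<close>
  have bD: "bij D"
  proof -
    obtain E where E: "(local_rep c c h has_derivative E) (at (snd c (f q)))"
      using local_rep_differentiable[OF f(2) c(1) c(1) c(2)] hq c(2) q(2) unfolding differentiable_def by auto
    have "(local_rep c c (h \<circ> f) has_derivative E \<circ> D) (at (snd c q))"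
      using local_rep_compose_has_derivative[OF cont_f fS c(1) c(1) c(1) c(2) _ D E] c(2) q(2) by simp
    then have "(id has_derivative E \<circ> D) (at (snd c q))"
    proof (rule has_derivative_transform_within_open)
      show "open (snd c ` fst c)" "snd c q \<in> snd c ` fst c" using chart_open c by auto
      show "local_rep c c (h \<circ> f) z = id z" if "z \<in> snd c ` fst c" for z
        using that chart_subset[OF c(1)] g_f by (auto simp: local_rep_chart c)
    qed
    then have "E \<circ> D = id" using has_derivative_id has_derivative_unique by blast
    then have "inj D" by (metis inj_on_id inj_on_imageI2)
    then show ?thesis using lD linear_inj_imp_surj by (auto simp: bij_def)
  qed
  have ev: "norm \<mu> \<noteq> 1 \<and> \<not> norm \<mu> > 1" if "complex_eigenvalue (matrix D) \<mu>" for \<mu>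
    using sink[OF c] that frechet_derivative_at[OF D] by fastforce
  then have hyp: "\<forall>\<mu>. complex_eigenvalue (matrix D) \<mu> \<longrightarrow> norm \<mu> \<noteq> 1" by blast
  have le1: "\<not> norm \<mu> > 1" if "complex_eigenvalue (matrix D) \<mu>" for \<mu> using ev[OF that] by blast
  \<comment> \<open>Contracting coordinates for D. The source case dies because a real matrix has
    some complex eigenvalue, here of norm below 1; the saddle case dies by its eigenvalue b.\<close>
  have "\<exists>(P :: real^2 \<Rightarrow> real^2) \<kappa>. linear P \<and> bij P \<and> 0 \<le> \<kappa> \<and> \<kappa> < 1 \<and> (\<forall>v. norm (P (D v)) \<le> \<kappa> * norm (P v))"
    using hyp
  proof (cases rule: hyperbolic_matrix_cases)
    case (sink P \<kappa>)
    then have "\<And>v. norm (P (D v)) \<le> \<kappa> * norm (P v)" by (simp add: DM)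
    then show ?thesis using sink(1-4) by blast
  next
    case (source P \<kappa>)
    then show ?thesis using le1 complex_eigenvalue_2_exists by blast
  next
    case (saddle P a b)
    then show ?thesis using le1[OF saddle(7)] by (simp add: norm_of_real)
  qed
  then obtain P :: "real^2 \<Rightarrow> real^2" and \<kappa> where P: "linear P" "bij P" and \<kappa>: "0 \<le> \<kappa>" "\<kappa> < 1"
    "\<And>v. norm (P (D v)) \<le> \<kappa> * norm (P v)" by blast
  define \<psi> where "\<psi> x = P (snd c x - snd c q)" for x
  define \<phi> where "\<phi> v = chart_inv c (snd c q + inv P v)" for v
  interpret local_coord S q "fst c" \<psi> \<phi>
    unfolding \<psi>_def[abs_def] \<phi>_def[abs_def] by (rule local_coord_chart[OF c P])
  have invP: "linear (inv P)" "bij (inv P)" "\<And>v. inv P (P v) = v" "\<And>v. P (inv P v) = v"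
    using P by (simp_all add: bij_is_inj bij_is_surj surj_f_inv_f inj_linear_imp_inv_linear bij_imp_bij_inv)
  define F where "F v = P (local_rep c c f (snd c q + inv P v) - snd c q)" for v
  define L where "L v = P (D (inv P v))" for v
  have L: "linear L" "bij L"
  proof -
    have "L = P \<circ> (D \<circ> inv P)" by (simp add: L_def fun_eq_iff)
    then show "linear L" "bij L"
      using P invP(1,2) lD bD by (auto intro!: linear_compose bij_comp)
  qed
  have Ln: "norm (L v) \<le> \<kappa> * norm v" for v using \<kappa>(3)[of "inv P v"] by (simp add: L_def invP)
  have F0: "F 0 = 0" using q(2) by (simp add: F_def linear_0[OF invP(1)] linear_0[OF P(1)] local_rep_chart c)
  have F\<psi>: "\<psi> (f x) = F (\<psi> x)" if "x \<in> fst c" for x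
    using that by (simp add: \<psi>_def F_def invP local_rep_chart c)
  have strictF: "\<exists>d>0. \<forall>x\<in>ball 0 d. \<forall>y\<in>ball 0 d. norm ((F x - L x) - (F y - L y)) \<le> e * norm (x - y)"
    if e: "e > 0" for e
  proof -
    obtain C where C: "C > 0" "\<And>v. norm (P v) \<le> C * norm v" "\<And>v. norm v \<le> C * norm (P v)"
      using linear_bij_bounds[OF P] by blast
    have Ci: "norm (inv P v) \<le> C * norm v" for v using C(3)[of "inv P v"] by (simp add: invP)
    have e': "e / (C * C) > 0" using e C by simp
    obtain d where d: "d > 0" "\<And>x y. x \<in> ball (snd c q) d \<Longrightarrow> y \<in> ball (snd c q) d \<Longrightarrow>
      norm ((local_rep c c f x - D x) - (local_rep c c f y - D y)) \<le> e / (C * C) * norm (x - y)"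
      using strict[OF e'] by blast
    have "norm ((F x - L x) - (F y - L y)) \<le> e * norm (x - y)" if xy: "x \<in> ball 0 (d / C)" "y \<in> ball 0 (d / C)" for x y
    proof -
      define X Y where "X = snd c q + inv P x" and "Y = snd c q + inv P y"
      have "C * norm x < d" "C * norm y < d" using xy C(1) by (simp_all add: field_simps)
      then have "norm (inv P x) < d" "norm (inv P y) < d" using Ci[of x] Ci[of y] by linarith+
      then have XY: "X \<in> ball (snd c q) d" "Y \<in> ball (snd c q) d" by (auto simp: X_def Y_def dist_norm)
      have "(F x - L x) - (F y - L y) = P ((local_rep c c f X - D X) - (local_rep c c f Y - D Y))"
        unfolding F_def L_def X_def Y_def
        by (simp add: linear_diff[OF P(1)] linear_add[OF P(1)] linear_add[OF lD] algebra_simps)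
      then have "norm ((F x - L x) - (F y - L y)) \<le> C * norm ((local_rep c c f X - D X) - (local_rep c c f Y - D Y))"
        using C(2) by simp
      also have "\<dots> \<le> C * (e / (C * C) * norm (X - Y))"
        using mult_left_mono[OF d(2)[OF XY], of C] C(1) by (simp only: less_imp_le)
      also have "X - Y = inv P (x - y)" by (simp add: X_def Y_def linear_diff[OF invP(1)])
      also have "C * (e / (C * C) * norm (inv P (x - y))) \<le> C * (e / (C * C) * (C * norm (x - y)))"
        using Ci C(1) e by (intro mult_left_mono) auto
      also have "\<dots> = e * norm (x - y)" using C(1) by (simp add: field_simps)
      finally show ?thesis .
    qed
    then show ?thesis using d(1) C(1) by (intro exI[of _ "d / C"]) simp
  qed
  obtain Ft Gt r k where ext: "homeo_pair UNIV Ft Gt" "r > 0" "\<And>y. y \<in> cball 0 r \<Longrightarrow> Ft y = F y"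
    "0 \<le> k" "k < 1" "\<And>y. norm (Ft y) \<le> k * norm y"
    using sink_germ_extension[OF L Ln \<kappa>(1,2) F0 strictF] by blast
  let ?X = "S - {p}"
  have "openin (top_of_set S) ((fst c \<inter> f -` fst c) \<inter> ?X)"
    by (rule openin_Int[OF openin_chart_preimage[OF c(1) c(1) cont_f fS] openin_diff_finite]) simp
  moreover have "q \<in> (fst c \<inter> f -` fst c) \<inter> ?X" using c q by auto
  ultimately obtain r1 where r1: "r1 > 0" "cball 0 r1 \<subseteq> \<psi> ` fst c"
    "\<phi> ` cball 0 r1 \<subseteq> (fst c \<inter> f -` fst c) \<inter> ?X" using small_ball by blast
  \<comment> \<open>Within r the extension agrees with the germ; within r1 a point and its image
    stay in the chart and the point differs from p. The ball is invariant under the extension, so V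
    is invariant under f.\<close>
  define r2 where "r2 = min r r1"
  have r2: "r2 > 0" "ball (0::real^2) r2 \<subseteq> cball 0 r" "ball (0::real^2) r2 \<subseteq> cball 0 r1"
    using ext(2) r1(1) by (auto simp: r2_def)
  define V where "V = \<phi> ` ball 0 r2"
  have b: "ball 0 r2 \<subseteq> \<psi> ` fst c" using r2(3) r1(2) by blast
  have V: "V = {x \<in> fst c. norm (\<psi> x) < r2}" unfolding V_def \<phi>_image_eq[OF b] by simp
  have VX: "V \<subseteq> fst c \<inter> f -` fst c" "V \<subseteq> ?X"
    using order_trans[OF image_mono[OF r2(3)] r1(3)] unfolding V_def by blast+
  have Vop: "openin (top_of_set S) V" unfolding V_def by (rule openin_\<phi>_image[OF open_ball b])
  have conj: "\<psi> (f x) = Ft (\<psi> x)" if "x \<in> V" for x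
  proof -
    have "\<psi> x \<in> ball 0 r2" "x \<in> fst c" using that by (auto simp: V)
    then show ?thesis using ext(3)[of "\<psi> x"] F\<psi> r2(2) by (metis subsetD)
  qed
  have Ftball: "norm (Ft y) < r2" if "norm y < r2" for y
  proof -
    have "norm (Ft y) \<le> 1 * norm y" using ext(6)[of y] ext(5) by (meson less_imp_le mult_right_mono norm_ge_zero order_trans)
    then show ?thesis using that by simp
  qed
  have "?X homeomorphic (UNIV :: (real^2) set)"
  proof (rule germ_conjugacy_homeomorphic)
    show "homeo_pair ?X f h"
    proof
      have "h p = p" using g_f[OF p(1)] p(2) by simp
      then show "x \<in> ?X \<Longrightarrow> f x \<in> ?X" "x \<in> ?X \<Longrightarrow> h x \<in> ?X" for x
        using f_in g_in g_f f_g p(2) by (auto; metis)+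
    qed (auto intro: continuous_on_subset[OF cont_f] continuous_on_subset[OF cont_g] simp: g_f f_g)
    show "homeo_pair UNIV Ft Gt" by (rule ext(1))
    show "openin (top_of_set ?X) V" using Vop VX(2) by (rule openin_subset_trans) blast
    show "f ` V \<subseteq> V" using VX(1) conj Ftball by (auto simp: V)
    show "\<exists>n. (f ^^ n) x \<in> V" if x: "x \<in> ?X" for x
    proof -
      obtain e where e: "e > 0" "ball q e \<inter> S \<subseteq> V"
        using Vop p_in_\<phi>_ball[OF r2(1)] unfolding V_def[symmetric] openin_contains_ball by blast
      then obtain n where "dist ((f ^^ n) x) q < e" using conv[OF x] unfolding lim_sequentially by blast
      then show ?thesis using e(2) fn_in[of x n] x by (auto simp: dist_commute intro!: exI[of _ n])
    qed
    show "openin (top_of_set UNIV) (ball (0::real^2) r2)" by simp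
    show "Ft ` ball 0 r2 \<subseteq> ball 0 r2" using Ftball by auto
    show "\<exists>n. (Ft ^^ n) y \<in> ball 0 r2" for y
    proof -
      have n: "norm ((Ft ^^ n) y) \<le> k ^ n * norm y" for n
      proof (induction n)
        case (Suc n)
        then show ?case using ext(6)[of "(Ft ^^ n) y"] mult_left_mono[OF Suc ext(4)] by (simp add: mult.assoc)
      qed simp
      have "(\<lambda>n. k ^ n * norm y) \<longlonglongrightarrow> 0 * norm y"
        using ext(4,5) by (intro tendsto_mult LIMSEQ_realpow_zero tendsto_const)
      then obtain n where "k ^ n * norm y < r2"
        using r2(1) order_tendstoD(2)[of _ "0 * norm y" sequentially r2]
        by (auto simp: eventually_sequentially)
      then show ?thesis using n[of n] by (intro exI[of _ n]) simp
    qed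
    show "homeomorphism V (ball 0 r2) \<psi> \<phi>"
    proof (rule homeomorphism_of_subsets[OF hom])
      show "V \<subseteq> fst c" using VX by blast
      show "ball 0 r2 \<subseteq> \<psi> ` fst c" by (rule b)
      show "\<psi> ` V = ball 0 r2" unfolding V_def using b \<psi>_\<phi> by (force simp: image_image)
    qed
    show "\<psi> (f x) = Ft (\<psi> x)" if "x \<in> V" for x by (rule conj[OF that])
  qed
  then show ?thesis using punctured_plane_imp_sphere[OF S p(1)] by blast
qed

end

theorem corollary1:
  fixes S :: "'a::metric_space set" and A :: "'a chart set" and f :: "'a \<Rightarrow> 'a"
  assumes "compact S" and "connected S" and "S \<noteq> {}" and "surface_atlas S A"
    and "morse_smale S A f"
    and "gen_entropy S f = growth_class (\<lambda>n. real n)"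
  shows "S homeomorphic sphere (0::real^3) 1 \<and> north_south S A f"
proof -
  interpret surface S A using assms(4) by unfold_locales
  define h where "h = inv_into S f"
  let ?\<Omega> = "nonwandering S f"
  have bij: "bij_betw f S S" and C1: "C1_map S A f" "C1_map S A h"
    and fin: "finite ?\<Omega>" and hyp: "\<And>p. p \<in> periodic_points S f \<Longrightarrow> hyperbolic_periodic A f p"
    using assms(5) by (auto simp: morse_smale_def diffeo_def h_def)
  have fS: "f ` S = S" and inj: "inj_on f S" using bij by (auto simp: bij_betw_def)
  interpret homeo_pair S f h
  proof
    show "continuous_on S f" "continuous_on S h" using C1 by (auto simp: C1_map_def)
    show "f x \<in> S" "h x \<in> S" "h (f x) = x" "f (h x) = x" if "x \<in> S" for x
      using that fS inj by (auto simp: h_def inv_into_into f_inv_into_f)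
  qed
  have \<Omega>S: "?\<Omega> \<subseteq> S" by (rule nonwandering_subset)
  have proper: "\<exists>m0. \<forall>m\<ge>m0. ((f ^^ n) ^^ m) ` K \<inter> K = {}"
    if K: "compact K" "K \<subseteq> S" "K \<inter> ?\<Omega> = {}" and n: "n \<ge> 1" for K n
  proof -
    obtain m0 where "\<And>m. m \<ge> m0 \<Longrightarrow> (f ^^ m) ` K \<inter> K = {}"
      using linear_entropy_imp_proper_on_wandering[OF assms(1,6) K] by blast
    moreover have "n * m \<ge> m0" if "m \<ge> m0" for m using that n by (metis le_trans mult_le_mono1 nat_mult_1)
    ultimately show ?thesis unfolding funpow_mult by blast
  qed
  have eig: "norm \<mu> \<noteq> 1"
    if "p \<in> S" "(f ^^ n) p = p" "n \<ge> 1" "c \<in> A" "p \<in> fst c"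
      "complex_eigenvalue (matrix (frechet_derivative (local_rep c c (f ^^ n)) (at (snd c p)))) \<mu>" for p n c \<mu>
    using hyp[of p] that unfolding periodic_points_def hyperbolic_periodic_def fixpoint_eigenvalue_def by blast
  \<comment> \<open>Stated for every n that fixes the non-wandering set pointwise, because it is
    used twice: with the common period N to find p and q, and with n = 1 to obtain the eigenvalues
    of f.\<close>
  have dichotomy: "attracts S (f ^^ n) p \<and> (\<forall>\<mu>. complex_eigenvalue
        (matrix (frechet_derivative (local_rep c c (f ^^ n)) (at (snd c p)))) \<mu> \<longrightarrow> norm \<mu> < 1) \<or>
      attracts S (h ^^ n) p \<and> (\<forall>\<mu>. complex_eigenvalue
        (matrix (frechet_derivative (local_rep c c (f ^^ n)) (at (snd c p)))) \<mu> \<longrightarrow> norm \<mu> > 1)"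
    if n: "n \<ge> 1" "\<And>x. x \<in> ?\<Omega> \<Longrightarrow> (f ^^ n) x = x" and p: "p \<in> ?\<Omega>" and c: "c \<in> A" "p \<in> fst c" for n p c
  proof (rule hyperbolic_fixed_point_cases[OF C1(1) iterate c _ _ fin])
    show "(f ^^ n) p = p" using n(2) p by blast
    show "norm \<mu> \<noteq> 1" if
      "complex_eigenvalue (matrix (frechet_derivative (local_rep c c (f ^^ n)) (at (snd c p)))) \<mu>" for \<mu>
      using eig that n p c \<Omega>S by blast
    show "x \<in> S \<and> (f ^^ n) x = x" if "x \<in> ?\<Omega>" for x using that n(2) \<Omega>S by blast
  qed (rule proper[OF _ _ _ n(1)])
  have punctured: "\<exists>D. openin (top_of_set S) D \<and> p \<in> D \<and> D \<subseteq> U \<and> connected (D - {p}) \<and> infinite (D - {p})"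
    if p: "p \<in> S" and U: "openin (top_of_set S) U" "p \<in> U" for p U
  proof -
    obtain c where c: "c \<in> A" "p \<in> fst c" using chart_at p by blast
    have lin: "linear (id :: real^2 \<Rightarrow> real^2)" by (simp add: linear_iff)
    show ?thesis
    proof (rule local_coord.punctured_nbhd[OF local_coord_chart[OF c lin bij_id] U])
      fix D assume "openin (top_of_set S) D" "p \<in> D" "D \<subseteq> U" "connected (D - {p})" "infinite (D - {p})"
      then show ?thesis by blast
    qed
  qed
  have dense: "U \<inter> (S - ?\<Omega>) \<noteq> {}" if p: "p \<in> S" and U: "openin (top_of_set S) U" "p \<in> U" for p U
  proof -
    obtain D where D: "D \<subseteq> U" "infinite (D - {p})" using punctured[OF p U] by blast
    have "\<not> D - {p} \<subseteq> ?\<Omega>" using D(2) fin finite_subset by blast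
    then show ?thesis using D(1) openin_imp_subset[OF U(1)] by blast
  qed
  have W: "connected (S - ?\<Omega>)"
  proof (rule connected_delete_finite[OF assms(2) fin])
    show "\<exists>D. openin (top_of_set S) D \<and> p \<in> D \<and> D \<subseteq> U \<and> connected (D - {p}) \<and> D - {p} \<noteq> {}"
      if "p \<in> S" "openin (top_of_set S) U" "p \<in> U" for p U
      using punctured[OF that] by (metis finite.emptyI)
  qed
  have W0: "S - ?\<Omega> \<noteq> {}"
  proof -
    obtain x where "x \<in> S" using assms(3) by blast
    then show ?thesis using dense[of x S] by auto
  qed
  have conv: "\<exists>p\<in>?\<Omega>. (\<lambda>k. ((f ^^ n) ^^ k) x) \<longlonglongrightarrow> p" "\<exists>p\<in>?\<Omega>. (\<lambda>k. ((h ^^ n) ^^ k) x) \<longlonglongrightarrow> p"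
    if n: "n \<ge> 1" "\<And>x. x \<in> ?\<Omega> \<Longrightarrow> (f ^^ n) x = x" and x: "x \<in> S" for n x
  proof -
    have mono: "strict_mono (\<lambda>k. n * r k)" if "strict_mono r" for r :: "nat \<Rightarrow> nat"
      using that n(1) by (simp add: strict_mono_def)
    have "z \<in> ?\<Omega>" if "strict_mono r" "z \<in> S" "(\<lambda>k. ((f ^^ n) ^^ r k) x) \<longlonglongrightarrow> z" for z r
      using limit_point_nonwandering[OF x mono[OF that(1)] that(2)] that(3) by (simp add: funpow_mult)
    then show "\<exists>p\<in>?\<Omega>. (\<lambda>k. ((f ^^ n) ^^ k) x) \<longlonglongrightarrow> p"
      using homeo_pair.orbit_converges[OF iterate[of n] assms(1) fin \<Omega>S n(2) _ x] by metis
    have "z \<in> ?\<Omega>" if "strict_mono r" "z \<in> S" "(\<lambda>k. ((h ^^ n) ^^ r k) x) \<longlonglongrightarrow> z" for z r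
      using homeo_pair.limit_point_nonwandering[OF inverse x mono[OF that(1)] that(2)] that(3)
      by (simp add: funpow_mult nonwandering_inverse)
    moreover have "(h ^^ n) y = y" if "y \<in> ?\<Omega>" for y
      using gn_fn[of y n] n(2)[OF that] \<Omega>S that by auto
    ultimately show "\<exists>p\<in>?\<Omega>. (\<lambda>k. ((h ^^ n) ^^ k) x) \<longlonglongrightarrow> p"
      using homeo_pair.orbit_converges[OF homeo_pair.inverse[OF iterate[of n]] assms(1) fin \<Omega>S _ _ x] by metis
  qed
  obtain N where N: "N \<ge> 1" "\<And>x. x \<in> ?\<Omega> \<Longrightarrow> (f ^^ N) x = x" using finite_nonwandering_period[OF fin] by blast
  have "\<exists>p q. p \<noteq> q \<and> ?\<Omega> = {p, q} \<and> (\<forall>x\<in>S - ?\<Omega>. (\<lambda>k. ((f ^^ N) ^^ k) x) \<longlonglongrightarrow> q \<and> (\<lambda>k. ((h ^^ N) ^^ k) x) \<longlonglongrightarrow> p)"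
  proof (rule homeo_pair.source_sink_dynamics[OF iterate fin \<Omega>S])
    show "attracts S (f ^^ N) p \<or> attracts S (h ^^ N) p" if p: "p \<in> ?\<Omega>" for p
    proof -
      obtain c where "c \<in> A" "p \<in> fst c" using chart_at p \<Omega>S by blast
      then show ?thesis using dichotomy[OF N p] by blast
    qed
  qed (use conv[OF N] W W0 dense \<Omega>S in auto)
  then obtain p q where pq: "p \<noteq> q" "?\<Omega> = {p, q}"
    and lim: "\<And>x. x \<in> S - ?\<Omega> \<Longrightarrow> (\<lambda>k. ((f ^^ N) ^^ k) x) \<longlonglongrightarrow> q" "\<And>x. x \<in> S - ?\<Omega> \<Longrightarrow> (\<lambda>k. ((h ^^ N) ^^ k) x) \<longlonglongrightarrow> p"
    by blast
  have pqS: "p \<in> S" "q \<in> S" using pq(2) \<Omega>S by auto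
  obtain x0 where x0: "x0 \<in> S - ?\<Omega>" using W0 by blast
  have fx0: "f x0 \<in> S - ?\<Omega>"
  proof -
    have "x0 \<in> ?\<Omega>" if "f x0 \<in> ?\<Omega>"
      using homeo_pair.f_nonwandering[OF inverse, of "f x0"] that x0 g_f[of x0] nonwandering_inverse by simp
    then show ?thesis using x0 f_in by blast
  qed
  have hx0: "h x0 \<in> S - ?\<Omega>"
    using f_nonwandering[of "h x0"] x0 f_g[of x0] g_in by auto
  have comm: "(u ^^ k) (u1 x) = u1 ((u ^^ k) x)" if "u = u1 ^^ N" for u u1 :: "'a \<Rightarrow> 'a" and k x
    unfolding that funpow_mult by (simp add: funpow_swap1)
  \<comment> \<open>The orbit of \<open>f x0\<close> under \<open>f ^^ N\<close> is the image under
    f of that of x0. It tends to \<open>f q\<close> by continuity, and to q because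
    \<open>f x0\<close> is again off the non-wandering set.\<close>
  have fq: "f q = q"
  proof -
    have "(\<lambda>k. f (((f ^^ N) ^^ k) x0)) \<longlonglongrightarrow> f q"
      by (rule continuous_on_tendsto_compose[OF cont_f lim(1)[OF x0] pqS(2)])
        (use homeo_pair.fn_in[OF iterate] x0 in auto)
    then show ?thesis using lim(1)[OF fx0] LIMSEQ_unique unfolding comm[OF refl] by blast
  qed
  have "h p = p"
  proof -
    have "(\<lambda>k. h (((h ^^ N) ^^ k) x0)) \<longlonglongrightarrow> h p"
      by (rule continuous_on_tendsto_compose[OF cont_g lim(2)[OF x0] pqS(1)])
        (use homeo_pair.gn_in[OF iterate] x0 in auto)
    then show ?thesis using lim(2)[OF hx0] LIMSEQ_unique unfolding comm[OF refl] by blast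
  qed
  then have fp: "f p = p" using f_g[OF pqS(1)] by simp
  have fix1: "(f ^^ 1) x = x" if "x \<in> ?\<Omega>" for x using that pq(2) fp fq by auto
  have sub: "strict_mono (\<lambda>k::nat. N * k)" using N(1) by (simp add: strict_mono_def)
  \<comment> \<open>Now f fixes the non-wandering set, so the full orbit converges; its limit is
    identified along the multiples of N.\<close>
  have flim: "(\<lambda>n. (f ^^ n) x) \<longlonglongrightarrow> q" if x: "x \<in> S - ?\<Omega>" for x
  proof -
    obtain z where z: "(\<lambda>n. (f ^^ n) x) \<longlonglongrightarrow> z" using conv(1)[OF le_refl fix1, of x] x by auto
    from LIMSEQ_subseq_LIMSEQ[OF z sub] have "(\<lambda>k. ((f ^^ N) ^^ k) x) \<longlonglongrightarrow> z" by (simp add: funpow_mult o_def)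
    then have "z = q" using lim(1)[OF x] LIMSEQ_unique by blast
    then show ?thesis using z by simp
  qed
  have hlim: "(\<lambda>n. (h ^^ n) x) \<longlonglongrightarrow> p" if x: "x \<in> S - ?\<Omega>" for x
  proof -
    obtain z where z: "(\<lambda>n. (h ^^ n) x) \<longlonglongrightarrow> z" using conv(2)[OF le_refl fix1, of x] x by auto
    from LIMSEQ_subseq_LIMSEQ[OF z sub] have "(\<lambda>k. ((h ^^ N) ^^ k) x) \<longlonglongrightarrow> z" by (simp add: funpow_mult o_def)
    then have "z = p" using lim(2)[OF x] LIMSEQ_unique by blast
    then show ?thesis using z by simp
  qed
  \<comment> \<open>The point x0 differs from q and tends to it under f, so q does not attract under
    h; this selects the sink alternative of the dichotomy. The argument for p is the same with time
    reversed.\<close>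
  have nq: "\<not> attracts S h q"
    using attracts_inverse_no_stable_manifold[of q x0] flim[OF x0] x0 pq(2) by auto
  have np: "\<not> attracts S f p"
    using homeo_pair.attracts_inverse_no_stable_manifold[OF inverse, of p x0] hlim[OF x0] x0 pq(2) by auto
  have sink: "norm \<mu> < 1" if "c \<in> A" "q \<in> fst c"
    "complex_eigenvalue (matrix (frechet_derivative (local_rep c c f) (at (snd c q)))) \<mu>" for c \<mu>
    using dichotomy[OF le_refl fix1, of q c] that pq(2) nq by auto
  have source: "norm \<mu> > 1" if "c \<in> A" "p \<in> fst c"
    "complex_eigenvalue (matrix (frechet_derivative (local_rep c c f) (at (snd c p)))) \<mu>" for c \<mu>
    using dichotomy[OF le_refl fix1, of p c] that pq(2) np by auto
  have "north_south S A f" unfolding north_south_def h_def[symmetric]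
  proof (intro exI conjI ballI)
    show "p \<noteq> q" "?\<Omega> = {p, q}" by (fact pq)+
    show "fixed_source S A f p" using pqS fp source by (auto simp: fixed_source_def fixpoint_eigenvalue_def)
    show "fixed_sink S A f q" using pqS fq sink by (auto simp: fixed_sink_def fixpoint_eigenvalue_def)
    show "(\<lambda>n. (f ^^ n) x) \<longlonglongrightarrow> q" "(\<lambda>n. (h ^^ n) x) \<longlonglongrightarrow> p" if "x \<in> S - {p, q}" for x
      using flim hlim that pq(2) by auto
  qed
  moreover have "S homeomorphic sphere (0::real^3) 1"
  proof (rule basin_complement_point_imp_sphere[OF assms(1) homeo_pair_axioms C1 pqS(1) fp pqS(2) fq pq(1)])
    have fnq: "(f ^^ n) q = q" for n using fq by (induction n) auto
    show "(\<lambda>n. (f ^^ n) x) \<longlonglongrightarrow> q" if "x \<in> S - {p}" for x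
      using flim[of x] that pq(2) fnq by (cases "x = q") auto
  qed (rule sink)
  ultimately show ?thesis by blast
qed

end
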